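(* Let $p\in(0,1)$ be a constant. Then for every $\varepsilon>0$, $$\lim_{\substack{n\to\infty\\ n \text{ even}}}\ \mathbb{P}\Big(\chi_g^{\infty}(G_{n,p})\le (1+\varepsilon)\tfrac{pn}{2}\Big)=1.$$ Moreover, if $p=\frac1l$ for some $l\in\mathbb{N}$, then for every $\varepsilon>0$, $$\lim_{\substack{n\to\infty\\ n \text{ even}}}\ \mathbb{P}\Big(\big|\chi_g^{\infty}(G_{n,p})-\tfrac{pn}{2}\big|\le \varepsilon n\Big)=1.$$
   Context: $G_{n,p}$ is the Erdős–Rényi random graph on $n$ vertices, each edge present independently with probability $p$. The eternal vertex colouring game on a graph $G$ with colour set $\{1,\dots,k\}$ is played by Alice and Bob, who alternately choose vertices, Alice making the very first move; the game consists of rounds, and in each round every vertex is chosen exactly once. In the first round, a player chooses a vertex not yet coloured and assigns it a colour so that the resulting partial colouring is proper. In every later round, players keep alternating, each choosing a vertex not yet chosen in the current round and assigning it a colour different from its current colour such that the resulting colouring is proper; vertices keep their colour until recoloured. Bob wins if at some point the chosen vertex has no legal colour; Alice wins if the game continues indefinitely. $\chi_g^{\infty}(G)$ is the smallest $k$ for which Alice has a winning strategy. *)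

theory Defs
  imports "HOL-Probability.Probability" "HOL-Probability.Product_PMF"
begin

section \<open>The eternal vertex colouring game\<close>

text \<open>
  A finite simple graph is given by its vertex set \<open>V\<close> and its set \<open>E\<close> of edges, which are
  two-element subsets of \<open>V\<close>.
\<close>

definition all_edges :: "'a set \<Rightarrow> 'a set set" where
  "all_edges V = {e. e \<subseteq> V \<and> card e = 2}"

definition proper_colouring :: "'a set set \<Rightarrow> ('a \<rightharpoonup> nat) \<Rightarrow> bool" where
  "proper_colouring E f \<longleftrightarrow> (\<forall>u v c. {u, v} \<in> E \<longrightarrow> \<not> (f u = Some c \<and> f v = Some c))"

text \<open>
  A move \<open>(v, c)\<close> gives the vertex \<open>v\<close> the colour \<open>c\<close>.  A history lists the moves made so far,
  the most recent one first, so that \<^term>\<open>map_of h\<close> is the current partial colouring.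
  Every round consists of exactly \<^term>\<open>card V\<close> moves, hence the current round comprises the
  \<^term>\<open>length h mod card V\<close> most recent ones.
\<close>

type_synonym 'a history = "('a \<times> nat) list"

definition chosen_in_round :: "'a set \<Rightarrow> 'a history \<Rightarrow> 'a set" where
  "chosen_in_round V h = fst ` set (take (length h mod card V) h)"

definition available :: "'a set \<Rightarrow> 'a history \<Rightarrow> 'a set" where
  "available V h = V - chosen_in_round V h"

text \<open>
  The condition \<^prop>\<open>map_of h v \<noteq> Some c\<close> only matters from the second round on: in the first
  round the available vertices are exactly the uncoloured ones.
\<close>

definition legal_colour :: "'a set set \<Rightarrow> nat \<Rightarrow> 'a history \<Rightarrow> 'a \<Rightarrow> nat \<Rightarrow> bool" where
  "legal_colour E k h v c \<longleftrightarrow>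
     c \<in> {1..k} \<and> map_of h v \<noteq> Some c \<and> proper_colouring E ((map_of h)(v \<mapsto> c))"

definition legal_move :: "'a set \<Rightarrow> 'a set set \<Rightarrow> nat \<Rightarrow> 'a history \<Rightarrow> 'a \<times> nat \<Rightarrow> bool" where
  "legal_move V E k h m \<longleftrightarrow> fst m \<in> available V h \<and> legal_colour E k h (fst m) (snd m)"

text \<open>
  The histories that can arise when Alice follows the strategy \<open>\<sigma>\<close> and Bob plays arbitrarily.
  The players alternate throughout, also across rounds, so Alice is to move iff the number of
  moves made so far is even.
\<close>

inductive play ::
  "'a set \<Rightarrow> 'a set set \<Rightarrow> nat \<Rightarrow> ('a history \<Rightarrow> 'a \<times> nat) \<Rightarrow> 'a history \<Rightarrow> bool"
  for V E k \<sigma> where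
  start: "play V E k \<sigma> []"
| alice: "play V E k \<sigma> h \<Longrightarrow> even (length h) \<Longrightarrow> legal_move V E k h (\<sigma> h) \<Longrightarrow> play V E k \<sigma> (\<sigma> h # h)"
| bob: "play V E k \<sigma> h \<Longrightarrow> odd (length h) \<Longrightarrow> legal_move V E k h m \<Longrightarrow> play V E k \<sigma> (m # h)"

text \<open>
  The strategy wins iff the game never stops: Alice can always carry out the move it prescribes,
  and Bob is never able to choose a vertex that has no legal colour.
\<close>

definition winning_strategy ::
  "'a set \<Rightarrow> 'a set set \<Rightarrow> nat \<Rightarrow> ('a history \<Rightarrow> 'a \<times> nat) \<Rightarrow> bool" where
  "winning_strategy V E k \<sigma> \<longleftrightarrow>
     (\<forall>h. play V E k \<sigma> h \<longrightarrow>
        (even (length h) \<longrightarrow> legal_move V E k h (\<sigma> h)) \<and>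
        (odd (length h) \<longrightarrow> (\<forall>v\<in>available V h. \<exists>c. legal_colour E k h v c)))"

definition alice_wins :: "'a set \<Rightarrow> 'a set set \<Rightarrow> nat \<Rightarrow> bool" where
  "alice_wins V E k \<longleftrightarrow> (\<exists>\<sigma>. winning_strategy V E k \<sigma>)"

definition eternal_chi :: "'a set \<Rightarrow> 'a set set \<Rightarrow> nat" where
  "eternal_chi V E = (LEAST k. alice_wins V E k)"

text \<open>On a nonempty finite graph the minimum is attained, and players never run out of vertices.\<close>

lemma available_nonempty:
  assumes "finite V" "V \<noteq> {}"
  shows "available V h \<noteq> {}"
proof
  assume "available V h = {}"
  then have "V \<subseteq> chosen_in_round V h" by (auto simp: available_def)
  then have "card V \<le> card (chosen_in_round V h)"
    by (intro card_mono) (auto simp: chosen_in_round_def)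
  also have "\<dots> \<le> length (take (length h mod card V) h)"
    unfolding chosen_in_round_def
    by (metis card_length length_map set_map)
  also have "\<dots> \<le> length h mod card V" by simp
  also have "\<dots> < card V" using assms by (simp add: card_gt_0_iff)
  finally show False by simp
qed

lemma alice_wins_card:
  assumes "finite V" "V \<noteq> {}" "E \<subseteq> all_edges V"
  shows "alice_wins V E (Suc (card V))"
proof -
  let ?k = "Suc (card V)"
  define \<sigma> where "\<sigma> h = (SOME m. legal_move V E ?k h m)" for h
  have edge: "u \<noteq> v \<and> u \<in> V \<and> v \<in> V" if "{u, v} \<in> E" for u v
    using that assms(3) by (auto simp: all_edges_def card_2_iff doubleton_eq_iff)
  have inv: "proper_colouring E (map_of h)" if "play V E ?k \<sigma> h" for h
    using that
  proof induction
    case start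
    then show ?case by (simp add: proper_colouring_def)
  next
    case (alice h)
    then show ?case by (cases "\<sigma> h") (auto simp: legal_move_def legal_colour_def fun_upd_def)
  next
    case (bob h m)
    then show ?case by (cases m) (auto simp: legal_move_def legal_colour_def fun_upd_def)
  qed
  have ex: "\<exists>c. legal_colour E ?k h v c" if "play V E ?k \<sigma> h" "v \<in> V" for h v
  proof -
    let ?used = "(\<lambda>u. the (map_of h u)) ` V"
    have "card ?used \<le> card V" using assms(1) by (rule card_image_le)
    then have "\<not> {1..?k} \<subseteq> ?used"
      using card_mono[of ?used "{1..?k}"] assms(1) by auto
    then obtain c where c: "c \<in> {1..?k}" "c \<notin> ?used" by blast
    then have no: "map_of h u \<noteq> Some c" if "u \<in> V" for u
      using that by force
    have "proper_colouring E ((map_of h)(v \<mapsto> c))"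
      unfolding proper_colouring_def
    proof (intro allI impI)
      fix u w d assume e: "{u, w} \<in> E"
      show "\<not> (((map_of h)(v \<mapsto> c)) u = Some d \<and> ((map_of h)(v \<mapsto> c)) w = Some d)"
        using edge[OF e] no[of u] no[of w] inv[OF that(1)] e
        by (auto simp: proper_colouring_def)
    qed
    then show ?thesis using c no that by (auto simp: legal_colour_def)
  qed
  have "winning_strategy V E ?k \<sigma>"
    unfolding winning_strategy_def
  proof (intro allI impI conjI ballI)
    fix h assume p: "play V E ?k \<sigma> h"
    obtain v where v: "v \<in> available V h" using available_nonempty[OF assms(1,2)] by blast
    then obtain c where "legal_colour E ?k h v c"
      using ex[OF p] by (auto simp: available_def)
    with v have "legal_move V E ?k h (v, c)" by (simp add: legal_move_def)
    then show "legal_move V E ?k h (\<sigma> h)" unfolding \<sigma>_def by (rule someI)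
  next
    fix h v assume "play V E ?k \<sigma> h" "v \<in> available V h"
    then show "\<exists>c. legal_colour E ?k h v c" using ex by (auto simp: available_def)
  qed
  then show ?thesis by (auto simp: alice_wins_def)
qed


section \<open>The random graph\<close>

text \<open>
  The distribution of the edge set of $G_{n,p}$ on the vertex set \<^term>\<open>{..<n}\<close>: one independent
  Bernoulli variable for every potential edge.
\<close>

definition gnp :: "nat \<Rightarrow> real \<Rightarrow> nat set set pmf" where
  "gnp n p =
     map_pmf (\<lambda>f. {e \<in> all_edges {..<n}. f e})
       (Pi_pmf (all_edges {..<n}) False (\<lambda>_. bernoulli_pmf p))"

definition even_at_top :: "nat filter" where
  "even_at_top = inf at_top (principal {n. even n})"

end

theory Submission
  imports Defs "HOL-Probability.Hoeffding" "HOL-Real_Asymp.Real_Asymp"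
begin

text \<open>
  Upper bound.  Alice keeps a palette of \<open>\<eta> n\<close> colours for herself.  In a random graph only few
  vertices can see almost the whole palette at the same time, whatever the colouring, because most
  of its colour classes have bounded size; hence few vertices become endangered during a round, and
  Alice plays these first.  Otherwise she chooses her vertex by a potential that balances the two
  players in every neighbourhood, so that at the end of a round a vertex sees at most about
  \<open>pn/2\<close> of Bob's colours, besides the palette.

  Lower bound for \<open>p = 1/l\<close>.  Bob fixes a bounded number \<open>m\<close> of target vertices and splits the other
  vertices into atoms according to their adjacency to the targets.  Colours are assigned
  non-constant maps from the targets to \<open>{..<l}\<close>, equally often, and Bob puts each colour on one
  vertex of the atom of every fibre.  As \<open>p = 1/l\<close>, this needs only half of every atom, which is what
  Bob gets by replying to Alice in her atom.  If he succeeds, then all targets are stuck after the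
  first round, and Alice, who is then to move, cannot free all of them by recolouring one vertex,
  since no fibre is the whole set of targets.
\<close>

section \<open>Concentration\<close>

text \<open>The opponent shapes the colouring, so each property of the random graph must hold for
  all colourings at once. Bounded class sizes make this possible. A vertex misses a set of at most
  \<open>J\<close> other vertices with probability at least the constant \<open>(1 - p) ^ J\<close>;
  for linearly many vertices and linearly many disjoint sets of this kind, a deficit of missed pairs
  has probability \<open>exp (- c * n\<^sup>2)\<close>, while there are only
  \<open>exp (O(n * ln n))\<close> choices of vertices and sets. This estimate on
  \<open>dense_pair\<close> serves both players. Evenness of \<open>n\<close> makes Alice open and
  Bob close every round: Bob's trap needs Alice to move first into the second round, and Alice's
  potential is compared after pairs of moves. The value \<open>pn/2\<close> in Bob's part comes from
  counting. A set \<open>S\<close> of targets is a fibre of a random map to \<open>{..<l}\<close>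
  with probability \<open>l\<close> times the density of the atom of \<open>S\<close>, provided that
  \<open>p = 1/l\<close>. Thus \<open>k\<close> colours ask for about \<open>k * l\<close> times
  this density of vertices in every atom simultaneously, and Bob gets half of the atom, which is
  enough as long as \<open>k * l\<close> stays below \<open>n/2\<close>.\<close>

lemma finite_all_edges [simp]: "finite V \<Longrightarrow> finite (all_edges V)"
  unfolding all_edges_def by (rule finite_subset[of _ "Pow V"]) auto

lemma all_edgesD: "E \<subseteq> all_edges {..<n} \<Longrightarrow> {u, v} \<in> E \<Longrightarrow> u \<noteq> v \<and> u < n \<and> v < n"
  by (auto simp: all_edges_def card_2_iff doubleton_eq_iff)

abbreviation (input) gnp_prob :: "nat \<Rightarrow> real \<Rightarrow> nat set set set \<Rightarrow> real" where
  "gnp_prob n p \<equiv> measure_pmf.prob (gnp n p)"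

text \<open>The events depend on disjoint sets of potential edges, so their indicators are
  independent and Hoeffding's inequality applies. Prescribing present edges \<open>P i\<close> and
  absent edges \<open>N i\<close> together makes one bound serve atoms, missed sets and, via
  non-neighbours, degrees.\<close>

lemma gnp_lower_tail:
  fixes P N :: "'i \<Rightarrow> nat set set" and p q d :: real
  assumes p: "0 \<le> p" "p \<le> 1" and I: "finite I"
    and sub: "\<And>i. i \<in> I \<Longrightarrow> P i \<union> N i \<subseteq> all_edges {..<n}"
    and PN: "\<And>i. i \<in> I \<Longrightarrow> P i \<inter> N i = {}"
    and disj: "disjoint_family_on (\<lambda>i. P i \<union> N i) I"
    and q: "\<And>i. i \<in> I \<Longrightarrow> q \<le> p ^ card (P i) * (1 - p) ^ card (N i)"
    and d: "0 \<le> d"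
  shows "gnp_prob n p
     {E. real (card {i \<in> I. P i \<subseteq> E \<and> N i \<inter> E = {}}) \<le> (q - d) * real (card I)}
       \<le> exp (- 2 * d\<^sup>2 * real (card I))"
proof (cases "I = {}")
  case True
  then show ?thesis by simp
next
  case False
  define A where "A = all_edges {..<n}"
  have A: "finite A" by (simp add: A_def)
  define M where "M = Pi_pmf A False (\<lambda>_. bernoulli_pmf p)"
  define h where "h i g \<longleftrightarrow> (\<forall>e\<in>P i. g e) \<and> (\<forall>e\<in>N i. \<not> g e)" for i and g :: "nat set \<Rightarrow> bool"
  define X where "X i g = (of_bool (h i g) :: real)" for i g

  have finPN: "finite (P i \<union> N i)" if "i \<in> I" for i
    using sub[OF that] A finite_subset unfolding A_def by blast
  have "prob_space.indep_vars (measure_pmf M) (\<lambda>_. count_space UNIV) (\<lambda>x f. f x) A"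
    unfolding M_def by (rule indep_vars_Pi_pmf[OF A])
  then have "prob_space.indep_vars (measure_pmf M) (\<lambda>j. PiM (P j \<union> N j) (\<lambda>_. count_space UNIV))
      (\<lambda>j f. restrict (\<lambda>i. f i) (P j \<union> N j)) I"
    by (rule prob_space.indep_vars_restrict[OF prob_space_measure_pmf]) (use sub disj in \<open>auto simp: A_def\<close>)
  then have "prob_space.indep_vars (measure_pmf M) (\<lambda>_. borel) (\<lambda>i f. X i (restrict f (P i \<union> N i))) I"
  proof (rule prob_space.indep_vars_compose2[OF prob_space_measure_pmf])
    fix i assume i: "i \<in> I"
    have "Measurable.pred (PiM (P i \<union> N i) (\<lambda>_. count_space UNIV)) (\<lambda>f. h i f)"
      unfolding h_def
      by (intro pred_intros_logic pred_intros_finite) (use finPN[OF i] in auto)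
    then show "X i \<in> PiM (P i \<union> N i) (\<lambda>_. count_space UNIV) \<rightarrow>\<^sub>M borel"
      unfolding X_def by (auto simp: of_bool_def intro!: measurable_If)
  qed
  then have ind: "prob_space.indep_vars (measure_pmf M) (\<lambda>_. borel) X I"
    by (rule prob_space.indep_vars_cong[OF prob_space_measure_pmf, THEN iffD1, rotated -1]) (auto simp: X_def h_def fun_eq_iff)
  interpret H: Hoeffding_ineq "measure_pmf M" I X "\<lambda>_. 0" "\<lambda>_. 1" "\<Sum>i\<in>I. measure_pmf.expectation M (X i)"
    by unfold_locales (use I ind in \<open>auto simp: X_def\<close>)
  have ex: "measure_pmf.expectation M (X i) = p ^ card (P i) * (1 - p) ^ card (N i)" if i: "i \<in> I" for i
  proof -
    \<comment> \<open>The event is a product set, so its probability factors over the potential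
      edges.\<close>
    define B where "B e = (if e \<in> P i then {True} else if e \<in> N i then {False} else UNIV)" for e
    have AB: "{g. h i g} = Pi A B"
      using sub[OF i] PN[OF i] unfolding h_def B_def A_def Pi_def by (auto split: if_splits)
    have "measure_pmf.expectation M (X i) = measure_pmf.expectation M (indicat_real {g. h i g})"
      by (intro arg_cong[where f = "measure_pmf.expectation M"]) (auto simp: X_def fun_eq_iff)
    also have "\<dots> = measure_pmf.prob M {g. h i g}" by simp
    also have "\<dots> = (\<Prod>e\<in>A. measure_pmf.prob (bernoulli_pmf p) (B e))"
      unfolding AB M_def by (rule measure_Pi_pmf_Pi[OF A])
    also have "\<dots> = (\<Prod>e\<in>A. (if e \<in> P i then p else 1) * (if e \<in> N i then 1 - p else 1))"
      using p PN[OF i] by (intro prod.cong) (auto simp: B_def measure_pmf_single)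
    also have "\<dots> = p ^ card (P i) * (1 - p) ^ card (N i)"
      using sub[OF i] A unfolding A_def[symmetric]
      by (simp add: prod.distrib prod.If_cases Int_absorb1)
    finally show ?thesis .
  qed
  have "q * card I \<le> (\<Sum>i\<in>I. measure_pmf.expectation M (X i))"
    using sum_mono[of I "\<lambda>_. q" "\<lambda>i. measure_pmf.expectation M (X i)"] q ex by (simp add: mult.commute)
  then have *: "(q - d) * card I \<le> (\<Sum>i\<in>I. measure_pmf.expectation M (X i)) - d * card I"
    by (simp add: algebra_simps)
  have cnt: "real (card {i \<in> I. P i \<subseteq> {e \<in> A. g e} \<and> N i \<inter> {e \<in> A. g e} = {}}) = (\<Sum>i\<in>I. X i g)" for g
  proof -
    have "{i \<in> I. P i \<subseteq> {e \<in> A. g e} \<and> N i \<inter> {e \<in> A. g e} = {}} = {i \<in> I. h i g}"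
      using sub unfolding h_def A_def by blast
    then show ?thesis using I by (simp add: X_def of_bool_def sum.If_cases Int_def)
  qed
  have "gnp_prob n p
     {E. real (card {i \<in> I. P i \<subseteq> E \<and> N i \<inter> E = {}}) \<le> (q - d) * real (card I)}
     = measure_pmf.prob M {g. (\<Sum>i\<in>I. X i g) \<le> (q - d) * real (card I)}"
    unfolding gnp_def A_def[symmetric] M_def[symmetric] by (simp add: vimage_def cnt)
  also have "\<dots> \<le> measure_pmf.prob M {g. (\<Sum>i\<in>I. X i g) \<le> (\<Sum>i\<in>I. measure_pmf.expectation M (X i)) - d * card I}"
    by (rule measure_pmf.finite_measure_mono) (use * in auto)
  also have "\<dots> \<le> exp (- 2 * (d * card I)\<^sup>2 / (\<Sum>i\<in>I. (1 - 0)\<^sup>2))"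
    using H.Hoeffding_ineq_le[of "d * card I"] False I d by (simp add: card_gt_0_iff)
  also have "\<dots> = exp (- 2 * d\<^sup>2 * real (card I))"
    using False I by (simp add: power2_eq_square field_simps)
  finally show ?thesis .
qed

lemma gnp_support: "E \<in> set_pmf (gnp n p) \<Longrightarrow> E \<subseteq> all_edges {..<n}"
  by (auto simp: gnp_def)

section \<open>Bob's tasks in the first round\<close>

definition nbrs :: "'a set set \<Rightarrow> 'a set \<Rightarrow> 'a set" where
  "nbrs E Y = {x. \<exists>y\<in>Y. {x, y} \<in> E}"

text \<open>Used to charge Bob's moves: raising one summand pays for raising a counter by one, even
  if the index set grows at the same time.\<close>

lemma sum_strict_step:
  fixes g h :: "'i \<Rightarrow> nat"
  assumes "finite A" "A \<subseteq> A'" "finite A'" "\<And>i. i \<in> A \<Longrightarrow> g i \<le> h i" "j \<in> A" "g j < h j"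
  shows "Suc (sum g A) \<le> sum h A'"
proof -
  have "sum g A < sum h A"
    using assms by (intro sum_strict_mono_ex1) auto
  also have "\<dots> \<le> sum h A'" using assms by (intro sum_mono2) auto
  finally show ?thesis by simp
qed

text \<open>
  A task \<open>S \<in> tk c\<close> asks for a vertex of colour \<open>c\<close> in the region \<open>R S\<close>.  The danger is that Alice makes
  the free part of a region adjacent to the whole class of an unfinished colour.  For bounded
  classes this can happen to few disjoint sets only (assumption \<open>few_bad\<close>), so that all sets that are
  about to block a region are met by a small set \<open>hs F\<close>, which grows during the play.  Bob colours
  the vertices of this set and completes their colours as soon as they appear, and he keeps the
  classes of unfinished colours bounded by replying in the colour that Alice has just used.
\<close>

locale task_game =
  fixes E :: "'a set set" and W :: "'a set" and R :: "'s \<Rightarrow> 'a set" and SS :: "'s set"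
    and tk :: "nat \<Rightarrow> 's set" and ok :: "'a \<Rightarrow> nat \<Rightarrow> bool"
    and k m C \<rho> \<kappa> \<beta> B r0 Q :: nat
  assumes W: "finite W" and SS: "finite SS"
    and R_sub: "\<And>S. S \<in> SS \<Longrightarrow> R S \<subseteq> W"
    and R_disj: "\<And>S S' x. S \<in> SS \<Longrightarrow> S' \<in> SS \<Longrightarrow> x \<in> R S \<Longrightarrow> x \<in> R S' \<Longrightarrow> S = S'"
    and tk_sub: "\<And>c. tk c \<subseteq> SS" and tk_card: "\<And>c. card (tk c) \<le> m"
    and tk_ok: "\<And>c S x. S \<in> tk c \<Longrightarrow> x \<in> R S \<Longrightarrow> ok x c"
    and few_bad: "\<And>S U F. \<lbrakk>S \<in> SS; U \<subseteq> R S; \<beta> \<le> card U; pairwise disjnt F;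
        \<And>Y. Y \<in> F \<Longrightarrow> Y \<subseteq> W \<and> card Y \<le> C + 3 \<and> card (U - nbrs E Y) < \<rho>\<rbrakk> \<Longrightarrow> card F \<le> \<kappa>"
    and rho_beta: "\<rho> \<le> \<beta>" and C: "2 * m \<le> C"
    and Q: "(m + 1) * (card SS * (\<kappa> * (C + 3)) * (m + 1)) \<le> Q"
    and rho: "2 * Q + 4 \<le> \<rho>" and B: "2 * (r0 + Q) + \<beta> \<le> B"
    and r0: "\<And>x. x * (C + 1 - 2 * m) \<le> card W \<Longrightarrow> x * m \<le> r0"
begin

abbreviation "N \<equiv> nbrs E"

definition free where "free S f = {x \<in> R S. f x = None}" for f :: "'a \<Rightarrow> nat option"
definition cls where "cls c f = {x \<in> W. f x = Some c}" for f :: "'a \<Rightarrow> nat option"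
definition und where "und f c = {S \<in> tk c. \<forall>x\<in>R S. f x \<noteq> Some c}" for f :: "'a \<Rightarrow> nat option"
definition inc where "inc f c \<longleftrightarrow> c \<in> {1..k} \<and> und f c \<noteq> {}"
definition tn where "tn f S = card {c \<in> {1..k}. S \<in> und f c}"
definition act where "act f S \<longleftrightarrow> S \<in> SS \<and> (\<exists>c\<in>{1..k}. S \<in> und f c)"
definition phi where "phi f c = card (cls c f) + 2 * card (und f c)"
definition legal where
  "legal f x c \<longleftrightarrow> x \<in> W \<and> f x = None \<and> c \<in> {1..k} \<and> x \<notin> N (cls c f) \<and> ok x c"

text \<open>
  The bookkeeping of the invariant: \<open>F S\<close> is a disjoint family of sets that almost block \<open>R S\<close>, and
  \<open>H0\<close> is the part of \<open>hs F\<close> that had been dealt with when last nothing was pending.  Among Bob's moves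
  that do not answer Alice in her region, \<open>s\<close> deal with a vertex of \<open>hs F\<close>, \<open>q\<close> are replies in a colour
  of \<open>G\<close> made while something is pending, and \<open>r\<close> are the other replies to a large colour class.  The set
  \<open>G\<close> contains the large colours whose touch by Alice was ignored once in favour of \<open>hs F\<close>.  Finally
  \<open>phi\<close> does not change when Alice touches a colour and Bob replies with a task of the same colour.
\<close>

definition hs where "hs F = (\<Union>S\<in>SS. \<Union>(F S))" for F :: "'s \<Rightarrow> 'a set set"
definition sH where
  "sH F f = (\<Sum>x\<in>hs F. case f x of None \<Rightarrow> 0 | Some c \<Rightarrow> m + 1 - card (und f c))"
definition qG where "qG G f = (\<Sum>c\<in>G. m - card (und f c))" for G :: "nat set"
definition rC where "rC f = (\<Sum>c\<in>{c \<in> {1..k}. C + 1 - 2 * m \<le> card (cls c f)}. m - card (und f c))"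
definition bnd where
  "bnd F G f c = C + (if c \<in> G then 1 else 0) + (if \<exists>x\<in>hs F. f x = Some c then 1 else 0)"

lemma fin_tk: "finite (tk c)" using tk_sub SS finite_subset by blast
lemma fin_und: "finite (und f c)" unfolding und_def using fin_tk by auto
lemma und_le: "card (und f c) \<le> m"
  using card_mono[OF fin_tk, of "und f c" c] tk_card[of c] unfolding und_def by force
lemma fin_cls: "finite (cls c f)" unfolding cls_def using W by auto
lemma fin_free: "S \<in> SS \<Longrightarrow> finite (free S f)"
  unfolding free_def using R_sub W by (metis (no_types, lifting) finite_subset mem_Collect_eq subsetI)

definition fam where
  "fam f F \<longleftrightarrow> (\<forall>S\<in>SS. pairwise disjnt (F S) \<and> card (F S) \<le> \<kappa> \<and>
     (\<forall>Y\<in>F S. Y \<subseteq> W \<and> card Y \<le> C + 3 \<and> (act f S \<longrightarrow> card (free S f - N Y) < \<rho>)))"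

definition hit where
  "hit f F \<longleftrightarrow> (\<forall>S Y. act f S \<longrightarrow> Y \<subseteq> W \<longrightarrow> card Y \<le> C + 3 \<longrightarrow> Y \<inter> hs F = {} \<longrightarrow>
     \<rho> \<le> card (free S f - N Y))"

definition settled where
  "settled f H \<longleftrightarrow> (\<forall>x\<in>H. \<exists>c. f x = Some c \<and> und f c = {})" for H :: "'a set"

text \<open>The slack \<open>2 * (s + q) + 2\<close> counts vertices coloured since nothing was
  pending: the hitting property holds just before an exchange of two moves, and each further
  exchange made while something is pending raises \<open>s + q\<close>. In the last inequality, an
  exchange removes at most two free vertices of a region; either a finished task of that region or a
  counter pays for them.\<close>

definition invar0 where
  "invar0 f F H0 G s q r \<longleftrightarrow> fam f F \<and>
     H0 \<subseteq> hs F \<and> settled f H0 \<and> (\<forall>x\<in>W. \<forall>c. f x = Some c \<longrightarrow> c \<in> {1..k}) \<and>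
     (\<forall>S Y. act f S \<longrightarrow> Y \<subseteq> W \<longrightarrow> card Y \<le> C + 3 \<longrightarrow> Y \<inter> H0 = {} \<longrightarrow>
        \<rho> \<le> card (free S f - N Y) + 2 * (s + q) + 2) \<and>
     (\<forall>c. inc f c \<longrightarrow> phi f c \<le> bnd F G f c) \<and>
     finite G \<and> card G \<le> s \<and> q \<le> qG G f \<and> s \<le> sH F f \<and> r \<le> rC f \<and>
     (\<forall>S. act f S \<longrightarrow> 2 * tn f S + B \<le> card (free S f) + 2 * (r + s + q))"

definition invar where "invar f F H0 G s q r \<longleftrightarrow> invar0 f F H0 G s q r \<and> hit f F"

abbreviation "kept f \<equiv> \<exists>F H0 G s q r. invar f F H0 G s q r"

lemma famD:
  assumes "fam f F" "S \<in> SS"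
  shows "finite (F S)" "pairwise disjnt (F S)" "card (F S) \<le> \<kappa>"
    "Y \<in> F S \<Longrightarrow> Y \<subseteq> W" "Y \<in> F S \<Longrightarrow> card Y \<le> C + 3"
    "Y \<in> F S \<Longrightarrow> act f S \<Longrightarrow> card (free S f - N Y) < \<rho>"
  using assms W unfolding fam_def by (blast intro: finite_subset[of _ "Pow W"])+

lemma hs_sub: "fam f F \<Longrightarrow> hs F \<subseteq> W"
  unfolding hs_def using famD(4) by blast
lemma hs_fin: "fam f F \<Longrightarrow> finite (hs F)"
  using hs_sub W finite_subset by blast

lemma hs_card:
  assumes "fam f F"
  shows "card (hs F) \<le> card SS * (\<kappa> * (C + 3))"
proof -
  have "card (hs F) \<le> (\<Sum>S\<in>SS. card (\<Union>(F S)))"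
    unfolding hs_def by (rule card_UN_le[OF SS])
  also have "\<dots> \<le> (\<Sum>S\<in>SS. \<kappa> * (C + 3))"
  proof (rule sum_mono)
    fix S assume S: "S \<in> SS"
    have "card (\<Union>(F S)) \<le> (\<Sum>Y\<in>F S. card Y)"
      by (rule card_Union_le_sum_card)
    also have "\<dots> \<le> card (F S) * (C + 3)"
      using famD(5)[OF assms S] sum_bounded_above[of "F S" card "C + 3"] by simp
    also have "\<dots> \<le> \<kappa> * (C + 3)" using famD(3)[OF assms S] by simp
    finally show "card (\<Union>(F S)) \<le> \<kappa> * (C + 3)" .
  qed
  finally show ?thesis by simp
qed

lemma sH_le:
  assumes "fam f F"
  shows "sH F f \<le> card SS * (\<kappa> * (C + 3)) * (m + 1)"
proof -
  have "sH F f \<le> card (hs F) * (m + 1)"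
    unfolding sH_def by (rule order_trans[OF sum_bounded_above[where K = "m + 1"]]) (auto split: option.split)
  also have "\<dots> \<le> card SS * (\<kappa> * (C + 3)) * (m + 1)"
    using hs_card[OF assms] by (intro mult_right_mono) auto
  finally show ?thesis .
qed

lemma qG_le: "finite G \<Longrightarrow> qG G f \<le> m * card G"
  unfolding qG_def by (rule order_trans[OF sum_bounded_above[where K = m]]) auto

text \<open>Large classes are disjoint subsets of \<open>W\<close>, hence few, and each contributes
  at most one unit per finished task.\<close>

lemma rC_le: "rC f \<le> r0"
proof -
  let ?A = "{c \<in> {1..k}. C + 1 - 2 * m \<le> card (cls c f)}"
  have "card ?A * (C + 1 - 2 * m) \<le> (\<Sum>c\<in>?A. card (cls c f))"
    using sum_bounded_below[of ?A "C + 1 - 2 * m" "\<lambda>c. card (cls c f)"] by simp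
  also have "\<dots> = card (\<Union>c\<in>?A. cls c f)"
    by (rule card_UN_disjoint[symmetric]) (auto simp: fin_cls, auto simp: cls_def)
  also have "\<dots> \<le> card W" by (rule card_mono[OF W]) (auto simp: cls_def)
  finally have "card ?A * m \<le> r0" by (rule r0)
  moreover have "rC f \<le> card ?A * m"
    unfolding rC_def using sum_bounded_above[of ?A "\<lambda>c. m - card (und f c)" m] by simp
  ultimately show ?thesis by simp
qed

text \<open>Everything is charged to the hitting set: a vertex of \<open>hs F\<close> pays once for
  being coloured and once for each of the at most \<open>m\<close> tasks of its colour;
  \<open>G\<close> has at most \<open>s\<close> elements, and a colour of \<open>G\<close> pays for
  at most \<open>m\<close> replies.\<close>

lemma counters:
  assumes "invar0 f F H0 G s q r"
  shows "s + q \<le> Q" "r \<le> r0"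
proof -
  have fam: "fam f F" and G: "finite G" "card G \<le> s" and q: "q \<le> qG G f" and s: "s \<le> sH F f" and r: "r \<le> rC f"
    using assms unfolding invar0_def by auto
  have "q \<le> m * s" using q qG_le[OF G(1), of f] G(2) by (meson le_trans mult_le_mono2)
  then have "s + q \<le> (m + 1) * s" by simp
  also have "\<dots> \<le> (m + 1) * (card SS * (\<kappa> * (C + 3)) * (m + 1))"
    using s sH_le[OF fam] by (intro mult_left_mono) auto
  also note Q
  finally show "s + q \<le> Q" .
  show "r \<le> r0" using r rC_le le_trans by blast
qed

text \<open>The counters consume only part of the reserve \<open>B\<close>. This keeps
  \<open>few_bad\<close> applicable throughout the round and shows that no task is left open when
  all vertices are coloured.\<close>

lemma free_big:
  assumes "invar0 f F H0 G s q r" "act f S"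
  shows "\<beta> \<le> card (free S f)"
proof -
  have "2 * tn f S + B \<le> card (free S f) + 2 * (r + s + q)"
    using assms unfolding invar0_def by auto
  moreover have "r + s + q \<le> r0 + Q" using counters[OF assms(1)] by simp
  then have "2 * (r + s + q) \<le> 2 * (r0 + Q)" by simp
  ultimately show ?thesis using B by linarith
qed

text \<open>Take a family with the most sets among those compatible with the bookkeeping. A bounded
  set that almost blocks an active region and misses \<open>hs F\<close> could be added to it, as
  \<open>few_bad\<close> still bounds the size. The other conditions survive because
  \<open>bnd\<close> and \<open>sH\<close> grow with \<open>hs F\<close>.\<close>

lemma refresh:
  assumes "invar0 f F H0 G s q r"
  shows "\<exists>F'. invar f F' H0 G s q r"
proof -
  define P where "P F' \<longleftrightarrow> invar0 f F' H0 G s q r" for F' :: "'s \<Rightarrow> 'a set set"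
  define M where "M F' = (\<Sum>S\<in>SS. card (F' S))" for F' :: "'s \<Rightarrow> 'a set set"
  have bd: "M F' \<le> card SS * \<kappa>" if "P F'" for F'
    using that famD(3) sum_bounded_above[of SS "\<lambda>S. card (F' S)" \<kappa>]
    unfolding P_def invar0_def M_def by force
  have "\<exists>F'. P F' \<and> (\<forall>F''. P F'' \<longrightarrow> M F'' \<le> M F')"
    using ex_has_greatest_nat[of P F M "Suc (card SS * \<kappa>)"] assms bd unfolding P_def by force
  then obtain F' where F': "P F'" and mx: "\<And>F''. P F'' \<Longrightarrow> M F'' \<le> M F'" by blast
  have i0: "invar0 f F' H0 G s q r" using F' unfolding P_def .
  have fam: "fam f F'" using i0 unfolding invar0_def by auto
  have "hit f F'"
  proof (rule ccontr)
    assume "\<not> hit f F'"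
    then obtain S Y where S: "act f S" and Y: "Y \<subseteq> W" "card Y \<le> C + 3" "Y \<inter> hs F' = {}"
      and bad: "card (free S f - N Y) < \<rho>" unfolding hit_def by (auto simp: not_le)
    have SSS: "S \<in> SS" using S unfolding act_def by auto
    have big: "\<beta> \<le> card (free S f)" by (rule free_big[OF i0 S])
    \<comment> \<open>The empty set has no neighbours and leaves all of the at least
      \<open>\<beta>\<close> free vertices. So \<open>Y\<close> is nonempty and, missing
      \<open>hs F\<close>, not yet in the family.\<close>
    have "Y \<noteq> {}" using bad big rho_beta by (auto simp: nbrs_def)
    have YF: "Y \<notin> F' S"
      using Y(3) SSS \<open>Y \<noteq> {}\<close> unfolding hs_def by blast
    have pw: "pairwise disjnt (insert Y (F' S))"
      unfolding pairwise_insert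
    proof (intro conjI allI impI)
      show "pairwise disjnt (F' S)" by (rule famD(2)[OF fam SSS])
      fix y assume "y \<in> F' S \<and> y \<noteq> Y"
      then have "y \<subseteq> hs F'" using SSS unfolding hs_def by blast
      then show "disjnt Y y" "disjnt y Y" using Y(3) unfolding disjnt_def by blast+
    qed
    have c: "card (insert Y (F' S)) \<le> \<kappa>"
    proof (rule few_bad[OF SSS _ big pw])
      show "free S f \<subseteq> R S" unfolding free_def by auto
      fix Z assume "Z \<in> insert Y (F' S)"
      then show "Z \<subseteq> W \<and> card Z \<le> C + 3 \<and> card (free S f - N Z) < \<rho>"
        using famD(4-6)[OF fam SSS] Y bad S by blast
    qed
    define F'' where "F'' = F'(S := insert Y (F' S))"
    have "F' T \<subseteq> F'' T" for T unfolding F''_def by auto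
    then have hs: "hs F' \<subseteq> hs F''" unfolding hs_def by blast
    have fam'': "fam f F''"
      using fam pw c Y bad unfolding fam_def F''_def by auto
    have sub: "bnd F' G f d \<le> bnd F'' G f d" for d
      unfolding bnd_def using hs by auto
    have "sH F' f \<le> sH F'' f"
      unfolding sH_def by (rule sum_mono2[OF hs_fin[OF fam''] hs]) auto
    then have "P F''"
      using i0 fam'' hs sub unfolding P_def invar0_def by (meson le_trans subset_trans)
    then have "M F'' \<le> M F'" by (rule mx)
    moreover have "M F' < M F''" unfolding M_def F''_def
      using SSS SS YF famD(1)[OF fam SSS] by (intro sum_strict_mono_ex1) auto
    ultimately show False by simp
  qed
  then show ?thesis using i0 unfolding invar_def by blast
qed


section \<open>How colouring one vertex affects the quantities of the invariant\<close>

lemma upd_facts: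
  assumes "f x = None" "x \<in> W"
  shows "cls d (f(x \<mapsto> c)) = (if d = c then insert x (cls d f) else cls d f)"
    "x \<notin> cls d f"
    "und (f(x \<mapsto> c)) d = (if d = c then {S \<in> und f d. x \<notin> R S} else und f d)"
    "free S (f(x \<mapsto> c)) = free S f - {x}"
  using assms unfolding cls_def und_def free_def by auto

lemma und_mono: "f x = None \<Longrightarrow> x \<in> W \<Longrightarrow> und (f(x \<mapsto> c)) d \<subseteq> und f d"
  by (auto simp: upd_facts)

lemma inc_mono: "f x = None \<Longrightarrow> x \<in> W \<Longrightarrow> inc (f(x \<mapsto> c)) d \<Longrightarrow> inc f d"
  using und_mono[of f x c d] by (auto simp: inc_def)

lemma act_mono: "f x = None \<Longrightarrow> x \<in> W \<Longrightarrow> act (f(x \<mapsto> c)) S \<Longrightarrow> act f S"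
  using und_mono[of f x c] by (auto simp: act_def)

lemma card_und_mono: "f x = None \<Longrightarrow> x \<in> W \<Longrightarrow> card (und (f(x \<mapsto> c)) d) \<le> card (und f d)"
  by (intro card_mono fin_und und_mono)

lemma tn_mono: "f x = None \<Longrightarrow> x \<in> W \<Longrightarrow> tn (f(x \<mapsto> c)) S \<le> tn f S"
  unfolding tn_def using und_mono[of f x c] by (intro card_mono) auto

lemma fam_mono:
  assumes "f x = None" "x \<in> W" "fam f F"
  shows "fam (f(x \<mapsto> c)) F"
  unfolding fam_def
proof (intro ballI conjI impI)
  fix S assume S: "S \<in> SS"
  note * = famD[OF assms(3) S]
  show "pairwise disjnt (F S)" "card (F S) \<le> \<kappa>" using * by auto
  fix Y assume Y: "Y \<in> F S"
  show "Y \<subseteq> W" "card Y \<le> C + 3" using *(4,5)[OF Y] by auto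
  assume "act (f(x \<mapsto> c)) S"
  then have "card (free S f - N Y) < \<rho>" using *(6)[OF Y] act_mono[of f x, OF assms(1,2)] by auto
  moreover have "card (free S (f(x \<mapsto> c)) - N Y) \<le> card (free S f - N Y)"
    by (intro card_mono) (auto simp: upd_facts(4)[of f x, OF assms(1,2)] fin_free[OF S])
  ultimately show "card (free S (f(x \<mapsto> c)) - N Y) < \<rho>" by simp
qed

lemma settled_mono: "f x = None \<Longrightarrow> x \<in> W \<Longrightarrow> settled f H \<Longrightarrow> settled (f(x \<mapsto> c)) H"
  unfolding settled_def using und_mono[of f x c]
  by (metis fun_upd_other option.discI subset_empty)

lemma qG_mono: "f x = None \<Longrightarrow> x \<in> W \<Longrightarrow> qG G f \<le> qG G (f(x \<mapsto> c))"
  unfolding qG_def by (intro sum_mono diff_le_mono2 card_und_mono)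

lemma sH_term_mono:
  assumes "f x = None" "x \<in> W"
  shows "(case f y of None \<Rightarrow> 0 | Some c \<Rightarrow> m + 1 - card (und f c))
    \<le> (case (f(x \<mapsto> c)) y of None \<Rightarrow> 0 | Some c' \<Rightarrow> m + 1 - card (und (f(x \<mapsto> c)) c'))"
  using card_und_mono[of f x, OF assms] assms(1) by (cases "y = x") (auto split: option.split intro: diff_le_mono2)

lemma sH_mono: "f x = None \<Longrightarrow> x \<in> W \<Longrightarrow> sH F f \<le> sH F (f(x \<mapsto> c))"
  unfolding sH_def by (rule sum_mono) (rule sH_term_mono)

lemma cls_mono: "f x = None \<Longrightarrow> x \<in> W \<Longrightarrow> card (cls d f) \<le> card (cls d (f(x \<mapsto> c)))"
  by (intro card_mono fin_cls) (auto simp: upd_facts)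

lemma rC_mono: "f x = None \<Longrightarrow> x \<in> W \<Longrightarrow> rC f \<le> rC (f(x \<mapsto> c))"
  unfolding rC_def
  by (rule order_trans[OF sum_mono sum_mono2])
     (auto intro: diff_le_mono2 card_und_mono cls_mono order_trans)

lemma free_drop:
  assumes "f x = None" "x \<in> W" "S \<in> SS"
  shows "card (free S f) \<le> card (free S (f(x \<mapsto> c))) + (if x \<in> R S then 1 else 0)"
    "card (free S f - A) \<le> card (free S (f(x \<mapsto> c)) - A) + 1"
proof -
  have "card (free S f - A) \<le> card (insert x (free S (f(x \<mapsto> c)) - A))" for A
    by (rule card_mono) (auto simp: upd_facts(4)[of f x, OF assms(1,2)] fin_free[OF assms(3)])
  also have "card (insert x (free S (f(x \<mapsto> c)) - A)) \<le> card (free S (f(x \<mapsto> c)) - A) + 1" for A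
    using fin_free[OF assms(3)] by (auto simp: card_insert_if)
  finally have *: "card (free S f - A) \<le> card (free S (f(x \<mapsto> c)) - A) + 1" for A .
  then show "card (free S f - A) \<le> card (free S (f(x \<mapsto> c)) - A) + 1" .
  show "card (free S f) \<le> card (free S (f(x \<mapsto> c))) + (if x \<in> R S then 1 else 0)"
    using *[of "{}"] upd_facts(4)[of f x S c, OF assms(1,2)] by (auto simp: free_def)
qed

lemma phi_other: "f x = None \<Longrightarrow> x \<in> W \<Longrightarrow> d \<noteq> c \<Longrightarrow> phi (f(x \<mapsto> c)) d = phi f d"
  by (simp add: phi_def upd_facts)

lemma phi_le: "f x = None \<Longrightarrow> x \<in> W \<Longrightarrow> phi (f(x \<mapsto> c)) d \<le> phi f d + 1"
  using card_und_mono[of f x c d] fin_cls[of d f]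
  by (cases "d = c") (simp_all add: phi_def upd_facts(1,2))

lemma task_drop:
  assumes "f x = None" "x \<in> W" "S \<in> und f c" "x \<in> R S"
  shows "card (und (f(x \<mapsto> c)) c) < card (und f c)"
  using assms by (intro psubset_card_mono fin_und) (auto simp: upd_facts)

text \<open>The class gains one vertex, while at least one open task, of weight two,
  disappears.\<close>

lemma phi_task:
  assumes "f x = None" "x \<in> W" "S \<in> und f c" "x \<in> R S"
  shows "phi (f(x \<mapsto> c)) c + 1 \<le> phi f c"
  using task_drop[of f x, OF assms] fin_cls[of c f] assms by (simp add: phi_def upd_facts(1,2))

lemma bnd_mono:
  assumes "f x = None" "G \<subseteq> G'"
  shows "bnd F G f d \<le> bnd F G' (f(x \<mapsto> c)) d"
proof -
  have "(\<exists>y\<in>hs F. f y = Some d) \<Longrightarrow> (\<exists>y\<in>hs F. (f(x \<mapsto> c)) y = Some d)" using assms by force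
  then show ?thesis using assms(2) unfolding bnd_def by auto
qed

text \<open>Vertices of a settled set carry finished colours only, so the class of an unfinished
  colour avoids \<open>H\<close>; being bounded, it cannot block the region.\<close>

lemma place:
  assumes "inc f c" "S \<in> und f c" "settled f H" "H \<subseteq> W" "phi f c \<le> C + 3"
    "\<And>Y. Y \<subseteq> W \<Longrightarrow> card Y \<le> C + 3 \<Longrightarrow> Y \<inter> H = {} \<Longrightarrow> 0 < card (free S f - N Y)"
  shows "\<exists>x. legal f x c \<and> x \<in> R S"
proof -
  have S: "S \<in> tk c" using assms(2) unfolding und_def by auto
  have "cls c f \<inter> H = {}" using assms(1,3) unfolding settled_def cls_def inc_def by fastforce
  moreover have "card (cls c f) \<le> C + 3" using assms(5) unfolding phi_def by simp
  moreover have "cls c f \<subseteq> W" unfolding cls_def by auto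
  ultimately have "0 < card (free S f - N (cls c f))" by (intro assms(6)) auto
  then obtain x where "x \<in> free S f - N (cls c f)" by (metis card_gt_0_iff ex_in_conv)
  moreover have "S \<in> SS" using S tk_sub by auto
  ultimately show ?thesis
    using assms(1) R_sub tk_ok[OF S] unfolding legal_def free_def inc_def by blast
qed

text \<open>One exchange of moves. Bob can cure only one trouble per move, and an oversized colour
  may coincide with pending work on \<open>hs F\<close>. The colour is then excused once by entering
  \<open>G\<close>; if it becomes too large again while work is pending, it is answered at once and
  \<open>G\<close> pays for the reply.\<close>

lemma step:
  assumes invar: "invar f F H0 G s q r" and u: "u \<in> W" "f u = None" and a: "a \<in> {1..k}"
    and f1: "f1 = f(u \<mapsto> a)" and ex_inc: "\<exists>c. inc f1 c"
    and ex_legal: "\<And>x. x \<in> W \<Longrightarrow> f1 x = None \<Longrightarrow> \<exists>c. legal f1 x c"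
  shows "\<exists>x c. legal f1 x c \<and> kept (f1(x \<mapsto> c))"
proof -
  have i0: "invar0 f F H0 G s q r" and ihit: "hit f F" using invar unfolding invar_def by auto
  have fam: "fam f F" and H0: "H0 \<subseteq> hs F" "settled f H0"
    and col: "\<And>x c. x \<in> W \<Longrightarrow> f x = Some c \<Longrightarrow> c \<in> {1..k}"
    and i4: "\<And>S Y. act f S \<Longrightarrow> Y \<subseteq> W \<Longrightarrow> card Y \<le> C + 3 \<Longrightarrow> Y \<inter> H0 = {} \<Longrightarrow>
        \<rho> \<le> card (free S f - N Y) + 2 * (s + q) + 2"
    and i5: "\<And>c. inc f c \<Longrightarrow> phi f c \<le> bnd F G f c"
    and G: "finite G" "card G \<le> s" and q: "q \<le> qG G f" and s: "s \<le> sH F f" and r: "r \<le> rC f"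
    and i7: "\<And>S. act f S \<Longrightarrow> 2 * tn f S + B \<le> card (free S f) + 2 * (r + s + q)"
    using i0 unfolding invar0_def by auto
  have fam1: "fam f1 F" unfolding f1 by (rule fam_mono[of f u, OF u(2,1) fam])
  have hsW: "hs F \<subseteq> W" by (rule hs_sub[OF fam])
  have col1: "\<And>x c. x \<in> W \<Longrightarrow> f1 x = Some c \<Longrightarrow> c \<in> {1..k}"
    using col a unfolding f1 by (auto split: if_splits)
  have i5o: "phi f1 c \<le> bnd F G f1 c" if "inc f1 c" "c \<noteq> a" for c
    using that i5[of c] inc_mono[of f u a c, OF u(2,1)] phi_other[of f u c a, OF u(2,1)] bnd_mono[of f u G G F c a] u
    unfolding f1 by force
  have i5a: "phi f1 c \<le> bnd F G f1 c + 1" if "inc f1 c" for c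
    using that i5[of c] inc_mono[of f u a c, OF u(2,1)] phi_le[of f u a c, OF u(2,1)] bnd_mono[of f u G G F c a] u
    unfolding f1 by force
  have act1: "act f S" if "act f1 S" for S using that act_mono[of f u, OF u(2,1)] unfolding f1 by blast
  have "s + q \<le> Q" by (rule counters[OF i0])
  \<comment> \<open>One unit each for membership in \<open>G\<close>, for a vertex in
    \<open>hs F\<close> and for Alice's present move: the origin of \<open>C + 3\<close>.\<close>
  have phi3: "phi f1 c \<le> C + 3" if "inc f1 c" for c
    using i5a[OF that] unfolding bnd_def by (auto split: if_splits)
  define pend where "pend \<longleftrightarrow> \<not> settled f1 (hs F)"
  \<comment> \<open>If nothing is pending, all of \<open>hs F\<close> is settled and takes over from
    \<open>H0\<close>; the loss against \<open>hit\<close> is then only the two moves of this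
    exchange.\<close>
  define H where "H = (if pend then H0 else hs F)"
  have H: "H \<subseteq> hs F" "settled f1 H"
    using H0 settled_mono[of f u H0 a, OF u(2,1)] unfolding H_def pend_def f1 by auto
  have i4': "\<rho> \<le> card (free S f - N Y) + (if pend then 2 * (s + q) + 2 else 0)"
    if "act f S" "Y \<subseteq> W" "card Y \<le> C + 3" "Y \<inter> H = {}" for S Y
    using that i4[of S Y] ihit unfolding hit_def H_def by auto
  have plc: "\<exists>x. legal f1 x c \<and> x \<in> R S" if c: "inc f1 c" "S \<in> und f1 c" for c S
  proof (rule place[OF c H(2) _ phi3[OF c(1)]])
    show "H \<subseteq> W" using H(1) hsW by auto
    fix Y assume Y: "Y \<subseteq> W" "card Y \<le> C + 3" "Y \<inter> H = {}"
    have "act f1 S" using c tk_sub unfolding act_def inc_def und_def by auto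
    then have S: "act f S" "S \<in> SS" using act1 unfolding act_def by auto
    have "card (free S f - N Y) \<le> card (free S f1 - N Y) + 1"
      unfolding f1 by (rule free_drop(2)[of f u, OF u(2,1) S(2)])
    then show "0 < card (free S f1 - N Y)"
      using i4'[OF S(1) Y] rho \<open>s + q \<le> Q\<close> by (auto split: if_splits)
  qed
  \<comment> \<open>The common end of all cases: it leaves the colour bounds, the counters and one
    inequality per region to be checked.\<close>
  have fin: "kept (f1(x \<mapsto> c))"
    if xc: "legal f1 x c"
      and c5: "\<And>d. inc (f1(x \<mapsto> c)) d \<Longrightarrow> phi (f1(x \<mapsto> c)) d \<le> bnd F G' (f1(x \<mapsto> c)) d"
      and cG: "finite G'" "card G' \<le> s'" and cq: "q' \<le> qG G' (f1(x \<mapsto> c))"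
      and cs: "s' \<le> sH F (f1(x \<mapsto> c))" and cr: "r' \<le> rC (f1(x \<mapsto> c))"
      and cp: "pend \<Longrightarrow> s + q + 1 \<le> s' + q'"
      and cc: "\<And>S. act (f1(x \<mapsto> c)) S \<Longrightarrow> 2 * tn (f1(x \<mapsto> c)) S + (if u \<in> R S then 1 else 0) + (if x \<in> R S then 1 else 0) + 2 * (r + s + q)
          \<le> 2 * tn f S + 2 * (r' + s' + q')" for x c G' s' q' r'
  proof -
    define f2 where "f2 = f1(x \<mapsto> c)"
    have x: "x \<in> W" "f1 x = None" "c \<in> {1..k}" using xc unfolding legal_def by auto
    have act2: "act f S \<and> S \<in> SS" if "act f2 S" for S
      using that act1 act_mono[of f1 x, OF x(2,1)] unfolding f2_def act_def by blast
    have "invar0 f2 F H G' s' q' r'"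
      unfolding invar0_def
    proof (intro conjI allI impI ballI)
      show "fam f2 F" unfolding f2_def by (rule fam_mono[of f1 x, OF x(2,1) fam1])
      show "H \<subseteq> hs F" by fact
      show "settled f2 H" unfolding f2_def by (rule settled_mono[of f1 x, OF x(2,1) H(2)])
      show "\<And>y d. y \<in> W \<Longrightarrow> f2 y = Some d \<Longrightarrow> d \<in> {1..k}"
        using col1 x unfolding f2_def by (auto split: if_splits)
      show "\<And>d. inc f2 d \<Longrightarrow> phi f2 d \<le> bnd F G' f2 d" using c5 unfolding f2_def .
      show "finite G'" "card G' \<le> s'" "q' \<le> qG G' f2" "s' \<le> sH F f2" "r' \<le> rC f2"
        using cG cq cs cr unfolding f2_def by auto
    next
      fix S Y assume *: "act f2 S" "Y \<subseteq> W" "card Y \<le> C + 3" "Y \<inter> H = {}"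
      have S: "act f S" "S \<in> SS" using act2[OF *(1)] by auto
      have "card (free S f - N Y) \<le> card (free S f1 - N Y) + 1"
        unfolding f1 by (rule free_drop(2)[of f u, OF u(2,1) S(2)])
      moreover have "card (free S f1 - N Y) \<le> card (free S f2 - N Y) + 1"
        unfolding f2_def by (rule free_drop(2)[of f1 x, OF x(2,1) S(2)])
      ultimately show "\<rho> \<le> card (free S f2 - N Y) + 2 * (s' + q') + 2"
        using i4'[OF S(1) *(2-4)] cp by (auto split: if_splits)
    next
      fix S assume *: "act f2 S"
      have S: "act f S" "S \<in> SS" using act2[OF *(1)] by auto
      have "card (free S f) \<le> card (free S f1) + (if u \<in> R S then 1 else 0)"
        unfolding f1 by (rule free_drop(1)[of f u, OF u(2,1) S(2)])
      moreover have "card (free S f1) \<le> card (free S f2) + (if x \<in> R S then 1 else 0)"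
        unfolding f2_def by (rule free_drop(1)[of f1 x, OF x(2,1) S(2)])
      ultimately show "2 * tn f2 S + B \<le> card (free S f2) + 2 * (r' + s' + q')"
        using cc[of S] * i7[OF S(1)] unfolding f2_def[symmetric] by linarith
    qed
    then show ?thesis using refresh unfolding f2_def by blast
  qed
  \<comment> \<open>A move charged to a counter pays for both moves of the exchange in every region
    at once.\<close>
  have crude: "2 * tn (f1(x \<mapsto> c)) S + (if u \<in> R S then 1 else 0) + (if x \<in> R S then 1 else 0) + 2 * n
      \<le> 2 * tn f S + 2 * n'" if "legal f1 x c" "n + 1 \<le> n'" for x c S and n n' :: nat
  proof -
    have "tn (f1(x \<mapsto> c)) S \<le> tn f1 S" using that(1) unfolding legal_def by (intro tn_mono) auto
    moreover have "tn f1 S \<le> tn f S" unfolding f1 using u by (intro tn_mono) auto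
    ultimately show ?thesis using that(2) by (auto split: if_splits)
  qed
  have mono: "qG A f \<le> qG A (f1(x \<mapsto> c))" "sH F f \<le> sH F f1" "sH F f1 \<le> sH F (f1(x \<mapsto> c))"
     "rC f \<le> rC f1" "rC f1 \<le> rC (f1(x \<mapsto> c))" "qG A f \<le> qG A f1"
    if "legal f1 x c" for x c A
  proof -
    have x: "x \<in> W" "f1 x = None" using that unfolding legal_def by auto
    have "qG A f \<le> qG A f1" "qG A f1 \<le> qG A (f1(x \<mapsto> c))" for A
      unfolding f1 by (rule qG_mono[of f u, OF u(2,1)], rule qG_mono) (use x in \<open>auto simp: f1\<close>)
    then show "qG A f \<le> qG A (f1(x \<mapsto> c))" "qG A f \<le> qG A f1" using le_trans by blast+
    show "sH F f \<le> sH F f1" "rC f \<le> rC f1" unfolding f1 using sH_mono rC_mono u by auto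
    show "sH F f1 \<le> sH F (f1(x \<mapsto> c))" "rC f1 \<le> rC (f1(x \<mapsto> c))" using sH_mono rC_mono x by auto
  qed
  have c5_task: "phi (f1(x \<mapsto> c)) d \<le> bnd F G' (f1(x \<mapsto> c)) d"
    if "legal f1 x c" "S \<in> und f1 c" "x \<in> R S" "inc (f1(x \<mapsto> c)) d" "G \<subseteq> G'"
      "inc f1 a \<Longrightarrow> phi f1 a \<le> bnd F G' f1 a \<or> c = a" for x c S d G'
  proof -
    have x: "x \<in> W" "f1 x = None" using that unfolding legal_def by auto
    have d1: "inc f1 d" using inc_mono[of f1 x c d, OF x(2,1) that(4)] .
    have b: "bnd F G' f1 d \<le> bnd F G' (f1(x \<mapsto> c)) d" by (rule bnd_mono) (use x in auto)
    have b2: "bnd F G f1 d \<le> bnd F G' f1 d" using that(5) unfolding bnd_def by auto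
    show ?thesis
    proof (cases "d = c")
      case True
      have "phi (f1(x \<mapsto> c)) c + 1 \<le> phi f1 c" by (rule phi_task[of f1 x, OF x(2,1) that(2,3)])
      then show ?thesis using True i5a[OF d1] b b2 by simp
    next
      case False
      then have "phi (f1(x \<mapsto> c)) d = phi f1 d" using phi_other[of f1 x d c] x by simp
      then show ?thesis using i5o[OF d1] that(6) d1 False b b2 by (cases "d = a") auto
    qed
  qed
  \<comment> \<open>\<open>A\<close>: reply in Alice's colour; \<open>B\<close>: deal with \<open>hs F\<close>; \<open>D\<close>: reply in Alice's region\<close>
  let ?over = "inc f1 a \<and> bnd F G f1 a < phi f1 a"
  consider (A) "?over" "\<not> pend \<or> a \<in> G" | (B) "pend" "?over \<Longrightarrow> a \<notin> G" | (D) "\<not> pend" "\<not> ?over"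
    by blast
  then show ?thesis
  proof cases
    case A
    obtain S where S: "S \<in> und f1 a" using A(1) unfolding inc_def by auto
    obtain x where x: "legal f1 x a" "x \<in> R S" using plc[OF _ S] A by blast
    have x': "x \<in> W" "f1 x = None" using x unfolding legal_def by auto
    have drop: "m - card (und f1 a) < m - card (und (f1(x \<mapsto> a)) a)"
      using task_drop[of f1 x, OF x'(2,1) S x(2)] und_le[of f1 a] by linarith
    have mn: "m - card (und f1 d) \<le> m - card (und (f1(x \<mapsto> a)) d)" for d
      using card_und_mono[of f1 x a d] x' by (intro diff_le_mono2) auto
    have c5: "\<And>d. inc (f1(x \<mapsto> a)) d \<Longrightarrow> phi (f1(x \<mapsto> a)) d \<le> bnd F G (f1(x \<mapsto> a)) d"
      using c5_task[OF x(1) S x(2)] by blast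
    show ?thesis
    proof (cases pend)
      case True
      then have aG: "a \<in> G" using A by auto
      have "Suc (qG G f1) \<le> qG G (f1(x \<mapsto> a))"
        unfolding qG_def by (rule sum_strict_step[where j = a]) (use G aG drop mn in auto)
      then have "q + 1 \<le> qG G (f1(x \<mapsto> a))" using q mono(6)[OF x(1), of G] by linarith
      then have "kept (f1(x \<mapsto> a))"
        using s r mono[OF x(1)] by (intro fin[OF x(1) c5 G, of "q + 1" r] crude[OF x(1)]) auto
      then show ?thesis using x(1) by blast
    next
      case False
      \<comment> \<open>Open tasks account for at most \<open>2 * m\<close> of \<open>phi\<close>,
        so the class itself is large and \<open>rC\<close> can be charged.\<close>
      have "C + 1 \<le> phi f1 a" using A(1) unfolding bnd_def by auto
      then have "C + 1 - 2 * m \<le> card (cls a f1)" using und_le[of f1 a] unfolding phi_def by linarith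
      moreover have "a \<in> {1..k}" by fact
      moreover have "card (cls d f1) \<le> card (cls d (f1(x \<mapsto> a)))" for d using cls_mono x' by blast
      ultimately have "Suc (rC f1) \<le> rC (f1(x \<mapsto> a))"
        unfolding rC_def using mn drop by (intro sum_strict_step[where j = a]) (auto intro: order_trans)
      then have "r + 1 \<le> rC (f1(x \<mapsto> a))" using r mono(4)[OF x(1)] by linarith
      then have "kept (f1(x \<mapsto> a))"
        using q s mono[OF x(1)] False by (intro fin[OF x(1) c5 G, of q "r + 1"] crude[OF x(1)]) (auto intro: order_trans)
      then show ?thesis using x(1) by blast
    qed
  next
    case B
    \<comment> \<open>If Alice's colour is too large, its excess of one is absorbed by the indicator
      of \<open>G'\<close> in \<open>bnd\<close>; the growth of \<open>G\<close> is matched by that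
      of \<open>s\<close>.\<close>
    define G' where "G' = (if ?over then insert a G else G)"
    have G': "G \<subseteq> G'" "finite G'" "card G' \<le> s + 1"
      using G unfolding G'_def by (auto simp: card_insert_if)
    have GG: "inc f1 a \<Longrightarrow> phi f1 a \<le> bnd F G' f1 a"
    proof -
      assume ia: "inc f1 a"
      show "phi f1 a \<le> bnd F G' f1 a"
      proof (cases "?over")
        case True
        then have "bnd F G' f1 a = bnd F G f1 a + 1" using B(2) unfolding G'_def bnd_def by auto
        then show ?thesis using i5a[OF ia] by simp
      qed (use ia in \<open>auto simp: G'_def\<close>)
    qed
    have qG': "q \<le> qG G' (f1(x \<mapsto> c))" if "legal f1 x c" for x c
    proof -
      have "qG G (f1(x \<mapsto> c)) \<le> qG G' (f1(x \<mapsto> c))" unfolding qG_def using G' by (intro sum_mono2) auto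
      then show ?thesis using q mono(1)[OF that, of G] by linarith
    qed
    show ?thesis
    proof (cases "\<exists>h\<in>hs F. \<exists>c. f1 h = Some c \<and> und f1 c \<noteq> {}")
      case True
      then obtain h c S where h: "h \<in> hs F" "f1 h = Some c" and S: "S \<in> und f1 c" by blast
      have ic: "inc f1 c" using col1[of h c] h hsW S unfolding inc_def by auto
      obtain x where x: "legal f1 x c" "x \<in> R S" using plc[OF ic S] by blast
      have x': "x \<in> W" "f1 x = None" using x unfolding legal_def by auto
      have drop: "card (und (f1(x \<mapsto> c)) c) < card (und f1 c)"
        by (rule task_drop[of f1 x, OF x'(2,1) S x(2)])
      have hx: "h \<noteq> x" using h x' by auto
      have "Suc (sH F f1) \<le> sH F (f1(x \<mapsto> c))"
        unfolding sH_def
        by (rule sum_strict_step[where j = h])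
           (use h hx drop und_le[of f1 c] hs_fin[OF fam] sH_term_mono[of f1 x, OF x'(2,1)] in auto)
      then have "s + 1 \<le> sH F (f1(x \<mapsto> c))" using s mono(2)[OF x(1)] by linarith
      then have "kept (f1(x \<mapsto> c))"
        using r mono[OF x(1)] GG
        by (intro fin[OF x(1) _ G'(2,3) qG'[OF x(1)], of r] crude[OF x(1)] c5_task[OF x(1) S x(2) _ G'(1)]) (auto intro: order_trans)
      then show ?thesis using x(1) by blast
    next
      case False
      then obtain h where h: "h \<in> hs F" "f1 h = None" using B(1) unfolding pend_def settled_def by force
      then obtain c where x: "legal f1 h c" using ex_legal[of h] hsW by auto
      have hW: "h \<in> W" using h hsW by auto
      have "Suc (sH F f1) \<le> sH F (f1(h \<mapsto> c))"
        unfolding sH_def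
        by (rule sum_strict_step[where j = h])
           (use h und_le[of "f1(h \<mapsto> c)" c] hs_fin[OF fam] sH_term_mono[of f1 h, OF h(2) hW] in auto)
      then have s1: "s + 1 \<le> sH F (f1(h \<mapsto> c))" using s mono(2)[OF x] by linarith
      have c5: "phi (f1(h \<mapsto> c)) d \<le> bnd F G' (f1(h \<mapsto> c)) d" if d: "inc (f1(h \<mapsto> c)) d" for d
      proof -
        have d1: "inc f1 d" using inc_mono[of f1 h c d, OF h(2) hW d] .
        have pd: "phi f1 d \<le> bnd F G' f1 d"
          using GG i5o[OF d1] d1 G'(1) unfolding bnd_def by (cases "d = a") (auto split: if_splits)
        have b: "bnd F G' f1 d \<le> bnd F G' (f1(h \<mapsto> c)) d" by (rule bnd_mono) (use h in auto)
        show ?thesis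
        proof (cases "d = c")
          case True
          \<comment> \<open>An unfinished colour already present on \<open>hs F\<close> would have
            been served before any uncoloured vertex. So \<open>h\<close> is the first vertex of
            colour \<open>c\<close> there, and the bound of \<open>c\<close> rises along with
            \<open>phi\<close>.\<close>
          have "\<not> (\<exists>y\<in>hs F. f1 y = Some c)" using False d1 True unfolding inc_def by auto
          then have "bnd F G' (f1(h \<mapsto> c)) c = bnd F G' f1 c + 1" using h unfolding bnd_def by auto
          then show ?thesis using pd True phi_le[of f1 h c c] h hW by simp
        qed (use pd b phi_other[of f1 h d c] h hW in simp)
      qed
      have "kept (f1(h \<mapsto> c))"
        using r s1 mono[OF x] by (intro fin[OF x c5 G'(2,3) qG'[OF x], of r] crude[OF x]) (auto intro: order_trans)
      then show ?thesis using x(1) by blast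
    qed
  next
    case D
    \<comment> \<open>If Alice played in an active region, Bob serves that region. Otherwise her
      move cost no active region anything, and any open task will do.\<close>
    obtain c S where c: "inc f1 c" "S \<in> und f1 c" and pr: "\<And>S'. act f1 S' \<Longrightarrow> u \<in> R S' \<Longrightarrow> S' = S"
    proof (cases "\<exists>S'. act f1 S' \<and> u \<in> R S'")
      case True
      then obtain S c where "S \<in> SS" "u \<in> R S" "c \<in> {1..k}" "S \<in> und f1 c" unfolding act_def by blast
      then show ?thesis using R_disj that[of c S] unfolding act_def inc_def by blast
    next
      case False
      then show ?thesis using ex_inc that unfolding inc_def by blast
    qed
    obtain x where x: "legal f1 x c" "x \<in> R S" using plc[OF c] by blast
    have x': "x \<in> W" "f1 x = None" using x unfolding legal_def by auto
    have SS': "S \<in> SS" using c(2) tk_sub unfolding und_def by auto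
    have tnS: "tn (f1(x \<mapsto> c)) S + 1 \<le> tn f S"
    proof -
      have "{d \<in> {1..k}. S \<in> und (f1(x \<mapsto> c)) d} \<subset> {d \<in> {1..k}. S \<in> und f1 d}"
        using c x x' unfolding inc_def by (auto simp: upd_facts)
      then have "tn (f1(x \<mapsto> c)) S < tn f1 S" unfolding tn_def by (intro psubset_card_mono) auto
      moreover have "tn f1 S \<le> tn f S" unfolding f1 using u by (intro tn_mono) auto
      ultimately show ?thesis by simp
    qed
    have cc: "2 * tn (f1(x \<mapsto> c)) S' + (if u \<in> R S' then 1 else 0) + (if x \<in> R S' then 1 else 0) + 2 * (r + s + q)
        \<le> 2 * tn f S' + 2 * (r + s + q)" if S': "act (f1(x \<mapsto> c)) S'" for S'
    proof (cases "S' = S")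
      case True
      then show ?thesis using tnS by auto
    next
      case False
      have "act f1 S'" using act_mono[of f1 x, OF x'(2,1) S'] .
      then have "u \<notin> R S'" "x \<notin> R S'" using pr[of S'] False R_disj[of S' S x] x SS' unfolding act_def by auto
      moreover have "tn (f1(x \<mapsto> c)) S' \<le> tn f1 S'" using x' by (intro tn_mono) auto
      moreover have "tn f1 S' \<le> tn f S'" unfolding f1 using u by (intro tn_mono) auto
      ultimately show ?thesis by simp
    qed
    have c5: "\<And>d. inc (f1(x \<mapsto> c)) d \<Longrightarrow> phi (f1(x \<mapsto> c)) d \<le> bnd F G (f1(x \<mapsto> c)) d"
      using c5_task[OF x(1) c(2) x(2)] D by force
    have "kept (f1(x \<mapsto> c))"
      by (rule fin[OF x(1) c5 G, of q r])
         (use q s r mono[OF x(1)] D cc in \<open>auto intro: order_trans\<close>)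
    then show ?thesis using x(1) by blast
  qed
qed

end

section \<open>Bob wins on suitable graphs\<close>

lemma play_props:
  assumes "play V E k \<sigma> h"
  shows "proper_colouring E (map_of h)" "fst ` set h \<subseteq> V" "\<And>v c. map_of h v = Some c \<Longrightarrow> c \<in> {1..k}"
proof -
  have "proper_colouring E (map_of h) \<and> fst ` set h \<subseteq> V \<and> (\<forall>v c. map_of h v = Some c \<longrightarrow> c \<in> {1..k})"
    using assms
  proof induction
    case start
    then show ?case by (simp add: proper_colouring_def)
  next
    case (alice h)
    then show ?case
      by (cases "\<sigma> h") (auto simp: legal_move_def legal_colour_def fun_upd_def available_def)
  next
    case (bob h m)
    then show ?case by (cases m) (auto simp: legal_move_def legal_colour_def fun_upd_def available_def)
  qed
  then show "proper_colouring E (map_of h)" "fst ` set h \<subseteq> V" "\<And>v c. map_of h v = Some c \<Longrightarrow> c \<in> {1..k}"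
    by auto
qed

lemma winning_moves:
  assumes "winning_strategy V E k \<sigma>" "play V E k \<sigma> h"
  shows "even (length h) \<Longrightarrow> legal_move V E k h (\<sigma> h)"
    "even (length h) \<Longrightarrow> play V E k \<sigma> (\<sigma> h # h)"
    "odd (length h) \<Longrightarrow> v \<in> available V h \<Longrightarrow> \<exists>c. legal_colour E k h v c"
  using assms play.alice[OF assms(2)] unfolding winning_strategy_def by auto

lemma available_first_round:
  assumes "length h < card V"
  shows "v \<in> available V h \<longleftrightarrow> v \<in> V \<and> map_of h v = None"
  using assms by (auto simp: available_def chosen_in_round_def map_of_eq_None_iff)

lemma card_dom_Cons:
  assumes "legal_move V E k h p" "length h < card V"
  shows "card (dom (map_of (p # h))) = Suc (card (dom (map_of h)))"
proof -
  have "map_of h (fst p) = None"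
    using available_first_round[OF assms(2)] assms(1) by (auto simp: legal_move_def)
  then have "fst p \<notin> dom (map_of h)" by auto
  moreover have "dom (map_of (p # h)) = insert (fst p) (dom (map_of h))" by (cases p) auto
  ultimately show ?thesis by (simp add: finite_dom_map_of)
qed

lemma dom_first_round:
  assumes "play V E k \<sigma> h" "length h \<le> card V"
  shows "card (dom (map_of h)) = length h"
  using assms
proof induction
  case (alice h)
  then show ?case using card_dom_Cons[of V E k h "\<sigma> h"] by (simp del: map_of.simps)
next
  case (bob h m)
  then show ?case using card_dom_Cons[of V E k h m] by (simp del: map_of.simps)
qed auto

text \<open>As long as a target is uncoloured, Bob gives one an arbitrary legal colour, which exists
  because Alice's strategy wins. This fixes the colours of the targets before any task is
  set.\<close>

lemma colour_targets:
  assumes win: "winning_strategy V E k \<sigma>" and V: "finite V" "T \<subseteq> V" and t: "2 * t \<le> card V"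
  shows "\<exists>h. play V E k \<sigma> h \<and> length h = 2 * t \<and> card (T - dom (map_of h)) \<le> card T - t"
  using t
proof (induction t)
  case 0
  then show ?case using play.start[of V E k \<sigma>] by (intro exI[of _ "[]"]) auto
next
  case (Suc t)
  then obtain h where h: "play V E k \<sigma> h" "length h = 2 * t" "card (T - dom (map_of h)) \<le> card T - t" by auto
  define h1 where "h1 = \<sigma> h # h"
  have p1: "play V E k \<sigma> h1" unfolding h1_def by (rule winning_moves(2)[OF win h(1)]) (simp add: h)
  have l1: "odd (length h1)" "length h1 < card V" using h(2) Suc.prems by (auto simp: h1_def)
  have T1: "T - dom (map_of h1) \<subseteq> T - dom (map_of h)" unfolding h1_def by (cases "\<sigma> h") auto
  have fT: "finite T" using V finite_subset by blast
  have "V \<noteq> {}" using l1 by auto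
  obtain v where v: "v \<in> available V h1" and v': "T - dom (map_of h1) \<noteq> {} \<Longrightarrow> v \<in> T"
  proof (cases "T - dom (map_of h1) = {}")
    case True
    then show ?thesis using available_nonempty[OF V(1) \<open>V \<noteq> {}\<close>, of h1] that by blast
  next
    case False
    then obtain v where "v \<in> T" "map_of h1 v = None" by auto
    then show ?thesis using available_first_round[OF l1(2)] V that by auto
  qed
  obtain c where c: "legal_colour E k h1 v c" using winning_moves(3)[OF win p1 l1(1) v] by auto
  have p2: "play V E k \<sigma> ((v, c) # h1)"
    by (rule play.bob[OF p1 l1(1)]) (use v c in \<open>auto simp: legal_move_def\<close>)
  have "card (T - dom (map_of ((v, c) # h1))) \<le> card T - Suc t"
  proof (cases "T - dom (map_of h1) = {}")
    case True
    then have "T - dom (map_of ((v, c) # h1)) = {}" by auto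
    then show ?thesis by (simp only: card.empty)
  next
    case False
    have "v \<in> T - dom (map_of h1)" using v' False v available_first_round[OF l1(2)] by auto
    moreover have "T - dom (map_of ((v, c) # h1)) = (T - dom (map_of h1)) - {v}" by auto
    ultimately have "card (T - dom (map_of ((v, c) # h1))) < card (T - dom (map_of h1))"
      using fT by (metis card_Diff1_less finite_Diff)
    also have "\<dots> \<le> card T - t" using card_mono[OF _ T1] fT h(3) by auto
    finally show ?thesis by simp
  qed
  moreover have "length ((v, c) # h1) = 2 * Suc t" using h(2) by (simp add: h1_def)
  ultimately show ?case using p2 by blast
qed

abbreviation proper_parts :: "nat \<Rightarrow> nat set set" where
  "proper_parts m \<equiv> {S. S \<subseteq> {..<m} \<and> S \<noteq> {} \<and> S \<noteq> {..<m}}"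

text \<open>When all tasks are done, each target sees every colour except its own, always through a
  vertex that is not adjacent to all targets. Hence Alice cannot open the second round at a target,
  and wherever else she moves, some target remains that does not depend on her vertex. The
  additional \<open>2 * m\<close> in \<open>nonnbrs\<close> and \<open>regions\<close> makes up for
  the vertices coloured in the opening.\<close>

lemma bob_wins:
  fixes n m k :: nat and E :: "nat set set" and blk :: "nat \<Rightarrow> nat set set"
  defines "T \<equiv> {..<m}" and "W \<equiv> {m..<n}"
  defines "SS \<equiv> proper_parts m"
  defines "R \<equiv> \<lambda>S. {x \<in> {m..<n}. {v \<in> {..<m}. {x, v} \<in> E} = S}"
  assumes n: "even n" "2 * m < n" and m: "2 \<le> m" and E: "E \<subseteq> all_edges {..<n}"
    and blk: "\<And>c. blk c \<subseteq> SS" "\<And>c. card (blk c) \<le> m" "\<And>c. \<Union>(blk c) = T"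
    and few_bad: "\<And>S U F. \<lbrakk>S \<in> SS; U \<subseteq> R S; \<beta> \<le> card U; pairwise disjnt F;
        \<And>Y. Y \<in> F \<Longrightarrow> Y \<subseteq> W \<and> card Y \<le> C + 3 \<and> card (U - nbrs E Y) < \<rho>\<rbrakk> \<Longrightarrow> card F \<le> \<kappa>"
    and nonnbrs: "\<And>S Y. S \<in> SS \<Longrightarrow> Y \<subseteq> W \<Longrightarrow> card Y \<le> C + 3 \<Longrightarrow> \<rho> + 2 * m \<le> card (R S - nbrs E Y)"
    and regions: "\<And>S. S \<in> SS \<Longrightarrow> 2 * (card {c \<in> {1..k}. S \<in> blk c} + m) + B + 2 * m \<le> card (R S)"
    and rho_beta: "\<rho> \<le> \<beta>" and C4: "4 * m \<le> C"
    and Q: "(m + 1) * (card SS * (\<kappa> * (C + 3)) * (m + 1)) \<le> Q"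
    and rho: "2 * Q + 4 \<le> \<rho>" and B: "2 * (\<tau> + Q) + \<beta> \<le> B"
    and \<tau>: "\<And>x. x * (C + 1 - 2 * m) \<le> n \<Longrightarrow> x * m \<le> \<tau>"
  shows "\<not> alice_wins {..<n} E k"
proof
  let ?V = "{..<n}"
  assume "alice_wins ?V E k"
  then obtain \<sigma> where win: "winning_strategy ?V E k \<sigma>" unfolding alice_wins_def by blast
  have T: "T \<subseteq> ?V" "finite T" "card T = m" and VTW: "?V = T \<union> W" "T \<inter> W = {}" using n unfolding T_def W_def by auto
  note edge = all_edgesD[OF E]
  obtain h0 where h0: "play ?V E k \<sigma> h0" "length h0 = 2 * m" "T \<subseteq> dom (map_of h0)"
  proof -
    obtain h where h: "play ?V E k \<sigma> h" "length h = 2 * m" "card (T - dom (map_of h)) \<le> card T - m"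
      using colour_targets[OF win _ T(1), of m] n by auto
    have "T - dom (map_of h) = {}" using h(3) T by (metis card_eq_0_iff diff_is_0_eq le_zero_eq order_refl finite_Diff)
    then show ?thesis using that[OF h(1,2)] by blast
  qed
  define f0 where "f0 = map_of h0"
  \<comment> \<open>A colour of a target cannot be placed next to that target, so it gets singleton tasks instead.\<close>
  define tk where "tk c = (if \<exists>i\<in>T. f0 i = Some c then (\<lambda>i. {i}) ` {i \<in> T. f0 i \<noteq> Some c} else blk c)" for c
  define ok where "ok x c \<longleftrightarrow> (\<forall>v\<in>T. {x, v} \<in> E \<longrightarrow> f0 v \<noteq> Some c)" for x :: nat and c
  have SSeq: "SS = {S. S \<subseteq> T \<and> S \<noteq> {} \<and> S \<noteq> T}" unfolding SS_def T_def ..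
  have R: "R S = {x \<in> W. {v \<in> T. {x, v} \<in> E} = S}" for S unfolding R_def T_def W_def ..
  have finSS: "finite SS" using T(2) unfolding SSeq by (auto intro: finite_subset[of _ "Pow T"])
  have tk_cov: "\<exists>S\<in>tk c. v \<in> S" if "v \<in> T" "f0 v \<noteq> Some c" for v c
    using that blk(3)[of c] unfolding tk_def by auto
  interpret task_game E W R SS tk ok k m C \<rho> \<kappa> \<beta> B \<tau> Q
  proof
    show "finite W" "finite SS" using finSS unfolding W_def by auto
    show "R S \<subseteq> W" for S unfolding R by auto
    show "S = S'" if "x \<in> R S" "x \<in> R S'" for S S' x using that unfolding R by auto
    have "T \<noteq> {i}" for i using T(3) m by auto
    then show "tk c \<subseteq> SS" for c using blk(1)[of c] unfolding tk_def SSeq by auto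
    show "card (tk c) \<le> m" for c
    proof (cases "\<exists>i\<in>T. f0 i = Some c")
      case True
      have "card (tk c) \<le> card {i \<in> T. f0 i \<noteq> Some c}" using True T(2) unfolding tk_def by (auto intro: card_image_le)
      also have "\<dots> \<le> card T" using T(2) by (intro card_mono) auto
      finally show ?thesis using T(3) by simp
    qed (use blk(2) in \<open>auto simp: tk_def\<close>)
    show "ok x c" if "S \<in> tk c" "x \<in> R S" for c S x
      unfolding ok_def
    proof (intro ballI impI)
      fix v assume v: "v \<in> T" "{x, v} \<in> E"
      then have "v \<in> S" using that(2) unfolding R by blast
      then show "f0 v \<noteq> Some c" using that(1) v(1) unfolding tk_def by (auto split: if_splits)
    qed
    show "2 * m \<le> C" using C4 by simp
    show "x * m \<le> \<tau>" if "x * (C + 1 - 2 * m) \<le> card W" for x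
      using \<tau>[of x] that unfolding W_def by auto
  qed (use few_bad rho_beta Q rho B in auto)
  have dom0: "card (dom f0) = 2 * m" using dom_first_round[OF h0(1)] h0(2) n unfolding f0_def by auto
  have fdom0: "finite (dom f0)" unfolding f0_def by (rule finite_dom_map_of)
  have freeR: "card (R S - A) \<le> card (free S f0 - A) + 2 * m" if "S \<in> SS" for S A
  proof -
    have "card (R S - A) \<le> card ((free S f0 - A) \<union> dom f0)"
      using fin_free[OF that] fdom0 by (intro card_mono) (auto simp: free_def)
    also have "\<dots> \<le> card (free S f0 - A) + card (dom f0)" by (rule card_Un_le)
    finally show ?thesis using dom0 by simp
  qed
  have "invar0 f0 (\<lambda>_. {}) {} {} 0 0 0"
    unfolding invar0_def
  proof (intro conjI allI impI ballI)
    show "fam f0 (\<lambda>_. {})" unfolding fam_def by auto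
    show "settled f0 {}" unfolding settled_def by auto
    show "c \<in> {1..k}" if "f0 x = Some c" for x c using play_props(3)[OF h0(1)] that unfolding f0_def by blast
    show "\<rho> \<le> card (free S f0 - nbrs E Y) + 2 * (0 + 0) + 2"
      if "act f0 S" "Y \<subseteq> W" "card Y \<le> C + 3" for S Y
    proof -
      have S: "S \<in> SS" using that(1) unfolding act_def by auto
      show ?thesis using nonnbrs[OF S that(2,3)] freeR[OF S, of "nbrs E Y"] by simp
    qed
    show "phi f0 c \<le> bnd (\<lambda>_. {}) {} f0 c" for c
    proof -
      have "card (cls c f0) \<le> card (dom f0)" by (rule card_mono[OF fdom0]) (auto simp: cls_def)
      then show ?thesis using und_le[of f0 c] C4 dom0 unfolding phi_def bnd_def by simp
    qed
    show "2 * tn f0 S + B \<le> card (free S f0) + 2 * (0 + 0 + 0)" if "act f0 S" for S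
    proof -
      have S: "S \<in> SS" using that(1) unfolding act_def by auto
      \<comment> \<open>Apart from the regular colours, each of the at most \<open>m\<close> colours
        on targets may add a task to the region.\<close>
      have "tn f0 S \<le> card ({c \<in> {1..k}. S \<in> blk c} \<union> (\<lambda>i. the (f0 i)) ` T)"
        unfolding tn_def
      proof (rule card_mono)
        show "{c \<in> {1..k}. S \<in> und f0 c} \<subseteq> {c \<in> {1..k}. S \<in> blk c} \<union> (\<lambda>i. the (f0 i)) ` T"
        proof
          fix c assume "c \<in> {c \<in> {1..k}. S \<in> und f0 c}"
          then have c: "c \<in> {1..k}" "S \<in> tk c" unfolding und_def by auto
          show "c \<in> {c \<in> {1..k}. S \<in> blk c} \<union> (\<lambda>i. the (f0 i)) ` T"
          proof (cases "\<exists>i\<in>T. f0 i = Some c")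
            case True
            then show ?thesis by force
          qed (use c in \<open>auto simp: tk_def\<close>)
        qed
      qed (use T(2) in auto)
      also have "\<dots> \<le> card {c \<in> {1..k}. S \<in> blk c} + card ((\<lambda>i. the (f0 i)) ` T)" by (rule card_Un_le)
      also have "card ((\<lambda>i. the (f0 i)) ` T) \<le> m" using card_image_le[OF T(2)] T(3) by auto
      finally show ?thesis using regions[OF S] freeR[OF S, of "{}"] by simp
    qed
  qed (auto simp: sH_def hs_def)
  then have start: "kept f0" using refresh by blast
  \<comment> \<open>Once every colour is finished, nothing has to be maintained and Bob may move
    anywhere.\<close>
  define good where "good f \<longleftrightarrow> kept f \<or> (\<forall>c. \<not> inc f c)" for f
  have main: "\<exists>h. play ?V E k \<sigma> h \<and> length h = 2 * m + 2 * t \<and> (\<forall>v\<in>T. map_of h v = f0 v) \<and> good (map_of h)"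
    if "2 * m + 2 * t \<le> n" for t
    using that
  proof (induction t)
    case 0
    have "good (map_of h0)" using start unfolding f0_def good_def by blast
    then show ?case using h0 unfolding f0_def by auto
  next
    case (Suc t)
    then obtain h where h: "play ?V E k \<sigma> h" "length h = 2 * m + 2 * t" "\<forall>v\<in>T. map_of h v = f0 v"
      and IH: "good (map_of h)" by auto
    obtain u a where ua: "\<sigma> h = (u, a)" by (cases "\<sigma> h")
    define h1 where "h1 = (u, a) # h"
    have ev: "even (length h)" "length h < card ?V" using h(2) Suc.prems by auto
    have p1: "play ?V E k \<sigma> h1" using winning_moves(2)[OF win h(1) ev(1)] unfolding h1_def ua .
    have lm: "legal_move ?V E k h (u, a)" using winning_moves(1)[OF win h(1) ev(1)] unfolding ua .
    have f0T: "f0 v \<noteq> None" if "v \<in> T" for v using h0(3) that unfolding f0_def by blast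
    have u: "u \<in> ?V" "map_of h u = None" "a \<in> {1..k}"
      using lm available_first_round[OF ev(2)] by (auto simp: legal_move_def legal_colour_def)
    then have uW: "u \<in> W" using VTW h(3) f0T by (metis UnE)
    define f1 where "f1 = (map_of h)(u \<mapsto> a)"
    have f1: "map_of h1 = f1" unfolding h1_def f1_def by (auto simp: fun_upd_def)
    have od: "odd (length h1)" "length h1 < card ?V" using h(2) Suc.prems unfolding h1_def by auto
    have f1T: "f1 v = f0 v" if "v \<in> T" for v using h(3) that uW VTW(2) unfolding f1_def by auto
    note proper = play_props(1)[OF p1, unfolded f1]
    have av: "x \<in> available ?V h1 \<longleftrightarrow> x \<in> W \<and> f1 x = None" for x
    proof (cases "x \<in> T")
      case True
      then have "f1 x \<noteq> None" using f1T[of x] f0T[of x] by metis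
      then show ?thesis using available_first_round[OF od(2), of x] f1 by auto
    next
      case False
      then have "x \<in> ?V \<longleftrightarrow> x \<in> W" using VTW by blast
      then show ?thesis using available_first_round[OF od(2), of x] f1 by simp
    qed
    have lc1: "legal f1 x c" if "x \<in> W" "f1 x = None" "legal_colour E k h1 x c" for x c
    proof -
      have pr: "proper_colouring E (f1(x \<mapsto> c))" and c: "c \<in> {1..k}"
        using that(3) unfolding legal_colour_def f1 by auto
      have nb: "\<not> f1 y = Some c" if "{x, y} \<in> E" for y
        using pr that edge[OF that] unfolding proper_colouring_def by (metis fun_upd_other fun_upd_same)
      have "ok x c" unfolding ok_def using nb f1T by metis
      moreover have "x \<notin> nbrs E (cls c f1)" using nb unfolding nbrs_def cls_def by blast
      ultimately show ?thesis using that(1,2) c unfolding legal_def by blast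
    qed
    have lc2: "legal_colour E k h1 x c" if "legal f1 x c" for x c
    proof -
      have x: "x \<in> W" "f1 x = None" "c \<in> {1..k}" "x \<notin> nbrs E (cls c f1)" "ok x c" using that unfolding legal_def by auto
      have nb: "f1 y \<noteq> Some c" if "{x, y} \<in> E" for y
      proof (cases "y \<in> T")
        case True
        then show ?thesis using x(5) that f1T unfolding ok_def by auto
      next
        case False
        then have "y \<in> W" using edge[OF that] VTW by auto
        then show ?thesis using x(4) that unfolding nbrs_def cls_def by auto
      qed
      have "proper_colouring E (f1(x \<mapsto> c))"
        unfolding proper_colouring_def
      proof (intro allI impI notI)
        fix y z d assume e: "{y, z} \<in> E" and d: "(f1(x \<mapsto> c)) y = Some d \<and> (f1(x \<mapsto> c)) z = Some d"
        have e': "{z, y} \<in> E" using e by (simp add: insert_commute)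
        show False
        proof (cases "y = x \<or> z = x")
          case True
          then show False using nb[of y] nb[of z] e e' d edge[OF e] by (auto split: if_splits)
        next
          case False
          then show False using proper e d unfolding proper_colouring_def by auto
        qed
      qed
      then show ?thesis using x unfolding legal_colour_def f1 by auto
    qed
    have next_move: ?case if "legal f1 x c"
      "good (f1(x \<mapsto> c))" for x c
    proof -
      have x: "x \<in> W" "f1 x = None" using that(1) unfolding legal_def by auto
      have "play ?V E k \<sigma> ((x, c) # h1)"
        by (rule play.bob[OF p1 od(1)]) (use x av lc2[OF that(1)] in \<open>auto simp: legal_move_def\<close>)
      moreover have "map_of ((x, c) # h1) = f1(x \<mapsto> c)" using f1 by (auto simp: fun_upd_def)
      moreover have "\<forall>v\<in>T. (f1(x \<mapsto> c)) v = f0 v" using f1T x VTW(2) by auto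
      moreover have "length ((x, c) # h1) = 2 * m + 2 * Suc t" using h(2) unfolding h1_def by simp
      ultimately show ?thesis using that(2) by (intro exI[of _ "(x, c) # h1"]) metis
    qed
    have exl: "\<exists>c. legal f1 x c" if "x \<in> W" "f1 x = None" for x
      using winning_moves(3)[OF win p1 od(1), of x] av that lc1 by blast
    show ?case
    proof (cases "\<exists>c. inc f1 c")
      case True
      then have "\<exists>c. inc (map_of h) c" using inc_mono[of "map_of h" u a, OF u(2) uW] unfolding f1_def by blast
      then obtain F H0 G s q r where iv: "invar (map_of h) F H0 G s q r" using IH unfolding good_def by blast
      show ?thesis using step[OF iv uW u(2,3) f1_def True exl] next_move unfolding good_def by blast
    next
      case False
      have "?V \<noteq> {}" using od by auto
      then obtain x where "x \<in> available ?V h1" using available_nonempty[of ?V h1] by blast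
      then have x: "x \<in> W" "f1 x = None" using av by auto
      then obtain c where c: "legal f1 x c" using exl by blast
      have "\<not> inc (f1(x \<mapsto> c)) d" for d using inc_mono[of f1 x c d, OF x(2,1)] False by blast
      then show ?thesis using next_move[OF c] unfolding good_def by blast
    qed
  qed
  obtain t where "n = 2 * t" using n(1) by auto
  then have "2 * m + 2 * (t - m) = n" using n by auto
  with main[of "t - m"] obtain h where h: "play ?V E k \<sigma> h" "length h = n" "\<forall>v\<in>T. map_of h v = f0 v"
    and fin: "good (map_of h)" by auto
  define f where "f = map_of h"
  have "dom f = ?V"
  proof (rule card_subset_eq)
    have "dom f = fst ` set h" unfolding f_def by (rule dom_map_of_conv_image_fst)
    then show "dom f \<subseteq> ?V" using play_props(2)[OF h(1)] by auto
    show "card (dom f) = card ?V" using dom_first_round[OF h(1)] h(2) unfolding f_def by auto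
  qed auto
  \<comment> \<open>An open task would keep its region above \<open>\<beta>\<close> free vertices,
    but all vertices are coloured.\<close>
  have noinc: "\<not> inc f c" for c
  proof
    assume c: "inc f c"
    then obtain F H0 G s q r where iv: "invar f F H0 G s q r" using fin unfolding f_def good_def by blast
    obtain S where S: "S \<in> und f c" "c \<in> {1..k}" using c unfolding inc_def by auto
    then have "act f S" using tk_sub unfolding act_def und_def by auto
    then have "\<beta> \<le> card (free S f)" using iv free_big unfolding invar_def by blast
    moreover have "f x \<noteq> None" if "x \<in> W" for x using \<open>dom f = ?V\<close> that unfolding W_def by auto
    then have "free S f = {}" unfolding free_def R by blast
    ultimately show False using rho rho_beta by simp
  qed
  have seen: "\<exists>x\<in>W. \<exists>S. S \<noteq> T \<and> v \<in> S \<and> x \<in> R S \<and> f x = Some c"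
    if vT: "v \<in> T" and ck: "c \<in> {1..k}" and vc: "f v \<noteq> Some c" for v c
  proof -
    have "f0 v \<noteq> Some c" using vT vc h(3) unfolding f_def by auto
    then obtain S where S: "S \<in> tk c" "v \<in> S" using tk_cov[OF vT] by blast
    have "S \<notin> und f c" using noinc[of c] ck unfolding inc_def by auto
    then obtain x where "x \<in> R S" "f x = Some c" using S unfolding und_def by auto
    moreover have "S \<in> SS" using S(1) tk_sub by blast
    then have "S \<noteq> T" unfolding SSeq by blast
    moreover have "x \<in> W" using \<open>x \<in> R S\<close> unfolding R by blast
    ultimately show ?thesis using S(2) by blast
  qed
  obtain u a where ua: "\<sigma> h = (u, a)" by (cases "\<sigma> h")
  define h1 where "h1 = (u, a) # h"
  have ev: "even (length h)" using h(2) n by auto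
  have p1: "play ?V E k \<sigma> h1" using winning_moves(2)[OF win h(1) ev] unfolding h1_def ua .
  have lm: "legal_move ?V E k h (u, a)" using winning_moves(1)[OF win h(1) ev] unfolding ua .
  then have u: "u \<in> ?V" "a \<in> {1..k}" "f u \<noteq> Some a" "proper_colouring E (f(u \<mapsto> a))"
    by (auto simp: legal_move_def legal_colour_def available_def f_def)
  have uW: "u \<in> W"
  proof (rule ccontr)
    assume "u \<notin> W"
    then have "u \<in> T" using u VTW by auto
    then obtain x S where x: "x \<in> W" "u \<in> S" "x \<in> R S" "f x = Some a" using seen[of u a] u by blast
    then have "{x, u} \<in> E" unfolding R by auto
    then show False using u(4) x edge unfolding proper_colouring_def by (metis fun_upd_other fun_upd_same)
  qed
  \<comment> \<open>If \<open>u\<close> is adjacent to all targets, it lies in no region of a proper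
    part and any target serves; otherwise take a target not adjacent to \<open>u\<close>.\<close>
  obtain v where v: "v \<in> T" "\<And>S. S \<noteq> T \<Longrightarrow> v \<in> S \<Longrightarrow> u \<notin> R S"
  proof (cases "{v \<in> T. {u, v} \<in> E} = T")
    case True
    have "T \<noteq> {}" using T m by auto
    then obtain v where "v \<in> T" by blast
    then show ?thesis using that True unfolding R by blast
  next
    case False
    then obtain v where "v \<in> T" "{u, v} \<notin> E" by blast
    then show ?thesis using that unfolding R by blast
  qed
  have vu: "v \<noteq> u" using v uW VTW by auto
  have "(n + 1) mod n = 1" using n m by (simp add: mod_Suc)
  then have "chosen_in_round ?V h1 = {u}" using h(2) unfolding chosen_in_round_def h1_def by simp
  then have va: "v \<in> available ?V h1" using v vu T unfolding available_def by auto
  have od: "odd (length h1)" using h(2) n unfolding h1_def by simp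
  obtain c where "legal_colour E k h1 v c" using winning_moves(3)[OF win p1 od va] by blast
  then have c: "c \<in> {1..k}" "map_of h1 v \<noteq> Some c" "proper_colouring E ((map_of h1)(v \<mapsto> c))"
    unfolding legal_colour_def by auto
  have "f v \<noteq> Some c" using c(2) vu unfolding h1_def f_def by auto
  then obtain x S where x: "x \<in> W" "S \<noteq> T" "v \<in> S" "x \<in> R S" "f x = Some c" using seen[OF v(1) c(1)] by blast
  have "x \<noteq> u" using v(2)[OF x(2,3)] x(4) by blast
  then have "map_of h1 x = Some c" using x(5) unfolding h1_def f_def by auto
  moreover have e: "{x, v} \<in> E" using x unfolding R by auto
  ultimately show False using c(3) edge[OF e] unfolding proper_colouring_def by (metis fun_upd_other fun_upd_same)
qed

section \<open>Alice's balancing strategy\<close>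

definition unseen :: "'a set set \<Rightarrow> nat \<Rightarrow> ('a \<rightharpoonup> nat) \<Rightarrow> 'a \<Rightarrow> nat set" where
  "unseen E k f v = {c \<in> {1..k}. \<forall>u. {u, v} \<in> E \<longrightarrow> f u \<noteq> Some c}"

lemma finite_unseen [simp]: "finite (unseen E k f v)"
  by (simp add: unseen_def)

text \<open>A move can hide at most its own colour from \<open>v\<close>; recolouring may even
  reveal the old one.\<close>

lemma card_unseen_Cons: "card (unseen E k (map_of h) v) \<le> card (unseen E k (map_of (m # h)) v) + 1"
proof -
  have "unseen E k (map_of h) v \<subseteq> insert (snd m) (unseen E k (map_of (m # h)) v)"
    by (cases m) (auto simp: unseen_def split: if_splits)
  then have "card (unseen E k (map_of h) v) \<le> card (insert (snd m) (unseen E k (map_of (m # h)) v))"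
    by (intro card_mono) auto
  also have "\<dots> \<le> card (unseen E k (map_of (m # h)) v) + 1" by (simp add: card_insert_if)
  finally show ?thesis .
qed

lemma card_unseen_append:
  "card (unseen E k (map_of h) v) \<le> card (unseen E k (map_of (t @ h)) v) + length t"
proof (induction t)
  case (Cons m t)
  then have "card (unseen E k (map_of h) v) \<le> card (unseen E k (map_of (m # (t @ h))) v) + 1 + length t"
    using card_unseen_Cons[of E k "t @ h" v m] by linarith
  then show ?case by (simp only: append_Cons list.size)
qed simp

lemma unseen_legal:
  assumes "proper_colouring E (map_of h)" "c \<in> unseen E k (map_of h) v" "map_of h v \<noteq> Some c"
    "\<And>w. {w} \<notin> E"
  shows "legal_colour E k h v c"
  unfolding legal_colour_def proper_colouring_def
proof (intro conjI allI impI notI)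
  show "c \<in> {1..k}" using assms(2) by (auto simp: unseen_def)
  fix x y d
  assume e: "{x, y} \<in> E" and d: "((map_of h)(v \<mapsto> c)) x = Some d \<and> ((map_of h)(v \<mapsto> c)) y = Some d"
  have e': "{y, x} \<in> E" using e by (simp add: insert_commute)
  have "x \<noteq> y" using e assms(4) by auto
  then show False using assms(1,2) e e' d unfolding unseen_def proper_colouring_def
    by (auto split: if_splits)
qed (use assms in auto)

lemma card_ge2_other:
  assumes "2 \<le> card A"
  shows "\<exists>c\<in>A. Some c \<noteq> y"
proof -
  have "\<not> A \<subseteq> {the y}" using assms card_mono[of "{the y}" A] by auto
  then show ?thesis by (cases y) auto
qed

lemma chosen_in_round_Cons:
  assumes "0 < card V"
  shows "chosen_in_round V (m # h) =
    (if card V dvd Suc (length h) then {} else insert (fst m) (chosen_in_round V h))"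
  using assms by (simp add: chosen_in_round_def mod_Suc dvd_eq_mod_eq_0)

text \<open>The palette is \<open>{1..P}\<close>, and a vertex is endangered once at most
  \<open>\<mu>\<close> palette colours are unseen by it. \<open>D\<close> bounds the vertices
  endangered during a round, \<open>b\<close> Bob's share of a neighbourhood, and \<open>l\<close>
  is the rate of the potential. The last condition is the budget of a vertex at the end of a round:
  palette, colours of endangered vertices, colours of Bob's neighbours, and a margin
  \<open>\<mu>\<close>. Assumption \<open>near\<close> ranges over all partial colourings, proper or
  not.\<close>

locale balancing =
  fixes E :: "nat set set" and n k P \<mu> D b z d :: nat and l :: real
  assumes n: "even n" "0 < n" and E: "E \<subseteq> all_edges {..<n}" and l: "0 < l" "l < 1"
    and near: "\<And>f. card {v \<in> {..<n}. card (unseen E P f v) \<le> 2 * \<mu>} \<le> z"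
    and D: "(n div \<mu> + 1) * z \<le> D" and mu: "2 * D + 5 \<le> \<mu>"
    and deg: "\<And>v. card {u. {u, v} \<in> E} \<le> d"
    and pot: "\<And>x y. x + y \<le> d \<Longrightarrow> (1 + l) ^ x * (1 - l) ^ y \<le> real n * (1 + l) ^ D \<Longrightarrow> x \<le> b"
    and k: "P + D + b + \<mu> \<le> k"
begin

abbreviation "V \<equiv> {..<n}"

definition danger where "danger h = {v \<in> available V h. card (unseen E P (map_of h) v) \<le> \<mu>}"

text \<open>
  After the last move of a round the sets \<open>round\<dots>\<close> still describe that round, whereas the sets
  \<open>cur\<dots>\<close> are already empty.
\<close>

fun roundA :: "nat history \<Rightarrow> nat set" where
  "roundA [] = {}"
| "roundA (m # h) = (if n dvd length h then {} else roundA h) \<union> (if even (length h) then {fst m} else {})"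

fun roundB :: "nat history \<Rightarrow> nat set" where
  "roundB [] = {}"
| "roundB (m # h) = (if n dvd length h then {} else roundB h) \<union> (if odd (length h) then {fst m} else {})"

fun roundD :: "nat history \<Rightarrow> nat set" where
  "roundD [] = {}"
| "roundD (m # h) = (if n dvd length h then {} else roundD h) \<union> (if even (length h) then danger h else {})"

definition "curA h = (if n dvd length h then {} else roundA h)"
definition "curB h = (if n dvd length h then {} else roundB h)"
definition "curD h = (if n dvd length h then {} else roundD h)"

section \<open>A potential that balances all neighbourhoods\<close>

definition Nb where "Nb v = {u. {u, v} \<in> E}"
text \<open>A multiplicative weight in the style of Erdos and Selfridge: it is exponentially large
  when Bob has clearly more vertices than Alice in the neighbourhood of \<open>v\<close>.\<close>

definition wt where "wt A B v = (1 + l) ^ card (B \<inter> Nb v) * (1 - l) ^ card (A \<inter> Nb v)"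
definition Wt where "Wt A B u = (\<Sum>v\<in>Nb u. wt A B v)"
definition Phi where "Phi A B = (\<Sum>v\<in>V. wt A B v)"

lemma edge: "{u, v} \<in> E \<Longrightarrow> u \<noteq> v \<and> u < n \<and> v < n"
  using all_edgesD[OF E] .

lemma no_loop: "{w} \<notin> E" using edge[of w w] by auto

lemma Nb_sub: "Nb v \<subseteq> V" using edge unfolding Nb_def by auto
lemma fin_Nb: "finite (Nb v)" using Nb_sub finite_subset by blast
lemma Nb_sym: "u \<in> Nb v \<longleftrightarrow> v \<in> Nb u" unfolding Nb_def by (auto simp: insert_commute)

lemma wt_pos: "0 < wt A B v" unfolding wt_def using l by simp

lemma wt_A:
  assumes "u \<notin> A"
  shows "wt (insert u A) B v = (if v \<in> Nb u then (1 - l) * wt A B v else wt A B v)"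
  using assms fin_Nb[of v] Nb_sym[of u v] by (auto simp: wt_def Int_insert_left)

lemma wt_B:
  assumes "u \<notin> B"
  shows "wt A (insert u B) v = (if v \<in> Nb u then (1 + l) * wt A B v else wt A B v)"
  using assms fin_Nb[of v] Nb_sym[of u v] by (auto simp: wt_def Int_insert_left)

lemma Phi_split: "Phi A B = Wt A B u + (\<Sum>v\<in>V - Nb u. wt A B v)"
  unfolding Phi_def Wt_def using sum.subset_diff[OF Nb_sub[of u], of "wt A B"] by simp

text \<open>The same rate \<open>l\<close> is used for both players, so that taking a vertex changes
  the potential by \<open>l\<close> times its \<open>Wt\<close> in either direction. If Alice takes
  a vertex of maximal \<open>Wt\<close>, her gain covers any reply.\<close>

lemma Phi_A:
  assumes "u \<notin> A"
  shows "Phi (insert u A) B = Phi A B - l * Wt A B u"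
proof -
  have "Wt (insert u A) B u = (1 - l) * Wt A B u"
    unfolding Wt_def by (simp add: wt_A[OF assms] sum_distrib_left)
  moreover have "(\<Sum>v\<in>V - Nb u. wt (insert u A) B v) = (\<Sum>v\<in>V - Nb u. wt A B v)"
    by (rule sum.cong) (auto simp: wt_A[OF assms])
  ultimately show ?thesis using Phi_split[of A B u] Phi_split[of "insert u A" B u] by (simp add: algebra_simps)
qed

lemma Phi_B:
  assumes "u \<notin> B"
  shows "Phi A (insert u B) = Phi A B + l * Wt A B u"
proof -
  have "Wt A (insert u B) u = (1 + l) * Wt A B u"
    unfolding Wt_def by (simp add: wt_B[OF assms] sum_distrib_left)
  moreover have "(\<Sum>v\<in>V - Nb u. wt A (insert u B) v) = (\<Sum>v\<in>V - Nb u. wt A B v)"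
    by (rule sum.cong) (auto simp: wt_B[OF assms])
  ultimately show ?thesis using Phi_split[of A B u] Phi_split[of A "insert u B" u] by (simp add: algebra_simps)
qed

lemma Wt_A_le: "u \<notin> A \<Longrightarrow> Wt (insert u A) B v \<le> Wt A B v"
  unfolding Wt_def by (rule sum_mono) (use l wt_pos[THEN less_imp_le] in \<open>auto simp: wt_A mult_left_le_one_le\<close>)

lemma Wt_le_Phi: "Wt A B u \<le> Phi A B"
  unfolding Wt_def Phi_def using Nb_sub wt_pos[THEN less_imp_le] by (intro sum_mono2) auto

lemma Wt_nonneg: "0 \<le> Wt A B u"
  unfolding Wt_def using wt_pos[THEN less_imp_le] by (intro sum_nonneg) auto

lemma Phi_empty: "Phi {} {} = real n"
  unfolding Phi_def wt_def by simp

text \<open>Unfolds the recursion into an earlier position of the same round. The term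
  \<open>length h - 1\<close> selects the round of the last move, also when that move has just ended
  it.\<close>

lemma roundD_history:
  assumes "v \<in> roundD h"
  shows "v \<in> V \<and> (\<exists>t s. h = t @ s \<and> n * ((length h - 1) div n) \<le> length s \<and> length s < length h \<and>
      card (unseen E P (map_of s) v) \<le> \<mu>)"
  using assms
proof (induction h)
  case (Cons m h)
  show ?case
  proof (cases "even (length h) \<and> v \<in> danger h")
    case True
    then show ?thesis
      by (intro conjI exI[of _ "[m]"] exI[of _ h]) (auto simp: danger_def available_def)
  next
    case False
    then have nd: "\<not> n dvd length h" and v: "v \<in> roundD h" using Cons.prems by (auto split: if_splits)
    have "Suc (length h - 1) = length h" using nd by (cases h) auto
    then have "(length h - 1) div n = length h div n"
      using nd by (metis div_Suc dvd_eq_mod_eq_0)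
    moreover obtain t s where "v \<in> V" "h = t @ s" "n * ((length h - 1) div n) \<le> length s" "length s < length h"
      "card (unseen E P (map_of s) v) \<le> \<mu>" using Cons.IH[OF v] by blast
    ultimately show ?thesis by (intro conjI exI[of _ "m # t"] exI[of _ s]) auto
  qed
qed simp

text \<open>Positions are sampled at every \<open>\<mu>\<close>-th move of the round. A vertex with
  at most \<open>\<mu>\<close> unseen palette colours had at most \<open>2 * \<mu>\<close> at the
  preceding checkpoint, since a move hides at most one colour. There are at most
  \<open>n div \<mu> + 1\<close> checkpoints, and \<open>near\<close> allows at most
  \<open>z\<close> such vertices at each.\<close>

lemma card_roundD: "card (roundD h) \<le> D"
proof -
  define r where "r = n * ((length h - 1) div n)"
  define S where "S j = {v \<in> V. card (unseen E P (map_of (drop (length h - (r + j * \<mu>)) h)) v) \<le> 2 * \<mu>}" for j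
  have mu0: "0 < \<mu>" using mu by simp
  have "roundD h \<subseteq> (\<Union>j\<in>{..n div \<mu>}. S j)"
  proof
    fix v assume "v \<in> roundD h"
    then obtain t s where v: "v \<in> V" "h = t @ s" "r \<le> length s" "length s < length h"
      "card (unseen E P (map_of s) v) \<le> \<mu>" using roundD_history unfolding r_def by blast
    define j where "j = (length s - r) div \<mu>"
    have "length h - 1 < r + n"
      unfolding r_def using n(2) by (metis add.commute dividend_less_times_div mult_Suc_right mult.commute)
    then have "length s - r \<le> n" using v(4) by simp
    then have j: "j \<le> n div \<mu>" unfolding j_def by (rule div_le_mono)
    have jl: "r + j * \<mu> \<le> length s" unfolding j_def using v(3)
      by (metis Nat.le_diff_conv2 add.commute div_times_less_eq_dividend)
    have jh: "length s < r + j * \<mu> + \<mu>" unfolding j_def using v(3) mu0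
      by (metis add.assoc add.commute dividend_less_div_times less_diff_conv2)
    define t' where "t' = take (length s - (r + j * \<mu>)) s"
    define s' where "s' = drop (length s - (r + j * \<mu>)) s"
    have s: "s = t' @ s'" unfolding t'_def s'_def by simp
    have "drop (length h - (r + j * \<mu>)) h = s'"
      unfolding s'_def v(2) using jl by simp
    moreover have "card (unseen E P (map_of s') v) \<le> card (unseen E P (map_of s) v) + length t'"
      unfolding s by (rule card_unseen_append)
    moreover have "length t' \<le> \<mu>" unfolding t'_def using jl jh by simp
    ultimately have "v \<in> S j" unfolding S_def using v by simp
    then show "v \<in> (\<Union>j\<in>{..n div \<mu>}. S j)" using j by blast
  qed
  then have "card (roundD h) \<le> card (\<Union>j\<in>{..n div \<mu>}. S j)"
    by (intro card_mono) (auto simp: S_def)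
  also have "\<dots> \<le> (\<Sum>j\<in>{..n div \<mu>}. card (S j))" by (rule card_UN_le) simp
  also have "\<dots> \<le> (\<Sum>j\<in>{..n div \<mu>}. z)" unfolding S_def by (intro sum_mono near)
  also have "\<dots> \<le> D" using D by simp
  finally show ?thesis .
qed

lemma fin_roundD: "finite (roundD h)"
  using roundD_history by (metis finite_lessThan finite_subset subsetI)

lemma card_curD: "card (curD h) \<le> D" "finite (curD h)"
  unfolding curD_def using card_roundD fin_roundD by auto

text \<open>As \<open>n\<close> is even, a round never ends with a move of Alice.\<close>

lemma cur_Cons_even:
  assumes "even (length h)"
  shows "curA (m # h) = insert (fst m) (curA h)" "curB (m # h) = curB h" "curD (m # h) = curD h \<union> danger h"
proof -
  have "\<not> n dvd Suc (length h)" using assms n(1) by (meson dvd_trans even_Suc)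
  then show "curA (m # h) = insert (fst m) (curA h)" "curB (m # h) = curB h" "curD (m # h) = curD h \<union> danger h"
    using assms unfolding curA_def curB_def curD_def by auto
qed

lemma round_Cons_odd:
  assumes "odd (length h)"
  shows "roundA (m # h) = curA h" "roundB (m # h) = insert (fst m) (curB h)" "roundD (m # h) = curD h"
  using assms unfolding curA_def curB_def curD_def by auto

lemma chosen_cur: "chosen_in_round V h = curA h \<union> curB h"
proof (induction h)
  case Nil
  then show ?case by (simp add: chosen_in_round_def curA_def curB_def)
next
  case (Cons m h)
  then show ?case using n chosen_in_round_Cons[of V m h]
    by (auto simp: curA_def curB_def split: if_splits)
qed

section \<open>Alice's strategy and its invariant\<close>

abbreviation "PhiC h \<equiv> Phi (curA h) (curB h)"
abbreviation "WtC h \<equiv> Wt (curA h) (curB h)"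
abbreviation "nAD h \<equiv> card (curA h \<inter> curD h)"

definition pick where
  "pick h = (if danger h \<noteq> {} then (SOME v. v \<in> danger h)
     else (SOME v. v \<in> available V h \<and> (\<forall>u\<in>available V h. WtC h u \<le> WtC h v)))"

definition strat where
  "strat h = (pick h, SOME c. legal_colour E k h (pick h) c \<and> (danger h = {} \<longrightarrow> c \<le> P))"

text \<open>Call a move of Alice an emergency if it is made while some vertex is endangered; it
  raises \<open>nAD\<close>, as she takes such a vertex. An emergency may cost the potential a
  factor \<open>1 + l\<close> and, together with Bob's reply, every available vertex two colours.
  After a move of Alice the potential must leave room for every possible reply, whence the case
  distinction.\<close>

definition ok where
  "ok h \<longleftrightarrow> curA h \<inter> curB h = {} \<and> card (curA h \<union> curB h) = length h mod n \<and> curA h \<union> curB h \<subseteq> V \<and>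
     (\<forall>v\<in>curA h - curD h. \<exists>c\<in>{1..P}. map_of h v = Some c) \<and>
     (if even (length h)
      then PhiC h \<le> real n * (1 + l) ^ nAD h
      else \<forall>u\<in>available V h. PhiC h + l * WtC h u \<le> real n * (1 + l) ^ nAD h) \<and>
     (\<forall>v\<in>available V h. \<mu> \<le> card (unseen E k (map_of h) v) + 2 * nAD h + (if even (length h) then 2 else 1))"

lemma avail_nonempty: "available V h \<noteq> {}"
  using available_nonempty[of V h] n by auto

lemma card_AD: "nAD h \<le> D"
  using card_curD[of h] card_mono[of "curD h" "curA h \<inter> curD h"] by auto

lemma ok_legal:
  assumes "ok h" "proper_colouring E (map_of h)" "v \<in> available V h"
  shows "\<exists>c. legal_colour E k h v c"
proof -
  have "\<mu> \<le> card (unseen E k (map_of h) v) + 2 * nAD h + 2"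
    using assms(1,3) unfolding ok_def by (auto split: if_splits)
  \<comment> \<open>One of the unseen colours may be the present colour of \<open>v\<close>, so two
    are required.\<close>
  then have "2 \<le> card (unseen E k (map_of h) v)" using card_AD[of h] mu by linarith
  then obtain c where "c \<in> unseen E k (map_of h) v" "Some c \<noteq> map_of h v" using card_ge2_other by blast
  then show ?thesis using unseen_legal[OF assms(2), of c k v] no_loop by metis
qed

lemma pick:
  "pick h \<in> available V h" "danger h \<noteq> {} \<Longrightarrow> pick h \<in> danger h"
  "danger h = {} \<Longrightarrow> u \<in> available V h \<Longrightarrow> WtC h u \<le> WtC h (pick h)"
proof -
  have fin: "finite (available V h)" unfolding available_def by simp
  have mx: "\<exists>v. v \<in> available V h \<and> (\<forall>u\<in>available V h. WtC h u \<le> WtC h v)"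
  proof -
    let ?W = "WtC h ` available V h"
    have "Max ?W \<in> ?W" using fin avail_nonempty by (intro Max_in) auto
    then obtain v where "v \<in> available V h" "WtC h v = Max ?W" by force
    then show ?thesis using fin by (intro exI[of _ v]) auto
  qed
  show "danger h \<noteq> {} \<Longrightarrow> pick h \<in> danger h" unfolding pick_def by (auto intro: someI)
  then show "pick h \<in> available V h"
    using someI_ex[OF mx] unfolding pick_def danger_def by (auto split: if_splits)
  show "danger h = {} \<Longrightarrow> u \<in> available V h \<Longrightarrow> WtC h u \<le> WtC h (pick h)"
    using someI_ex[OF mx] unfolding pick_def by auto
qed

lemma strat:
  assumes "ok h" "proper_colouring E (map_of h)"
  shows "legal_move V E k h (strat h)" "danger h = {} \<Longrightarrow> snd (strat h) \<in> {1..P}" "fst (strat h) = pick h"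
proof -
  have "\<exists>c. legal_colour E k h (pick h) c \<and> (danger h = {} \<longrightarrow> c \<le> P)"
  proof (cases "danger h = {}")
    case True
    then have "\<mu> < card (unseen E P (map_of h) (pick h))" using pick(1)[of h] unfolding danger_def by force
    then have "2 \<le> card (unseen E P (map_of h) (pick h))" using mu by simp
    then obtain c where c: "c \<in> unseen E P (map_of h) (pick h)" "Some c \<noteq> map_of h (pick h)"
      using card_ge2_other by blast
    have "c \<in> unseen E k (map_of h) (pick h)" "c \<le> P" using c(1) k unfolding unseen_def by auto
    then show ?thesis using unseen_legal[OF assms(2), of c k "pick h"] no_loop c by metis
  next
    case False
    then show ?thesis using ok_legal[OF assms pick(1)] by blast
  qed
  from someI_ex[OF this] show "legal_move V E k h (strat h)" "danger h = {} \<Longrightarrow> snd (strat h) \<in> {1..P}" "fst (strat h) = pick h"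
    using pick(1)[of h] unfolding strat_def legal_move_def by (auto simp: legal_colour_def)
qed

lemma available_cur: "available V h = V - (curA h \<union> curB h)"
  unfolding available_def chosen_cur ..

lemma ok_alice:
  assumes "ok h" "proper_colouring E (map_of h)" "even (length h)"
  shows "ok (strat h # h)"
proof -
  obtain u c where uc: "strat h = (u, c)" by (cases "strat h")
  note st = strat[OF assms(1,2)]
  have u: "u = pick h" using st(3) uc by simp
  have ua: "u \<in> V" "u \<notin> curA h" "u \<notin> curB h" using pick(1)[of h] unfolding u available_cur by auto
  note cur = cur_Cons_even[OF assms(3), of "(u, c)", unfolded fst_conv]
  let ?h = "(u, c) # h"
  have od: "odd (length ?h)" using assms(3) by simp
  have fin: "finite (curA h)" "finite (curB h)"
    using assms(1) finite_subset[of _ V] unfolding ok_def by auto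
  have "\<not> n dvd Suc (length h)" using assms(3) n(1) by (meson dvd_trans even_Suc)
  then have md: "length ?h mod n = Suc (length h mod n)"
    by (auto simp: mod_Suc dvd_eq_mod_eq_0 split: if_splits)
  have finD: "finite (curD ?h)" by (rule card_curD)
  have AD: "nAD h \<le> nAD ?h"
    using finD unfolding cur by (intro card_mono) auto
  have AD1: "nAD h + 1 \<le> nAD ?h" if "danger h \<noteq> {}"
  proof -
    have "insert u (curA h \<inter> curD h) \<subseteq> curA ?h \<inter> curD ?h" using pick(2)[OF that, folded u] unfolding cur by auto
    then have "card (insert u (curA h \<inter> curD h)) \<le> nAD ?h" using finD by (intro card_mono) auto
    then show ?thesis using fin ua by simp
  qed
  have av: "available V ?h \<subseteq> available V h" unfolding available_cur cur by auto
  have l1: "1 \<le> 1 + l" using l by simp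
  have PhiI: "PhiC h \<le> real n * (1 + l) ^ nAD h"
    using assms(1,3) unfolding ok_def by auto
  have "ok ?h"
    unfolding ok_def
  proof (intro conjI ballI)
    show "curA ?h \<inter> curB ?h = {}" using assms(1) ua unfolding ok_def cur by auto
    show "card (curA ?h \<union> curB ?h) = length ?h mod n"
      using assms(1) ua fin unfolding ok_def cur md by auto
    show "curA ?h \<union> curB ?h \<subseteq> V" using assms(1) ua unfolding ok_def cur by auto
  next
    fix v assume v: "v \<in> curA ?h - curD ?h"
    show "\<exists>c\<in>{1..P}. map_of ?h v = Some c"
    proof (cases "v = u")
      case True
      then have "danger h = {}" using v True pick(2)[of h, folded u] unfolding cur by auto
      then show ?thesis using st(2) uc True by auto
    next
      case False
      then have "v \<in> curA h - curD h" using v unfolding cur by auto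
      then show ?thesis using assms(1) False unfolding ok_def by auto
    qed
  next
    have *: "PhiC ?h + l * WtC ?h v \<le> real n * (1 + l) ^ nAD ?h"
      if v: "v \<in> available V ?h" for v
    proof (cases "danger h = {}")
      case True
      have "WtC ?h v \<le> WtC h u"
        using Wt_A_le[OF ua(2), of "curB h" v] pick(3)[OF True, of v, folded u] v av unfolding cur by fastforce
      then have "l * WtC ?h v \<le> l * WtC h u" using l by simp
      then have "PhiC ?h + l * WtC ?h v \<le> PhiC h"
        using Phi_A[OF ua(2), of "curB h"] unfolding cur by linarith
      also note PhiI
      also have "real n * (1 + l) ^ nAD h \<le> real n * (1 + l) ^ nAD ?h"
        using power_increasing[OF AD l1] by (intro mult_left_mono) auto
      finally show ?thesis .
    next
      case False
      \<comment> \<open>In an emergency the vertex is not chosen by weight. The trivial bound of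
        \<open>Wt\<close> by \<open>Phi\<close> then loses a factor \<open>1 + l\<close>, which the
        larger \<open>nAD\<close> pays for.\<close>
      have "PhiC ?h \<le> PhiC h"
        using Phi_A[OF ua(2), of "curB h"] l Wt_nonneg unfolding cur by simp
      moreover have "WtC ?h v \<le> PhiC ?h" by (rule Wt_le_Phi)
      ultimately have "PhiC ?h + l * WtC ?h v \<le> PhiC h + l * PhiC h"
        using l by (intro add_mono mult_left_mono) auto
      also have "\<dots> = (1 + l) * PhiC h" by (simp add: algebra_simps)
      also have "\<dots> \<le> (1 + l) * (real n * (1 + l) ^ nAD h)"
        using PhiI l by (intro mult_left_mono) auto
      also have "\<dots> = real n * (1 + l) ^ (nAD h + 1)" by simp
      also have "\<dots> \<le> real n * (1 + l) ^ nAD ?h"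
        by (intro mult_left_mono power_increasing[OF AD1[OF False] l1]) auto
      finally show ?thesis .
    qed
    then show "if even (length ?h)
      then PhiC ?h \<le> real n * (1 + l) ^ nAD ?h
      else \<forall>u\<in>available V ?h. PhiC ?h + l * WtC ?h u \<le> real n * (1 + l) ^ nAD ?h"
      using od by (simp only: if_False not_False_eq_True) blast
  next
    fix v assume "v \<in> available V ?h"
    then have v: "v \<in> available V h" using av by auto
    have drop: "card (unseen E k (map_of h) v) \<le> card (unseen E k (map_of ?h) v) + 1" by (rule card_unseen_Cons)
    have "\<mu> \<le> card (unseen E k (map_of ?h) v) + 2 * nAD ?h + 1"
    proof (cases "danger h = {}")
      case True
      \<comment> \<open>Without endangered vertices the palette alone supplies the margin, and
        earlier losses are forgotten.\<close>
      then have "\<mu> < card (unseen E P (map_of h) v)" using v unfolding danger_def by force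
      also have "\<dots> \<le> card (unseen E k (map_of h) v)" using k by (intro card_mono) (auto simp: unseen_def)
      finally show ?thesis using drop by simp
    next
      case False
      have "\<mu> \<le> card (unseen E k (map_of h) v) + 2 * nAD h + 2"
        using assms(1,3) v unfolding ok_def by auto
      then show ?thesis using drop AD1[OF False] by linarith
    qed
    then show "\<mu> \<le> card (unseen E k (map_of ?h) v) + 2 * nAD ?h + (if even (length ?h) then 2 else 1)"
      using od by simp
  qed
  then show ?thesis unfolding uc .
qed

lemma ok_bob:
  assumes "ok h" "odd (length h)" "legal_move V E k h m"
  shows "ok (m # h)"
proof -
  obtain u c where uc: "m = (u, c)" by (cases m)
  have uav: "u \<in> available V h" using assms(3) unfolding uc legal_move_def by simp
  then have ua: "u \<in> V" "u \<notin> curA h" "u \<notin> curB h" unfolding available_cur by auto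
  let ?h = "(u, c) # h"
  note rnd = round_Cons_odd[OF assms(2), of "(u, c)", unfolded fst_conv]
  have ev: "even (length ?h)" using assms(2) by simp
  have fin: "finite (curA h)" "finite (curB h)"
    using assms(1) finite_subset[of _ V] unfolding ok_def by auto
  have PhiI: "Phi (roundA ?h) (roundB ?h) \<le> real n * (1 + l) ^ card (roundA ?h \<inter> roundD ?h)"
    using assms(1,2) uav Phi_B[OF ua(3), of "curA h"] unfolding ok_def rnd by auto
  have dj: "roundA ?h \<inter> roundB ?h = {}" using assms(1) ua unfolding ok_def rnd by auto
  have cd: "card (roundA ?h \<union> roundB ?h) = Suc (length h mod n)"
    using assms(1) ua fin unfolding ok_def rnd by auto
  have sub: "roundA ?h \<union> roundB ?h \<subseteq> V" using assms(1) ua unfolding ok_def rnd by auto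
  have pal: "\<exists>c\<in>{1..P}. map_of ?h v = Some c" if "v \<in> roundA ?h - roundD ?h" for v
    using assms(1) that ua unfolding ok_def rnd by auto
  have "ok ?h"
  proof (cases "n dvd length ?h")
    case False
    then have cur: "curA ?h = roundA ?h" "curB ?h = roundB ?h" "curD ?h = roundD ?h"
      unfolding curA_def curB_def curD_def by auto
    have md: "length ?h mod n = Suc (length h mod n)"
      using False by (auto simp: mod_Suc dvd_eq_mod_eq_0 split: if_splits)
    have un: "\<mu> \<le> card (unseen E k (map_of ?h) v) + 2 * card (roundA ?h \<inter> roundD ?h) + 2" if v: "v \<in> available V ?h" for v
    proof -
      have "v \<in> available V h" using v unfolding available_cur cur rnd by auto
      then have "\<mu> \<le> card (unseen E k (map_of h) v) + 2 * card (roundA ?h \<inter> roundD ?h) + 1"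
        using assms(1,2) unfolding ok_def rnd by auto
      then show ?thesis using card_unseen_Cons[of E k h v "(u, c)"] by linarith
    qed
    show ?thesis unfolding ok_def cur md using ev dj cd sub pal PhiI un unfolding cur by (simp only: if_True) blast
  next
    case True
    then have cur: "curA ?h = {}" "curB ?h = {}" "curD ?h = {}" and md: "length ?h mod n = 0"
      unfolding curA_def curB_def curD_def by auto
    have "Suc (length h mod n) = n" using True n by (simp add: mod_Suc dvd_eq_mod_eq_0 split: if_splits)
    then have all: "roundA ?h \<union> roundB ?h = V" using cd sub by (intro card_subset_eq) auto
    have un: "\<mu> \<le> card (unseen E k (map_of ?h) v)" if v: "v \<in> V" for v
    proof -
      let ?B = "roundB ?h \<inter> Nb v" and ?A = "roundA ?h \<inter> Nb v" and ?f = "map_of ?h"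
      have fB: "finite ?B" "finite ?A" "finite (roundD ?h)" using fin_Nb fin_roundD by (blast intro: finite_Int)+
      have "card ?B + card ?A = card (?B \<union> ?A)" using dj fB by (intro card_Un_disjoint[symmetric]) auto
      also have "\<dots> \<le> card (Nb v)" using fin_Nb by (intro card_mono) auto
      also have "\<dots> \<le> d" using deg unfolding Nb_def .
      finally have sz: "card ?B + card ?A \<le> d" .
      have cAD: "card (roundA ?h \<inter> roundD ?h) \<le> D"
        using card_roundD[of ?h] card_mono[of "roundD ?h" "roundA ?h \<inter> roundD ?h"] fB by (meson inf_le2 le_trans)
      \<comment> \<open>A single weight is at most the potential; \<open>pot\<close> turns this into
        a bound on Bob's share of the neighbourhood.\<close>
      have "wt (roundA ?h) (roundB ?h) v \<le> Phi (roundA ?h) (roundB ?h)"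
        unfolding Phi_def using v wt_pos[THEN less_imp_le] by (intro member_le_sum) auto
      also note PhiI
      also have "real n * (1 + l) ^ card (roundA ?h \<inter> roundD ?h) \<le> real n * (1 + l) ^ D"
        using cAD l by (intro mult_left_mono power_increasing) auto
      finally have Bb: "card ?B \<le> b" using pot[OF sz] unfolding wt_def by simp
      \<comment> \<open>A colour seen at the end of the round lies in the palette, on a vertex
        endangered during the round, or on a neighbour taken by Bob: Alice's remaining vertices have
        palette colours.\<close>
      have "{1..k} \<subseteq> unseen E k ?f v \<union> ({1..P} \<union> (\<lambda>w. the (?f w)) ` roundD ?h \<union> (\<lambda>w. the (?f w)) ` ?B)"
      proof
        fix d assume d: "d \<in> {1..k}"
        show "d \<in> unseen E k ?f v \<union> ({1..P} \<union> (\<lambda>w. the (?f w)) ` roundD ?h \<union> (\<lambda>w. the (?f w)) ` ?B)"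
        proof (cases "d \<in> unseen E k ?f v")
          case False
          then obtain w where w: "{w, v} \<in> E" "?f w = Some d" using d unfolding unseen_def by blast
          then have "w \<in> roundA ?h \<union> roundB ?h" "w \<in> Nb v" using all edge[OF w(1)] unfolding Nb_def by auto
          moreover have "the (?f w) = d" using w(2) by simp
          moreover have "d \<in> {1..P}" if "w \<in> roundA ?h - roundD ?h" using pal[OF that] w(2) by auto
          ultimately show ?thesis by blast
        qed blast
      qed
      then have "card {1..k} \<le> card (unseen E k ?f v \<union> ({1..P} \<union> (\<lambda>w. the (?f w)) ` roundD ?h \<union> (\<lambda>w. the (?f w)) ` ?B))"
        using fB by (intro card_mono) auto
      also have "\<dots> \<le> card (unseen E k ?f v) + (card {1..P} + card ((\<lambda>w. the (?f w)) ` roundD ?h) + card ((\<lambda>w. the (?f w)) ` ?B))"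
        by (meson card_Un_le add_mono le_trans order_refl)
      also have "\<dots> \<le> card (unseen E k ?f v) + (P + D + b)"
        using card_image_le[OF fB(3), of "\<lambda>w. the (?f w)"] card_image_le[OF fB(1), of "\<lambda>w. the (?f w)"] card_roundD[of ?h] Bb by simp
      finally show ?thesis using k by simp
    qed
    have "available V ?h \<subseteq> V" unfolding available_def by auto
    then have "\<mu> \<le> card (unseen E k (map_of ?h) v) + 2 * card ({} \<inter> {} :: nat set) + (if even (length ?h) then 2 else 1)"
      if "v \<in> available V ?h" for v using un that by (meson subsetD trans_le_add1)
    moreover have "Phi {} {} \<le> real n * (1 + l) ^ card ({} \<inter> {} :: nat set)" using Phi_empty by simp
    ultimately show ?thesis unfolding ok_def cur md using ev by auto
  qed
  then show ?thesis unfolding uc .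
qed

lemma alice_wins: "alice_wins V E k"
proof -
  have inv: "ok h" if "play V E k strat h" for h
    using that
  proof induction
    case start
    have "\<mu> \<le> card (unseen E k (map_of []) v)" for v :: nat
    proof -
      have "unseen E k (map_of []) v = {1..k}" by (auto simp: unseen_def)
      then show ?thesis using k by simp
    qed
    then show ?case using Phi_empty by (auto simp: ok_def curA_def curB_def curD_def intro: le_SucI)
  next
    case (alice h)
    then show ?case using ok_alice play_props(1) by blast
  next
    case (bob h m)
    then show ?case using ok_bob by blast
  qed
  have "winning_strategy V E k strat"
    unfolding winning_strategy_def
    using inv strat(1) ok_legal play_props(1) by blast
  then show ?thesis unfolding alice_wins_def by blast
qed

end

section \<open>Typical properties of the random graph\<close>

lemma card_bounded_subsets:
  assumes "finite A"
  shows "finite {F. F \<subseteq> A \<and> card F \<le> r}" "card {F. F \<subseteq> A \<and> card F \<le> r} \<le> (card A + 1) ^ r"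
proof -
  show "finite {F. F \<subseteq> A \<and> card F \<le> r}" using assms by (auto intro: finite_subset[of _ "Pow A"])
  \<comment> \<open>A set with at most \<open>r\<close> elements is listed and padded with
    \<open>None\<close> to length \<open>r\<close>.\<close>
  let ?L = "{xs. set xs \<subseteq> insert None (Some ` A) \<and> length xs = r}"
  have fin: "finite ?L" using assms by (intro finite_lists_length_eq) auto
  have "{F. F \<subseteq> A \<and> card F \<le> r} \<subseteq> (\<lambda>xs. {x. Some x \<in> set xs}) ` ?L"
  proof safe
    fix F assume F: "F \<subseteq> A" "card F \<le> r"
    then obtain xs where xs: "set xs = F" "distinct xs" using assms finite_distinct_list finite_subset by metis
    then have "length xs = card F" using distinct_card by metis
    then show "F \<in> (\<lambda>xs. {x. Some x \<in> set xs}) ` ?L"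
      using F xs by (intro image_eqI[of _ _ "map Some xs @ replicate (r - length xs) None"]) auto
  qed
  then have "card {F. F \<subseteq> A \<and> card F \<le> r} \<le> card ?L" using fin by (rule surj_card_le[rotated])
  also have "\<dots> = (card A + 1) ^ r"
    using assms by (subst card_lists_length_eq) (auto simp: card_insert_if card_image)
  finally show "card {F. F \<subseteq> A \<and> card F \<le> r} \<le> (card A + 1) ^ r" .
qed

lemma prob_UN_le:
  fixes M :: "'a pmf"
  assumes "finite I" "\<And>i. i \<in> I \<Longrightarrow> measure_pmf.prob M (A i) \<le> c"
  shows "measure_pmf.prob M (\<Union>i\<in>I. A i) \<le> real (card I) * c"
proof -
  have "measure_pmf.prob M (\<Union>i\<in>I. A i) \<le> (\<Sum>i\<in>I. measure_pmf.prob M (A i))"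
    using assms(1) by (intro measure_pmf.finite_measure_subadditive_finite) auto
  also have "\<dots> \<le> real (card I) * c" using assms(2) by (rule sum_bounded_above)
  finally show ?thesis .
qed

text \<open>The extra one is for the empty set, which may belong to \<open>F\<close> as
  well.\<close>

lemma card_disjoint_family:
  assumes "finite V" "pairwise disjnt F" "\<And>Y. Y \<in> F \<Longrightarrow> Y \<subseteq> V"
  shows "card F \<le> card V + 1"
proof -
  have fF: "finite F" using assms by (intro finite_subset[of F "Pow V"]) auto
  let ?F = "F - {{}}"
  have fin: "finite Y" if "Y \<in> F" for Y using assms that finite_subset by blast
  have "card ?F = (\<Sum>Y\<in>?F. 1)" by simp
  also have "\<dots> \<le> (\<Sum>Y\<in>?F. card Y)" using fin by (intro sum_mono) (auto simp: Suc_le_eq card_gt_0_iff)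
  also have "\<dots> = card (\<Union>?F)"
    using assms(2) fin by (intro card_Union_disjoint[symmetric]) (auto simp: pairwise_def)
  also have "\<dots> \<le> card V" using assms by (intro card_mono) auto
  finally have "card ?F \<le> card V" .
  moreover have "card F \<le> card (insert {} ?F)" using fF by (intro card_mono) auto
  moreover have "card (insert {} ?F) = Suc (card ?F)" by (rule card_insert_disjoint) (use fF in auto)
  ultimately show ?thesis by simp
qed

text \<open>For \<open>q = (1 - p) ^ J\<close>, at least a fraction \<open>q\<close> of the pairs is
  expected to be non-adjacent; here it is at most half of that. \<open>Z\<close> must avoid the sets
  of \<open>F\<close> so that different pairs use different potential edges.\<close>

definition dense_pair :: "nat \<Rightarrow> nat \<Rightarrow> real \<Rightarrow> real \<Rightarrow> nat set set \<Rightarrow> nat set \<Rightarrow> nat set set \<Rightarrow> bool" where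
  "dense_pair n J \<kappa> q E Z F \<longleftrightarrow> Z \<subseteq> {..<n} \<and> (\<forall>Y\<in>F. Y \<subseteq> {..<n} \<and> card Y \<le> J) \<and> pairwise disjnt F \<and>
     Z \<inter> \<Union>F = {} \<and> \<kappa> * n \<le> card Z \<and> \<kappa> * n \<le> card F \<and>
     real (card {(v, Y) \<in> Z \<times> F. v \<notin> nbrs E Y}) \<le> q / 2 * (card Z * card F)"

text \<open>For fixed \<open>Z\<close> and \<open>F\<close> there are at least
  \<open>(\<kappa> * n)\<^sup>2\<close> independent non-adjacency events of probability at least
  \<open>(1 - p) ^ J\<close>; the deviation is half of this value. The prefactor counts the choices
  of \<open>Z\<close> and \<open>F\<close>.\<close>

lemma prob_dense_pair:
  assumes p: "0 < p" "p < 1" and \<kappa>: "0 < \<kappa>"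
  shows "gnp_prob n p {E. \<exists>Z F. dense_pair n J \<kappa> ((1 - p) ^ J) E Z F}
    \<le> 2 ^ n * (real n + 2) ^ ((J + 1) * (n + 1)) * exp (- (((1 - p) ^ J)\<^sup>2 * \<kappa>\<^sup>2 / 2 * (real n)\<^sup>2))"
proof -
  define q where "q = (1 - p) ^ J"
  define \<J> where "\<J> = {Y. Y \<subseteq> {..<n} \<and> card Y \<le> J}"
  define \<F> where "\<F> = {F. F \<subseteq> \<J> \<and> card F \<le> n + 1}"
  define A where "A i = (case i of (Z, F) \<Rightarrow> {E. dense_pair n J \<kappa> q E Z F})" for i
  have fJ: "finite \<J>" "card \<J> \<le> (n + 1) ^ J"
    using card_bounded_subsets[of "{..<n}" J] unfolding \<J>_def by auto
  have fF: "finite \<F>" "card \<F> \<le> (card \<J> + 1) ^ (n + 1)"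
    using card_bounded_subsets[OF fJ(1), of "n + 1"] unfolding \<F>_def by auto
  have single: "gnp_prob n p (A i) \<le> exp (- (q\<^sup>2 * \<kappa>\<^sup>2 / 2 * (real n)\<^sup>2))" for i
  proof -
    obtain Z F where i: "i = (Z, F)" by (cases i)
    show ?thesis
    proof (cases "Z \<subseteq> {..<n} \<and> (\<forall>Y\<in>F. Y \<subseteq> {..<n} \<and> card Y \<le> J) \<and> pairwise disjnt F \<and>
     Z \<inter> \<Union>F = {} \<and> \<kappa> * n \<le> card Z \<and> \<kappa> * n \<le> card F")
      case True
      define N where "N = (\<lambda>(v :: nat, Y). (\<lambda>y. {v, y}) ` Y)"
      have fin: "finite (Z \<times> F)" "finite F" "finite Z"
        using True finite_subset[of F "Pow {..<n}"] finite_subset[of Z "{..<n}"] by auto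
      have card_N: "card (N (v, Y)) \<le> J" if "(v, Y) \<in> Z \<times> F" for v Y
      proof -
        have "card (N (v, Y)) \<le> card Y" unfolding N_def using that True finite_subset[of Y "{..<n}"] by (auto intro!: card_image_le)
        then show ?thesis using that True by fastforce
      qed
      have disj: "disjoint_family_on (\<lambda>i. {} \<union> N i) (Z \<times> F)"
        unfolding disjoint_family_on_def
      proof (intro ballI impI, rule ccontr)
        fix a b assume ab: "a \<in> Z \<times> F" "b \<in> Z \<times> F" "a \<noteq> b" "({} \<union> N a) \<inter> ({} \<union> N b) \<noteq> {}"
        obtain v Y w Y' where [simp]: "a = (v, Y)" "b = (w, Y')" by (cases a, cases b)
        obtain y y' where y: "y \<in> Y" "y' \<in> Y'" "{v, y} = {w, y'}" using ab(4) unfolding N_def by auto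
        have vw: "v \<in> Z" "w \<in> Z" "Y \<in> F" "Y' \<in> F" using ab(1,2) by auto
        have "\<Union>F \<inter> Z = {}" and pw: "pairwise disjnt F" using True by auto
        then have "y \<notin> Z" "y' \<notin> Z" using vw(3,4) y(1,2) by blast+
        then have "v = w" "y = y'" using y(3) vw(1,2) by (auto simp: doubleton_eq_iff)
        then have "\<not> disjnt Y Y'" using y(1,2) unfolding disjnt_def by blast
        then have "Y = Y'" using pw vw(3,4) unfolding pairwise_def by blast
        then show False using ab(3) \<open>v = w\<close> by simp
      qed
      have "gnp_prob n p
         {E. real (card {i \<in> Z \<times> F. {} \<subseteq> E \<and> N i \<inter> E = {}}) \<le> (q - q / 2) * real (card (Z \<times> F))}
           \<le> exp (- 2 * (q / 2)\<^sup>2 * real (card (Z \<times> F)))"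
      proof (rule gnp_lower_tail[where P = "\<lambda>_. {}" and N = N])
        fix i assume i: "i \<in> Z \<times> F"
        then obtain v Y where vY: "i = (v, Y)" "v \<in> Z" "Y \<in> F" by auto
        have "Y \<subseteq> {..<n}" "v \<in> {..<n}" "v \<notin> Y" using True vY by auto
        then show "{} \<union> N i \<subseteq> all_edges {..<n}"
          unfolding N_def all_edges_def vY by (auto simp: card_insert_if)
        show "q \<le> p ^ card ({} :: nat set set) * (1 - p) ^ card (N i)"
          unfolding q_def using card_N i p vY by (auto intro!: power_decreasing)
      qed (use p fin disj in \<open>auto simp: q_def\<close>)
      also have "{E. real (card {i \<in> Z \<times> F. {} \<subseteq> E \<and> N i \<inter> E = {}}) \<le> (q - q / 2) * real (card (Z \<times> F))} = A i"
      proof -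
        have "{i \<in> Z \<times> F. {} \<subseteq> E \<and> N i \<inter> E = {}} = {(v, Y) \<in> Z \<times> F. v \<notin> nbrs E Y}" for E
          unfolding N_def nbrs_def by auto
        then show ?thesis unfolding A_def i using True by (auto simp: dense_pair_def card_cartesian_product)
      qed
      also have "exp (- 2 * (q / 2)\<^sup>2 * real (card (Z \<times> F))) \<le> exp (- (q\<^sup>2 * \<kappa>\<^sup>2 / 2 * (real n)\<^sup>2))"
      proof -
        have "(\<kappa> * n) * (\<kappa> * n) \<le> real (card Z) * real (card F)" using True \<kappa> by (intro mult_mono) auto
        then have "q\<^sup>2 / 2 * ((\<kappa> * n) * (\<kappa> * n)) \<le> q\<^sup>2 / 2 * (real (card Z) * real (card F))" by (intro mult_left_mono) auto
        then show ?thesis by (simp add: card_cartesian_product power2_eq_square algebra_simps)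
      qed
      finally show ?thesis .
    next
      case False
      then have "A i = {}" unfolding A_def i by (auto simp: dense_pair_def)
      then show ?thesis by simp
    qed
  qed
  have "{E. \<exists>Z F. dense_pair n J \<kappa> q E Z F} \<subseteq> (\<Union>i\<in>Pow {..<n} \<times> \<F>. A i)"
  proof safe
    fix E Z F assume d: "dense_pair n J \<kappa> q E Z F"
    then have "card F \<le> card {..<n} + 1" unfolding dense_pair_def by (intro card_disjoint_family) auto
    then have "F \<in> \<F>" "Z \<in> Pow {..<n}" using d unfolding \<F>_def \<J>_def dense_pair_def by auto
    then show "E \<in> (\<Union>i\<in>Pow {..<n} \<times> \<F>. A i)" using d unfolding A_def by (intro UN_I[of "(Z, F)"]) auto
  qed
  then have "gnp_prob n p {E. \<exists>Z F. dense_pair n J \<kappa> q E Z F}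
     \<le> gnp_prob n p (\<Union>i\<in>Pow {..<n} \<times> \<F>. A i)"
    by (rule measure_pmf.finite_measure_mono) simp
  also have "\<dots> \<le> real (card (Pow {..<n} \<times> \<F>)) * exp (- (q\<^sup>2 * \<kappa>\<^sup>2 / 2 * (real n)\<^sup>2))"
    using fF(1) by (intro prob_UN_le single finite_cartesian_product finite_Pow_iff[THEN iffD2] finite_lessThan)
  finally have *: "gnp_prob n p {E. \<exists>Z F. dense_pair n J \<kappa> q E Z F}
     \<le> real (card (Pow {..<n} \<times> \<F>)) * exp (- (q\<^sup>2 * \<kappa>\<^sup>2 / 2 * (real n)\<^sup>2))" .
  have "real (card (Pow {..<n} \<times> \<F>)) \<le> 2 ^ n * (real n + 2) ^ ((J + 1) * (n + 1))"
  proof -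
    have "card \<J> + 1 \<le> (n + 1) ^ J + 1 ^ J" using fJ(2) by simp
    also have "\<dots> \<le> (n + 2) ^ (J + 1)"
    proof -
      have "(n + 1) ^ J + 1 ^ J \<le> (n + 2) ^ J + (n + 2) ^ J" by (intro add_mono power_mono) auto
      also have "\<dots> = 2 * (n + 2) ^ J" by simp
      also have "\<dots> \<le> (n + 2) ^ (J + 1)" by simp
      finally show ?thesis .
    qed
    finally have "(card \<J> + 1) ^ (n + 1) \<le> ((n + 2) ^ (J + 1)) ^ (n + 1)" by (rule power_mono) simp
    with fF(2) have "card \<F> \<le> ((n + 2) ^ (J + 1)) ^ (n + 1)" by (rule le_trans)
    then have "card \<F> \<le> (n + 2) ^ ((J + 1) * (n + 1))" by (simp only: power_mult)
    then have "card (Pow {..<n} \<times> \<F>) \<le> 2 ^ n * (n + 2) ^ ((J + 1) * (n + 1))"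
      by (simp add: card_cartesian_product card_Pow)
    then have "real (card (Pow {..<n} \<times> \<F>)) \<le> real (2 ^ n * (n + 2) ^ ((J + 1) * (n + 1)))" by (rule of_nat_mono)
    also have "\<dots> = 2 ^ n * (real n + 2) ^ ((J + 1) * (n + 1))" by (simp only: of_nat_mult of_nat_power of_nat_add of_nat_numeral)
    finally show ?thesis .
  qed
  then have "real (card (Pow {..<n} \<times> \<F>)) * exp (- (q\<^sup>2 * \<kappa>\<^sup>2 / 2 * (real n)\<^sup>2))
    \<le> 2 ^ n * (real n + 2) ^ ((J + 1) * (n + 1)) * exp (- (q\<^sup>2 * \<kappa>\<^sup>2 / 2 * (real n)\<^sup>2))"
    by (rule mult_right_mono) simp
  with * have "gnp_prob n p {E. \<exists>Z F. dense_pair n J \<kappa> q E Z F}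
    \<le> 2 ^ n * (real n + 2) ^ ((J + 1) * (n + 1)) * exp (- (q\<^sup>2 * \<kappa>\<^sup>2 / 2 * (real n)\<^sup>2))"
    by (rule order_trans)
  then show ?thesis unfolding q_def .
qed

lemma dense_pair_whp:
  assumes p: "0 < p" "p < 1" and \<kappa>: "0 < \<kappa>"
  shows "(\<lambda>n. gnp_prob n p {E. \<exists>Z F. dense_pair n J \<kappa> ((1 - p) ^ J) E Z F}) \<longlonglongrightarrow> 0"
proof (rule tendsto_sandwich[OF _ _ tendsto_const])
  define c where "c = ((1 - p) ^ J)\<^sup>2 * \<kappa>\<^sup>2 / 2"
  have c: "c > 0" unfolding c_def using p \<kappa> by simp
  define j where "j = real J + 1"
  have "j > 0" unfolding j_def by simp
  have *: "2 ^ n * (real n + 2) ^ ((J + 1) * (n + 1)) * exp (- (c * (real n)\<^sup>2))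
      = exp (real n * ln 2 + j * (real n + 1) * ln (real n + 2) - c * (real n)\<^sup>2)" for n
  proof -
    have "(real n + 2) ^ ((J + 1) * (n + 1)) = exp (j * (real n + 1) * ln (real n + 2))"
      unfolding j_def using exp_of_nat_mult[of "(J + 1) * (n + 1)" "ln (real n + 2)"] by (simp add: algebra_simps)
    moreover have "(2 :: real) ^ n = exp (real n * ln 2)" by (simp add: exp_of_nat_mult)
    moreover have "exp (real n * ln 2 + j * (real n + 1) * ln (real n + 2) - c * (real n)\<^sup>2)
      = exp (real n * ln 2) * exp (j * (real n + 1) * ln (real n + 2)) * exp (- (c * (real n)\<^sup>2))"
      by (simp flip: exp_add)
    ultimately show ?thesis by metis
  qed
  have "(\<lambda>n :: nat. exp (real n * ln 2 + j * (real n + 1) * ln (real n + 2) - c * (real n)\<^sup>2)) \<longlonglongrightarrow> 0"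
    using c \<open>j > 0\<close> by real_asymp
  then show "(\<lambda>n. 2 ^ n * (real n + 2) ^ ((J + 1) * (n + 1)) * exp (- (((1 - p) ^ J)\<^sup>2 * \<kappa>\<^sup>2 / 2 * (real n)\<^sup>2))) \<longlonglongrightarrow> 0"
    unfolding c_def[symmetric] * .
  show "\<forall>\<^sub>F n in sequentially. gnp_prob n p {E. \<exists>Z F. dense_pair n J \<kappa> ((1 - p) ^ J) E Z F}
    \<le> 2 ^ n * (real n + 2) ^ ((J + 1) * (n + 1)) * exp (- (((1 - p) ^ J)\<^sup>2 * \<kappa>\<^sup>2 / 2 * (real n)\<^sup>2))"
    by (intro always_eventually allI prob_dense_pair assms)
qed simp

text \<open>Large degree means few non-neighbours, so the lower tail suffices.\<close>

lemma degree_whp: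
  assumes p: "0 < p" "p < 1" and \<delta>: "0 < \<delta>"
  shows "(\<lambda>n. gnp_prob n p {E. E \<subseteq> all_edges {..<n} \<and> (\<exists>v. (p + \<delta>) * n < card {u. {u, v} \<in> E})}) \<longlonglongrightarrow> 0"
    (is "(\<lambda>n. gnp_prob n p (?X n)) \<longlonglongrightarrow> _")
proof (rule tendsto_sandwich[OF _ _ tendsto_const])
  show "(\<lambda>n. real n * exp (- 2 * \<delta>\<^sup>2 * (real n - 1))) \<longlonglongrightarrow> 0" using \<delta> by real_asymp
  show "\<forall>\<^sub>F n in sequentially. gnp_prob n p (?X n)
    \<le> real n * exp (- 2 * \<delta>\<^sup>2 * (real n - 1))"
  proof (rule always_eventually, rule allI)
    fix n :: nat
    define A where "A v = {E. real (card {u \<in> {..<n} - {v}. {} \<subseteq> E \<and> {{u, v}} \<inter> E = {}}) \<le> (1 - p - \<delta>) * real (card ({..<n} - {v}))}" for v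
    have A: "gnp_prob n p (A v) \<le> exp (- 2 * \<delta>\<^sup>2 * (real n - 1))" if v: "v < n" for v
    proof -
      have "gnp_prob n p (A v) \<le> exp (- 2 * \<delta>\<^sup>2 * real (card ({..<n} - {v})))"
        unfolding A_def
        by (rule gnp_lower_tail[where P = "\<lambda>_. {}" and N = "\<lambda>u. {{u, v}}"])
          (use p \<delta> v in \<open>auto simp: all_edges_def card_insert_if disjoint_family_on_def doubleton_eq_iff\<close>)
      also have "real (card ({..<n} - {v})) = real n - 1" using v by simp
      finally show ?thesis .
    qed
    have "?X n \<subseteq> (\<Union>v\<in>{..<n}. A v)"
    proof safe
      fix E v assume E: "E \<subseteq> all_edges {..<n}" and v: "(p + \<delta>) * n < card {u. {u, v} \<in> E}"
      note edge = all_edgesD[OF E]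
      have "0 \<le> (p + \<delta>) * n" using p \<delta> by simp
      then have "0 < card {u. {u, v} \<in> E}" using v by linarith
      then obtain u where "{u, v} \<in> E" by (metis (mono_tags, lifting) card_gt_0_iff empty_Collect_eq)
      then have vn: "v < n" using edge by blast
      define A1 where "A1 = {u. {u, v} \<in> E}"
      define A2 where "A2 = {u \<in> {..<n} - {v}. {} \<subseteq> E \<and> {{u, v}} \<inter> E = {}}"
      have "A1 \<subseteq> {..<n} - {v}" unfolding A1_def using edge by blast
      then have eq: "{..<n} - {v} = A1 \<union> A2" and dj: "A1 \<inter> A2 = {}" unfolding A1_def A2_def by blast+
      then have fin: "finite A1" "finite A2" by (metis finite_Diff finite_Un finite_lessThan)+
      have "card ({..<n} - {v}) = card A1 + card A2" unfolding eq by (rule card_Un_disjoint[OF fin dj])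
      moreover have "card ({..<n} - {v}) = n - 1" using vn by simp
      ultimately have c: "real (card A2) = real n - 1 - card A1" using vn by linarith
      have "real n - 1 - card A1 \<le> real n - 1 - (p + \<delta>) * n" using v unfolding A1_def by simp
      also have "\<dots> \<le> (1 - p - \<delta>) * (real n - 1)" using p \<delta> by (simp add: algebra_simps)
      finally have "E \<in> A v" unfolding A_def A2_def[symmetric] mem_Collect_eq c using vn by simp
      then show "E \<in> (\<Union>v\<in>{..<n}. A v)" using vn by auto
    qed
    then have "gnp_prob n p (?X n)
       \<le> gnp_prob n p (\<Union>v\<in>{..<n}. A v)" by (intro measure_pmf.finite_measure_mono) auto
    also have "\<dots> \<le> real (card {..<n}) * exp (- 2 * \<delta>\<^sup>2 * (real n - 1))"
      by (rule prob_UN_le) (use A in auto)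
    finally show "gnp_prob n p (?X n)
      \<le> real n * exp (- 2 * \<delta>\<^sup>2 * (real n - 1))" by simp
  qed
qed auto

definition atom :: "nat \<Rightarrow> nat \<Rightarrow> nat set set \<Rightarrow> nat set \<Rightarrow> nat set" where
  "atom m n E S = {x \<in> {m..<n}. {v \<in> {..<m}. {x, v} \<in> E} = S}"

text \<open>For different vertices outside \<open>Y\<close>, the edges to the targets and to
  \<open>Y\<close> are distinct, and there are only polynomially many choices of \<open>S\<close>
  and \<open>Y\<close> for fixed \<open>m\<close> and \<open>J\<close>. Vertices of \<open>Y\<close>
  are discarded because they would share edges; hence \<open>n - m - J\<close>. The case
  \<open>J = 0\<close> yields the sizes of the atoms themselves.\<close>

lemma atom_whp:
  assumes p: "0 < p" "p < 1" and \<delta>: "0 < \<delta>"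
  shows "(\<lambda>n. gnp_prob n p {E. \<exists>S Y. S \<subseteq> {..<m} \<and> Y \<subseteq> {m..<n} \<and> card Y \<le> J \<and>
     card (atom m n E S - nbrs E Y) \<le> (p ^ card S * (1 - p) ^ (m - card S) * (1 - p) ^ J - \<delta>) * (real n - m - J)}) \<longlonglongrightarrow> 0"
    (is "(\<lambda>n. measure_pmf.prob _ (?X n)) \<longlonglongrightarrow> _")
proof (rule tendsto_sandwich[OF _ _ tendsto_const])
  define c where "c = real (2 ^ m)"
  define j where "j = real J"
  define j' where "j' = real m + real J"
  have c: "c > 0" "j \<ge> 0" unfolding c_def j_def by auto
  have *: "c * (real n + 1) ^ J * exp (- 2 * \<delta>\<^sup>2 * (real n - j')) = c * exp (j * ln (real n + 1) - 2 * \<delta>\<^sup>2 * (real n - j'))" for n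
  proof -
    have "exp (j * ln (real n + 1) - 2 * \<delta>\<^sup>2 * (real n - j')) = exp (j * ln (real n + 1)) * exp (- 2 * \<delta>\<^sup>2 * (real n - j'))"
      by (simp flip: exp_add)
    also have "exp (j * ln (real n + 1)) = (real n + 1) ^ J"
      unfolding j_def using exp_of_nat_mult[of J "ln (real n + 1)"] by simp
    finally show ?thesis by simp
  qed
  have "(\<lambda>n :: nat. c * exp (j * ln (real n + 1) - 2 * \<delta>\<^sup>2 * (real n - j'))) \<longlonglongrightarrow> 0"
    using \<delta> c by real_asymp
  then show "(\<lambda>n. c * (real n + 1) ^ J * exp (- 2 * \<delta>\<^sup>2 * (real n - j'))) \<longlonglongrightarrow> 0"
    unfolding * .
  show "\<forall>\<^sub>F n in sequentially. gnp_prob n p (?X n) \<le> c * (real n + 1) ^ J * exp (- 2 * \<delta>\<^sup>2 * (real n - j'))"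
    using eventually_ge_at_top[of m]
  proof eventually_elim
    case n: (elim n)
    define q where "q S = p ^ card S * (1 - p) ^ (m - card S) * (1 - p) ^ J" for S :: "nat set"
    define Ix where "Ix = Pow {..<m} \<times> {Y. Y \<subseteq> {..<n} \<and> card Y \<le> J}"
    define A where "A i = (case i of (S, Y) \<Rightarrow> {E. S \<subseteq> {..<m} \<and> Y \<subseteq> {m..<n} \<and> card Y \<le> J \<and> card (atom m n E S - nbrs E Y) \<le> (q S - \<delta>) * (real n - j')})" for i
    have A: "gnp_prob n p (A i) \<le> exp (- 2 * \<delta>\<^sup>2 * (real n - j'))" for i
    proof -
      obtain S Y where i: "i = (S, Y)" by (cases i)
      show ?thesis
      proof (cases "S \<subseteq> {..<m} \<and> Y \<subseteq> {m..<n} \<and> card Y \<le> J \<and> 0 \<le> (q S - \<delta>) * (real n - j') \<and> 0 < real n - j'")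
        case True
        define W where "W = {m..<n} - Y"
        define P where "P x = (\<lambda>v. {x, v}) ` S" for x :: nat
        define N where "N x = (\<lambda>v. {x, v}) ` (({..<m} - S) \<union> Y)" for x :: nat
        have fin: "finite S" "finite Y" using True finite_subset by blast+
        have inj: "inj_on (\<lambda>v. {x, v}) A" for x :: nat and A
          by (rule inj_onI) (auto simp: doubleton_eq_iff)
        have cS: "card ({..<m} - S) = m - card S" using True fin by (simp add: card_Diff_subset)
        have "card W = card {m..<n} - card Y" unfolding W_def using True fin by (simp add: card_Diff_subset)
        then have cW: "real n - j' \<le> real (card W)" unfolding j'_def using True n by auto
        let ?D = "{E. real (card {x \<in> W. P x \<subseteq> E \<and> N x \<inter> E = {}}) \<le> (q S - \<delta>) * real (card W)}"
        have "gnp_prob n p ?D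
           \<le> exp (- 2 * \<delta>\<^sup>2 * real (card W))"
        proof (rule gnp_lower_tail[where P = P and N = N])
          fix x assume x: "x \<in> W"
          show "P x \<union> N x \<subseteq> all_edges {..<n}"
            using x True n unfolding P_def N_def W_def all_edges_def by (force simp: card_insert_if)
          have "S \<inter> Y = {}" using True by force
        then show "P x \<inter> N x = {}" using x unfolding P_def N_def W_def by (auto simp: doubleton_eq_iff)
          have "card (N x) = card (({..<m} - S) \<union> Y)" unfolding N_def by (rule card_image[OF inj])
          also have "\<dots> \<le> card ({..<m} - S) + card Y" by (rule card_Un_le)
          also have "\<dots> \<le> (m - card S) + J" using cS True by simp
          finally have "(1 - p) ^ ((m - card S) + J) \<le> (1 - p) ^ card (N x)" using p by (intro power_decreasing) auto
          moreover have "card (P x) = card S" unfolding P_def by (rule card_image[OF inj])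
          ultimately show "q S \<le> p ^ card (P x) * (1 - p) ^ card (N x)"
            unfolding q_def using p by (simp add: power_add mult.assoc)
        next
          show "disjoint_family_on (\<lambda>x. P x \<union> N x) W"
            unfolding disjoint_family_on_def
          proof (intro ballI impI, rule ccontr)
            fix x y assume xy: "x \<in> W" "y \<in> W" "x \<noteq> y" "(P x \<union> N x) \<inter> (P y \<union> N y) \<noteq> {}"
            have "P x \<union> N x = (\<lambda>v. {x, v}) ` ({..<m} \<union> Y)" for x unfolding P_def N_def using True by auto
            then obtain a b where "a \<in> {..<m} \<union> Y" "b \<in> {..<m} \<union> Y" "{x, a} = {y, b}" using xy(4) by auto
            then show False using xy(1-3) unfolding W_def by (auto simp: doubleton_eq_iff)
          qed
        qed (use p \<delta> in \<open>auto simp: W_def\<close>)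
        also have "exp (- 2 * \<delta>\<^sup>2 * real (card W)) \<le> exp (- 2 * \<delta>\<^sup>2 * (real n - j'))"
          using cW \<delta> by (simp add: mult_left_mono)
        finally have *: "gnp_prob n p ?D
            \<le> exp (- 2 * \<delta>\<^sup>2 * (real n - j'))" .
        have "A i \<subseteq> ?D"
        proof
          fix E assume "E \<in> A i"
          then have E: "card (atom m n E S - nbrs E Y) \<le> (q S - \<delta>) * (real n - j')" unfolding A_def i by auto
          have "S \<subseteq> {..<m}" using True by simp
          have "{x \<in> W. P x \<subseteq> E \<and> N x \<inter> E = {}} \<subseteq> atom m n E S - nbrs E Y"
          proof
            fix x assume "x \<in> {x \<in> W. P x \<subseteq> E \<and> N x \<inter> E = {}}"
            then have x: "x \<in> {m..<n}" and "\<And>v. v \<in> S \<Longrightarrow> {x, v} \<in> E" and N: "\<And>v. v \<in> ({..<m} - S) \<union> Y \<Longrightarrow> {x, v} \<notin> E"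
              unfolding W_def P_def N_def by blast+
            then have "{v \<in> {..<m}. {x, v} \<in> E} = S" using \<open>S \<subseteq> {..<m}\<close> by blast
            then show "x \<in> atom m n E S - nbrs E Y" using x N unfolding atom_def nbrs_def by blast
          qed
          then have "card {x \<in> W. P x \<subseteq> E \<and> N x \<inter> E = {}} \<le> card (atom m n E S - nbrs E Y)"
            by (intro card_mono) (auto simp: atom_def)
          also note E
          also have "(q S - \<delta>) * (real n - j') \<le> (q S - \<delta>) * real (card W)"
            using True cW by (intro mult_left_mono) (auto simp: zero_le_mult_iff)
          finally show "E \<in> ?D" by simp
        qed
        then have "gnp_prob n p (A i) \<le> gnp_prob n p
            ?D"
          by (intro measure_pmf.finite_measure_mono) auto
        then show ?thesis using * by linarith
      next
        case False
        show ?thesis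
        \<comment> \<open>Here either no graph satisfies the event, for instance because the
          threshold is negative, or the exponential bound is at least one.\<close>
        proof (cases "0 < real n - j'")
          case True
          with False have "A i = {}" unfolding A_def i by (auto simp: not_le intro: order.strict_trans2[OF _ of_nat_0_le_iff])
          then show ?thesis by simp
        next
          case False
          then have "0 \<le> - 2 * \<delta>\<^sup>2 * (real n - j')" by (simp add: mult_nonneg_nonpos)
          then have "1 \<le> exp (- 2 * \<delta>\<^sup>2 * (real n - j'))" by simp
          moreover have "gnp_prob n p (A i) \<le> 1" by simp
          ultimately show ?thesis by linarith
        qed
      qed
    qed
    have fI: "finite Ix" "card Ix \<le> 2 ^ m * (n + 1) ^ J"
      using card_bounded_subsets[of "{..<n}" J] unfolding Ix_def
      by (auto simp: card_cartesian_product card_Pow)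
    have "?X n \<subseteq> (\<Union>i\<in>Ix. A i)"
    proof safe
      fix E S Y assume *: "S \<subseteq> {..<m}" "Y \<subseteq> {m..<n}" "card Y \<le> J"
        "card (atom m n E S - nbrs E Y) \<le> (p ^ card S * (1 - p) ^ (m - card S) * (1 - p) ^ J - \<delta>) * (real n - m - J)"
      then have "E \<in> A (S, Y)" unfolding A_def q_def j'_def by (simp add: diff_diff_eq)
      moreover have "Y \<subseteq> {..<n}" using *(2) by auto
      then have "(S, Y) \<in> Ix" using * unfolding Ix_def by simp
      ultimately show "E \<in> (\<Union>i\<in>Ix. A i)" by blast
    qed
    then have "gnp_prob n p (?X n) \<le> gnp_prob n p (\<Union>i\<in>Ix. A i)"
      by (intro measure_pmf.finite_measure_mono) auto
    also have "\<dots> \<le> real (card Ix) * exp (- 2 * \<delta>\<^sup>2 * (real n - j'))"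
      by (rule prob_UN_le[OF fI(1) A])
    also have "real (card Ix) \<le> c * (real n + 1) ^ J"
    proof -
      have "real (card Ix) \<le> real (2 ^ m * (n + 1) ^ J)" using fI(2) by (rule of_nat_mono)
      then show ?thesis unfolding c_def by (simp add: add.commute)
    qed
    finally show ?case by (simp add: mult_right_mono)
  qed
qed auto

section \<open>Choice of the constants\<close>

text \<open>Too many vertices that see almost the whole palette would form a dense pair with the
  small palette classes avoiding them: each such vertex misses at most \<open>2 * \<mu>\<close>
  classes, far fewer than typical.\<close>

lemma few_near:
  assumes E: "E \<subseteq> all_edges {..<n}" and no_dense: "\<And>Z F. \<not> dense_pair n J \<kappa> q E Z F"
    and z: "\<kappa> * real n \<le> real z"
    and y: "\<kappa> * real n \<le> y" "4 * real \<mu> \<le> q * y" "y \<le> real P - 2 * real \<mu> - real n / (real J + 1) - real z - 1"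
    and q: "0 \<le> q"
  shows "card {v \<in> {..<n}. card (unseen E P f v) \<le> 2 * \<mu>} \<le> z"
proof (rule ccontr)
  note edge = all_edgesD[OF E]
  assume "\<not> card {v \<in> {..<n}. card (unseen E P f v) \<le> 2 * \<mu>} \<le> z"
  then have "Suc z \<le> card {v \<in> {..<n}. card (unseen E P f v) \<le> 2 * \<mu>}" by simp
  from obtain_subset_with_card_n[OF this]
  obtain Z where Z: "Z \<subseteq> {v \<in> {..<n}. card (unseen E P f v) \<le> 2 * \<mu>}" "card Z = Suc z" "finite Z" by blast
  define cl where "cl c = {w \<in> {..<n}. f w = Some c}" for c
  define G where "G = {c \<in> {1..P}. cl c \<noteq> {} \<and> card (cl c) \<le> J \<and> cl c \<inter> Z = {}}"
  define F where "F = cl ` G"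
  have fcl: "finite (cl c)" for c unfolding cl_def by simp
  have inj: "inj_on cl G"
  proof (rule inj_onI)
    fix c c' assume c: "c \<in> G" "cl c = cl c'"
    then obtain w where "w \<in> cl c" unfolding G_def by blast
    then have "f w = Some c" "f w = Some c'" using c(2) unfolding cl_def by blast+
    then show "c = c'" by simp
  qed
  have fG: "finite G" unfolding G_def by simp
  have cF: "card F = card G" unfolding F_def by (rule card_image[OF inj])
  obtain v0 where v0: "v0 \<in> Z" using Z(2) by fastforce
  define B1 where "B1 = {c \<in> {1..P}. cl c = {}}"
  define B2 where "B2 = {c \<in> {1..P}. J + 1 \<le> card (cl c)}"
  define B3 where "B3 = {c \<in> {1..P}. cl c \<inter> Z \<noteq> {}}"
  have "B1 \<subseteq> unseen E P f v0" unfolding B1_def unseen_def cl_def using edge by fastforce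
  then have "card B1 \<le> card (unseen E P f v0)" by (intro card_mono) auto
  then have b1: "card B1 \<le> 2 * \<mu>" using v0 Z(1) by fastforce
  have "card B2 * (J + 1) \<le> (\<Sum>c\<in>B2. card (cl c))"
    using sum_bounded_below[of B2 "J + 1" "\<lambda>c. card (cl c)"] unfolding B2_def by simp
  also have "\<dots> = card (\<Union>c\<in>B2. cl c)"
    using fcl by (intro card_UN_disjoint[symmetric]) (auto simp: B2_def cl_def)
  also have "\<dots> \<le> card {..<n}" by (intro card_mono) (auto simp: cl_def)
  finally have "real (card B2 * (J + 1)) \<le> real n" by (simp only: card_lessThan of_nat_mono)
  then have b2: "real (card B2) \<le> real n / (real J + 1)" by (simp add: field_simps)
  have "B3 \<subseteq> (\<lambda>w. the (f w)) ` Z" unfolding B3_def cl_def by force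
  then have "card B3 \<le> card Z" using Z(3) by (meson card_image_le card_mono finite_imageI le_trans)
  then have b3: "card B3 \<le> Suc z" using Z(2) by simp
  have "{1..P} \<subseteq> G \<union> (B1 \<union> (B2 \<union> B3))" unfolding G_def B1_def B2_def B3_def by auto
  then have "card {1..P} \<le> card (G \<union> (B1 \<union> (B2 \<union> B3)))" by (rule card_mono[rotated]) (simp add: G_def B1_def B2_def B3_def)
  also have "\<dots> \<le> card G + (card B1 + (card B2 + card B3))"
    by (meson card_Un_le add_mono le_trans order_refl)
  finally have "P \<le> card G + (card B1 + (card B2 + card B3))" by simp
  then have "real P \<le> real (card G) + (real (card B1) + (real (card B2) + real (card B3)))" by linarith
  then have yF: "y \<le> real (card F)" using b1 b2 b3 y(3) cF by linarith
  have "{(v, Y) \<in> Z \<times> F. v \<notin> nbrs E Y} = (SIGMA v:Z. {Y \<in> F. v \<notin> nbrs E Y})" by auto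
  then have "card {(v, Y) \<in> Z \<times> F. v \<notin> nbrs E Y} = (\<Sum>v\<in>Z. card {Y \<in> F. v \<notin> nbrs E Y})"
    using Z(3) fG unfolding F_def by simp
  also have "\<dots> \<le> (\<Sum>v\<in>Z. 2 * \<mu>)"
  proof (rule sum_mono)
    fix v assume v: "v \<in> Z"
    have "{Y \<in> F. v \<notin> nbrs E Y} \<subseteq> cl ` unseen E P f v"
    proof
      fix Y assume "Y \<in> {Y \<in> F. v \<notin> nbrs E Y}"
      then obtain c where c: "c \<in> G" "Y = cl c" "v \<notin> nbrs E (cl c)" unfolding F_def by auto
      have "f u \<noteq> Some c" if "{u, v} \<in> E" for u
      proof -
        have "{v, u} \<in> E" using that by (simp add: insert_commute)
        then show ?thesis using c(3) edge[OF that] unfolding nbrs_def cl_def by auto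
      qed
      then have "c \<in> unseen E P f v" using c(1) unfolding unseen_def G_def by auto
      then show "Y \<in> cl ` unseen E P f v" using c by auto
    qed
    then have "card {Y \<in> F. v \<notin> nbrs E Y} \<le> card (unseen E P f v)"
      by (meson card_image_le card_mono finite_imageI finite_unseen le_trans)
    then show "card {Y \<in> F. v \<notin> nbrs E Y} \<le> 2 * \<mu>" using v Z(1) by fastforce
  qed
  also have "\<dots> = 2 * \<mu> * card Z" by simp
  finally have "real (card {(v, Y) \<in> Z \<times> F. v \<notin> nbrs E Y}) \<le> real (2 * \<mu> * card Z)" by (rule of_nat_mono)
  also have "\<dots> = 2 * real \<mu> * real (card Z)" by simp
  also have "\<dots> \<le> (q / 2 * card F) * real (card Z)"
  proof (rule mult_right_mono)
    have "q * y \<le> q * card F" using yF q by (intro mult_left_mono) auto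
    then show "2 * real \<mu> \<le> q / 2 * card F" using y(2) by simp
  qed simp
  finally have cnt: "real (card {(v, Y) \<in> Z \<times> F. v \<notin> nbrs E Y}) \<le> q / 2 * (card Z * card F)" by (simp add: mult_ac)
  have "dense_pair n J \<kappa> q E Z F"
    unfolding dense_pair_def
  proof (intro conjI ballI)
    show "Z \<subseteq> {..<n}" using Z(1) by auto
    show "pairwise disjnt F" unfolding F_def pairwise_def disjnt_def cl_def by auto
    show "Z \<inter> \<Union>F = {}" unfolding F_def G_def by auto
    show "\<kappa> * n \<le> card Z" using z Z(2) by simp
    show "\<kappa> * n \<le> card F" using y(1) yF by simp
  qed (use cnt in \<open>auto simp: F_def G_def cl_def\<close>)
  then show False using no_dense by blast
qed

text \<open>In logarithms, \<open>x * ln (1 + l)\<close> exceeds \<open>- y * ln (1 - l)\<close> by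
  at most \<open>ln n + D * ln (1 + l)\<close>. Both rates equal \<open>l\<close> up to order
  \<open>l\<^sup>2\<close>, so \<open>x\<close> is at most \<open>d / 2\<close> plus errors of order
  \<open>ln n / l\<close>, \<open>D\<close> and \<open>l * d\<close>; the choice of \<open>l\<close>
  and the bounds on the data keep them below \<open>a * n / 8\<close>.\<close>

lemma balancing_bound:
  fixes a p l n L :: real and x y d D :: nat
  assumes a: "0 < a" "a \<le> 1" "0 < p" "p < 1" and l: "l = a / 64" and n: "1 \<le> n" "ln n \<le> l * (a * n / 16)"
    and D: "real D \<le> a * n / 512" and d: "real d \<le> (p + a / 64) * n"
    and xy: "x + y \<le> d" "(1 + l) ^ x * (1 - l) ^ y \<le> n * (1 + l) ^ D"
  shows "real x \<le> (p / 2 + a / 8) * n"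
proof (rule ccontr)
  assume "\<not> ?thesis"
  then have x: "(p / 2 + a / 8) * n \<le> real x" by simp
  have l01: "0 < l" "l \<le> 1 / 64" using a l by auto
  define A where "A = ln (1 + l)"
  define B where "B = - ln (1 - l)"
  have A: "l - l\<^sup>2 \<le> A" "A \<le> l"
    using ln_one_plus_pos_lower_bound[of l] ln_add_one_self_le_self[of l] l01 unfolding A_def by auto
  have A0: "0 \<le> A" unfolding A_def using l01 by simp
  have B: "l \<le> B" "B \<le> l + 2 * l\<^sup>2"
    using ln_one_minus_pos_lower_bound[of l] ln_le_minus_one[of "1 - l"] l01 unfolding B_def by auto
  have "ln ((1 + l) ^ x * (1 - l) ^ y) \<le> ln (n * (1 + l) ^ D)"
    using xy(2) l01 n by (intro ln_mono) auto
  then have "x * A - y * B \<le> ln n + D * A"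
    using l01 n unfolding A_def B_def by (simp add: ln_mult ln_realpow)
  moreover have "y * B \<le> (real d - real x) * B" using xy(1) B l01 by (intro mult_right_mono) auto
  ultimately have "x * (A + B) \<le> ln n + D * A + d * B" by (simp add: algebra_simps)
  also have "\<dots> \<le> l * (a * n / 16) + (a * n / 512) * l + ((p + a / 64) * n) * (l + 2 * l\<^sup>2)"
    using n A A0 B D d l01 a by (intro add_mono mult_mono) auto
  also have "\<dots> = l * n * (a / 16 + a / 512 + (p + a / 64) * (1 + 2 * l))"
    by (simp add: algebra_simps power2_eq_square)
  finally have "x * (A + B) \<le> l * n * (a / 16 + a / 512 + (p + a / 64) * (1 + 2 * l))" .
  moreover have "((p / 2 + a / 8) * n) * (2 * l - l\<^sup>2) \<le> x * (A + B)"
    using x A B l01 a n by (intro mult_mono) (auto simp: power2_eq_square mult_left_le)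
  ultimately have "((p / 2 + a / 8) * n) * (2 * l - l\<^sup>2) \<le> l * n * (a / 16 + a / 512 + (p + a / 64) * (1 + 2 * l))"
    by linarith
  moreover have "((p / 2 + a / 8) * n) * (2 * l - l\<^sup>2) = (l * n) * ((p / 2 + a / 8) * (2 - l))"
    by (simp add: field_simps power2_eq_square)
  ultimately have "(l * n) * ((p / 2 + a / 8) * (2 - l)) \<le> (l * n) * (a / 16 + a / 512 + (p + a / 64) * (1 + 2 * l))"
    by simp
  then have fin: "(p / 2 + a / 8) * (2 - l) \<le> a / 16 + a / 512 + (p + a / 64) * (1 + 2 * l)"
    using l01 n by (subst (asm) mult_le_cancel_left_pos) auto
  define X where "X = l * (p / 2 + a / 8)"
  define Y where "Y = l * (p + a / 64)"
  have "(p / 2 + a / 8) * (2 - l) = p + a / 4 - X" unfolding X_def by (simp add: field_simps)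
  moreover have "(p + a / 64) * (1 + 2 * l) = p + a / 64 + 2 * Y" unfolding Y_def by (simp add: field_simps)
  ultimately have "p + a / 4 - X \<le> a / 16 + a / 512 + (p + a / 64 + 2 * Y)" using fin by metis
  moreover have "X \<le> l * 1" unfolding X_def using l01 a by (intro mult_left_mono) auto
  moreover have "Y \<le> l * 2" unfolding Y_def using l01 a by (intro mult_left_mono) auto
  ultimately show False using a(1) l by linarith
qed

lemma nat_floor_bounds:
  fixes x :: real
  assumes "0 \<le> x"
  shows "x - 1 \<le> real (nat \<lfloor>x\<rfloor>)" "real (nat \<lfloor>x\<rfloor>) \<le> x"
  using assms by linarith+

definition alice_typical :: "real \<Rightarrow> nat \<Rightarrow> real \<Rightarrow> real \<Rightarrow> nat \<Rightarrow> nat set set \<Rightarrow> bool" where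
  "alice_typical p J \<kappa> \<delta> n E \<longleftrightarrow> (\<forall>Z F. \<not> dense_pair n J \<kappa> ((1 - p) ^ J) E Z F) \<and>
     (\<forall>v. real (card {u. {u, v} \<in> E}) \<le> (p + \<delta>) * real n)"

lemma alice_wins_random:
  fixes p \<epsilon> :: real
  assumes p: "0 < p" "p < 1" and eps: "0 < \<epsilon>" "\<epsilon> \<le> 1"
  obtains J \<kappa> \<delta> where "0 < \<kappa>" "0 < \<delta>"
    "\<forall>\<^sub>F n in sequentially. even n \<longrightarrow> (\<forall>E. E \<subseteq> all_edges {..<n} \<longrightarrow> alice_typical p J \<kappa> \<delta> n E \<longrightarrow>
       alice_wins {..<n} E (nat \<lfloor>(1 + \<epsilon>) * (p * real n / 2)\<rfloor>))"
proof -
  \<comment> \<open>The number of colours exceeds \<open>p * n / 2\<close> by about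
    \<open>a * n / 2\<close>. Palette and Bob's surplus take \<open>a * n / 8\<close> each;
    \<open>\<mu>\<close> and \<open>D\<close> are much smaller.\<close>
  define a where "a = \<epsilon> * p"
  have a: "0 < a" "a \<le> 1" unfolding a_def using p eps mult_mono[of \<epsilon> 1 p 1] by auto
  define \<eta> where "\<eta> = a / 8"
  \<comment> \<open>Classes larger than \<open>J\<close> then make up at most an eighth of the
    palette.\<close>
  define J where "J = nat \<lceil>8 / \<eta>\<rceil>"
  define q where "q = (1 - p) ^ J"
  \<comment> \<open>Solves \<open>4 * \<theta> = q * (\<eta> / 2)\<close>, so that the misses
    allowed to a vertex stay below the typical number for half of the palette.\<close>
  define \<theta> where "\<theta> = q * \<eta> / 8"
  \<comment> \<open>About \<open>3 / \<theta>\<close> checkpoints with \<open>\<kappa> * n\<close>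
    vertices each must fit into \<open>\<theta> * n / 8\<close>.\<close>
  define \<kappa> where "\<kappa> = \<theta>\<^sup>2 / 64"
  define l where "l = a / 64"
  have \<eta>: "0 < \<eta>" "\<eta> \<le> 1 / 8" unfolding \<eta>_def using a by auto
  have q: "0 < q" "q \<le> 1" unfolding q_def using p by (auto intro: power_le_one)
  have \<theta>: "0 < \<theta>" "\<theta> \<le> \<eta> / 8" unfolding \<theta>_def using \<eta> q mult_right_mono[of q 1 \<eta>] by auto
  have \<kappa>: "0 < \<kappa>" "\<kappa> \<le> \<eta> / 16" "\<kappa> \<le> \<theta> / 64"
  proof -
    have "\<theta> * \<theta> \<le> \<theta> * 1" using \<theta> \<eta> by (intro mult_left_mono) auto
    then have "\<kappa> \<le> \<theta> / 64" unfolding \<kappa>_def by (simp add: power2_eq_square)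
    moreover have "0 < \<kappa>" unfolding \<kappa>_def using \<theta> by simp
    ultimately show "0 < \<kappa>" "\<kappa> \<le> \<eta> / 16" "\<kappa> \<le> \<theta> / 64" using \<theta>(2) \<eta>(1) by linarith+
  qed
  have J: "real n / (real J + 1) \<le> \<eta> * n / 8" for n :: nat
  proof -
    have "8 / \<eta> \<le> real J + 1" unfolding J_def by linarith
    then have "real n / (real J + 1) \<le> real n / (8 / \<eta>)" using \<eta> by (intro divide_left_mono) auto
    then show ?thesis by (simp add: mult_ac)
  qed
  have l0: "0 < l" using a unfolding l_def by simp
  have ev1: "\<forall>\<^sub>F n :: nat in sequentially. ln (real n) \<le> l * (a * real n / 16)"
    using l0 a(1) by real_asymp
  have ev2: "\<forall>\<^sub>F n :: nat in sequentially. 100 \<le> \<kappa> * real n \<and> 3 / \<theta> + 3 \<le> \<theta> * real n / 64"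
    using \<kappa>(1) \<theta>(1) by (intro eventually_conj) real_asymp+
  have "\<forall>\<^sub>F n in sequentially. even n \<longrightarrow> (\<forall>E. E \<subseteq> all_edges {..<n} \<longrightarrow> alice_typical p J \<kappa> (a / 64) n E \<longrightarrow>
       alice_wins {..<n} E (nat \<lfloor>(1 + \<epsilon>) * (p * real n / 2)\<rfloor>))"
    using ev1 ev2
  proof eventually_elim
    case (elim n)
    have big: "100 \<le> \<kappa> * n" "3 / \<theta> + 3 \<le> \<theta> * n / 64" using elim(2) by auto
    have kn: "100 \<le> \<theta> * n / 64" using big \<kappa>(3) mult_right_mono[of \<kappa> "\<theta> / 64" "real n"] by simp
    have tn: "\<theta> * n \<le> \<eta> * n / 8" using \<theta>(2) mult_right_mono[of \<theta> "\<eta> / 8" "real n"] by simp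
    have k16: "\<kappa> * n \<le> \<eta> * n / 16" using \<kappa>(2) mult_right_mono[of \<kappa> "\<eta> / 16" "real n"] by simp
    have n1: "1 \<le> real n" using big \<kappa> by (cases n) auto
    define P where "P = nat \<lfloor>\<eta> * n\<rfloor>"
    define \<mu> where "\<mu> = nat \<lfloor>\<theta> * n\<rfloor>"
    define z where "z = nat \<lceil>\<kappa> * n\<rceil>"
    define D where "D = nat \<lfloor>\<theta> * n / 8\<rfloor>"
    define d where "d = nat \<lfloor>(p + a / 64) * n\<rfloor>"
    define b where "b = nat \<lfloor>(p / 2 + a / 8) * n\<rfloor>"
    define k where "k = nat \<lfloor>(1 + \<epsilon>) * (p * real n / 2)\<rfloor>"
    have P: "\<eta> * n - 1 \<le> P" "P \<le> \<eta> * n" unfolding P_def using \<eta> by (intro nat_floor_bounds, simp)+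
    have mu: "\<theta> * n - 1 \<le> \<mu>" "\<mu> \<le> \<theta> * n" unfolding \<mu>_def using \<theta> by (intro nat_floor_bounds, simp)+
    have z: "\<kappa> * n \<le> z" "z \<le> \<kappa> * n + 1" unfolding z_def using big(1) by linarith+
    have D: "\<theta> * n / 8 - 1 \<le> D" "D \<le> \<theta> * n / 8" unfolding D_def using \<theta> by (intro nat_floor_bounds, simp)+
    have d: "d \<le> (p + a / 64) * n" unfolding d_def using p a by (intro nat_floor_bounds) simp
    have b: "b \<le> (p / 2 + a / 8) * n" unfolding b_def using p a by (intro nat_floor_bounds) simp
    have k: "p * n / 2 + a * n / 2 - 1 \<le> k"
    proof -
      have "(1 + \<epsilon>) * (p * real n / 2) - 1 \<le> k" unfolding k_def by linarith
      then show ?thesis unfolding a_def by (simp add: algebra_simps)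
    qed
    show ?case
    proof (intro impI allI)
      fix E assume ev: "even n" and E: "E \<subseteq> all_edges {..<n}"
        and typical: "alice_typical p J \<kappa> (a / 64) n E"
      then have nd: "\<not> dense_pair n J \<kappa> q E Z F" and deg: "card {u. {u, v} \<in> E} \<le> (p + a / 64) * n" for Z F v
        unfolding alice_typical_def q_def by blast+
      interpret balancing E n k P \<mu> D b z d l
      proof
        show "even n" "0 < n" using ev n1 by auto
        show "E \<subseteq> all_edges {..<n}" by fact
        show "0 < l" "l < 1" using a unfolding l_def by auto
        show "card {v \<in> {..<n}. card (unseen E P f v) \<le> 2 * \<mu>} \<le> z" for f
        proof (rule few_near[OF E, of J \<kappa> q _ "\<eta> * n / 2"])
          show "\<not> dense_pair n J \<kappa> q E Z F" for Z F by (rule nd)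
          show "\<kappa> * n \<le> z" "0 \<le> q" using z q by auto
          show "\<kappa> * n \<le> \<eta> * n / 2"
          proof -
            have "0 \<le> \<eta> * n" using \<eta> by simp
            then show ?thesis using k16 by linarith
          qed
          show "4 * real \<mu> \<le> q * (\<eta> * n / 2)" using mu(2) unfolding \<theta>_def by simp
          show "\<eta> * n / 2 \<le> real P - 2 * real \<mu> - real n / (real J + 1) - real z - 1"
            using P(1) mu(2) z(2) J[of n] k16 tn big by linarith
        qed
        show "(n div \<mu> + 1) * z \<le> D"
        proof -
          have m2: "\<theta> * n / 2 \<le> \<mu>" using mu(1) kn by linarith
          have tpos: "0 < \<theta> * n" using \<theta> n1 by simp
          have "real (n div \<mu>) \<le> real n / real \<mu>" by (rule of_nat_div_le_of_nat)
          also have "\<dots> \<le> real n / (\<theta> * n / 2)" using m2 tpos by (intro divide_left_mono mult_pos_pos) auto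
          also have "\<dots> = 2 / \<theta>" using n1 \<theta> by (simp add: field_simps)
          finally have "real (n div \<mu>) + 1 \<le> 3 / \<theta>" using \<theta> \<eta> by (simp add: field_simps)
          then have "(real (n div \<mu>) + 1) * real z \<le> 3 / \<theta> * (\<kappa> * n + 1)"
            using z \<theta> by (intro mult_mono) auto
          also have "\<dots> = 3 * (\<theta> * n / 64) + 3 / \<theta>" using \<theta> unfolding \<kappa>_def by (simp add: field_simps power2_eq_square)
          also have "\<dots> \<le> D" using big D(1) kn by linarith
          finally have "real ((n div \<mu> + 1) * z) \<le> real D" by (simp add: algebra_simps)
          then show ?thesis by (simp only: of_nat_le_iff)
        qed
        have "2 * real D + 5 \<le> real \<mu>" using D(2) mu(1) kn by linarith
        then show "2 * D + 5 \<le> \<mu>" by linarith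
        show "card {u. {u, v} \<in> E} \<le> d" for v
          unfolding d_def using deg by (simp add: le_nat_floor)
        show "x \<le> b" if "x + y \<le> d" "(1 + l) ^ x * (1 - l) ^ y \<le> real n * (1 + l) ^ D" for x y
        proof -
          have "\<theta> * n \<le> (a / 64) * n" using \<theta>(2) unfolding \<eta>_def by (intro mult_right_mono) auto
          then have D': "real D \<le> a * n / 512" using D(2) by simp
          have "real x \<le> (p / 2 + a / 8) * n"
            by (rule balancing_bound[OF a p l_def n1 elim(1) D' d that])
          then show ?thesis unfolding b_def by (simp add: le_nat_floor)
        qed
        show "P + D + b + \<mu> \<le> k"
        proof -
          have "real P + real D + real b + real \<mu> \<le> real k"
          proof -
            have "real b \<le> p * n / 2 + a * n / 8" using b by (simp add: algebra_simps)
            moreover have "\<eta> * n = a * n / 8" unfolding \<eta>_def by simp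
            ultimately show ?thesis using P(2) D(2) mu(2) k tn kn by linarith
          qed
          then show ?thesis by linarith
        qed
      qed
      show "alice_wins {..<n} E (nat \<lfloor>(1 + \<epsilon>) * (p * real n / 2)\<rfloor>)"
        using alice_wins unfolding k_def .
    qed
  qed
  then show thesis using a(1) by (intro that[OF \<kappa>(1), of "a / 64" J]) auto
qed

text \<open>Already \<open>K + 1\<close> almost blocking sets give a dense pair: removing their at
  most \<open>J * (K + 1)\<close> vertices leaves most of \<open>U\<close>, and each set misses
  fewer than \<open>\<rho>\<close> of the rest.\<close>

lemma few_bad_sets:
  assumes no_dense: "\<And>Z F. \<not> dense_pair n J \<kappa> q E Z F"
    and U: "U \<subseteq> {..<n}" "\<beta> \<le> card U" and F: "pairwise disjnt F"
      "\<And>Y. Y \<in> F \<Longrightarrow> Y \<subseteq> {..<n} \<and> card Y \<le> J \<and> card (U - nbrs E Y) < \<rho>"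
    and K: "\<kappa> * real n \<le> real K + 1" and y: "\<kappa> * real n \<le> y" "real J * (real K + 1) + y \<le> real \<beta>"
      "real \<rho> \<le> q / 2 * y" and q: "0 \<le> q"
  shows "card F \<le> K"
proof (rule ccontr)
  assume "\<not> card F \<le> K"
  then have "Suc K \<le> card F" by simp
  from obtain_subset_with_card_n[OF this]
  obtain F' where F': "F' \<subseteq> F" "card F' = Suc K" "finite F'" by blast
  define Z where "Z = U - \<Union>F'"
  have fU: "finite U" using U(1) finite_subset by blast
  have "card (\<Union>F') \<le> (\<Sum>Y\<in>F'. card Y)" by (rule card_Union_le_sum_card)
  also have "\<dots> \<le> card F' * J" using sum_bounded_above[of F' card J] F(2) F'(1) by auto
  finally have cU: "card (\<Union>F') \<le> Suc K * J" using F'(2) by simp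
  have "\<Union>F' \<subseteq> {..<n}" using F(2) F'(1) by blast
  then have "finite (\<Union>F')" using finite_subset by blast
  then have "card U - card (\<Union>F') \<le> card Z" unfolding Z_def by (rule diff_card_le_card_Diff)
  then have "\<beta> \<le> card Z + Suc K * J" using U(2) cU by linarith
  then have "real \<beta> \<le> real (card Z + Suc K * J)" by (rule of_nat_mono)
  then have yZ: "y \<le> real (card Z)" using y(2) by (simp add: algebra_simps)
  have fZ: "finite Z" unfolding Z_def using fU by simp
  have "{(v, Y) \<in> Z \<times> F'. v \<notin> nbrs E Y} = prod.swap ` (SIGMA Y:F'. {v \<in> Z. v \<notin> nbrs E Y})" by force
  then have "card {(v, Y) \<in> Z \<times> F'. v \<notin> nbrs E Y} = card (SIGMA Y:F'. {v \<in> Z. v \<notin> nbrs E Y})"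
    by (simp add: card_image)
  also have "\<dots> = (\<Sum>Y\<in>F'. card {v \<in> Z. v \<notin> nbrs E Y})" using F'(3) fZ by simp
  also have "\<dots> \<le> (\<Sum>Y\<in>F'. \<rho>)"
  proof (rule sum_mono)
    fix Y assume "Y \<in> F'"
    then have "card (U - nbrs E Y) < \<rho>" using F(2) F'(1) by blast
    moreover have "card {v \<in> Z. v \<notin> nbrs E Y} \<le> card (U - nbrs E Y)"
      using fU by (intro card_mono) (auto simp: Z_def)
    ultimately show "card {v \<in> Z. v \<notin> nbrs E Y} \<le> \<rho>" by simp
  qed
  also have "\<dots> = \<rho> * card F'" by simp
  finally have "real (card {(v, Y) \<in> Z \<times> F'. v \<notin> nbrs E Y}) \<le> real (\<rho> * card F')" by (rule of_nat_mono)
  also have "\<dots> = real \<rho> * real (card F')" by simp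
  also have "\<dots> \<le> (q / 2 * card Z) * real (card F')"
  proof (rule mult_right_mono)
    have "q / 2 * y \<le> q / 2 * card Z" using yZ q by (intro mult_left_mono) auto
    then show "real \<rho> \<le> q / 2 * card Z" using y(3) by linarith
  qed simp
  finally have cnt: "real (card {(v, Y) \<in> Z \<times> F'. v \<notin> nbrs E Y}) \<le> q / 2 * (card Z * card F')" by (simp add: mult_ac)
  have "dense_pair n J \<kappa> q E Z F'"
    unfolding dense_pair_def
  proof (intro conjI)
    show "Z \<subseteq> {..<n}" using U(1) unfolding Z_def by auto
    show "\<forall>Y\<in>F'. Y \<subseteq> {..<n} \<and> card Y \<le> J" using F(2) F'(1) by blast
    show "pairwise disjnt F'" using F(1) F'(1) by (rule pairwise_subset)
    show "Z \<inter> \<Union>F' = {}" unfolding Z_def by auto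
    show "\<kappa> * n \<le> card Z" using y(1) yZ by simp
    show "\<kappa> * n \<le> card F'" using K F'(2) by simp
  qed (rule cnt)
  then show False using no_dense by blast
qed

lemma card_residue_le:
  assumes "0 < L"
  shows "card {c \<in> {1..k}. c mod L = i} \<le> k div L + 1"
proof -
  have "inj_on (\<lambda>c. c div L) {c \<in> {1..k}. c mod L = i}"
    by (rule inj_onI) (metis (mono_tags, lifting) div_mult_mod_eq mem_Collect_eq)
  moreover have "(\<lambda>c. c div L) ` {c \<in> {1..k}. c mod L = i} \<subseteq> {..k div L}" by (auto intro: div_le_mono)
  ultimately have "card {c \<in> {1..k}. c mod L = i} \<le> card {..k div L}" by (meson card_inj_on_le finite_atMost)
  then show ?thesis by simp
qed

text \<open>
  The bound below is, up to lower order terms, \<open>k l\<close> times the expected density of the atom of \<open>S\<close>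
  in \<open>G\<^bsub>n,1/l\<^esub>\<close>: a fibre of a random map to \<open>{..<l}\<close> is distributed like a random neighbourhood.
\<close>

lemma ex_blocks:
  fixes l m :: nat
  assumes l: "2 \<le> l" and m: "2 \<le> m"
  obtains blk :: "nat \<Rightarrow> nat set set" where
    "\<And>c. blk c \<subseteq> proper_parts m" "\<And>c. card (blk c) \<le> m" "\<And>c. \<Union>(blk c) = {..<m}"
    "\<And>S k. S \<subseteq> {..<m} \<Longrightarrow> S \<noteq> {} \<Longrightarrow>
       real (card {c \<in> {1..k}. S \<in> blk c}) \<le> (real k / (real l ^ m - real l) + 1) * (real l * real (l - 1) ^ (m - card S))"
proof -
  define T where "T = {..<m}"
  define NC where "NC = (T \<rightarrow>\<^sub>E {..<l}) - (\<lambda>j. \<lambda>v\<in>T. j) ` {..<l}"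
  define L where "L = card NC"
  define bl where "bl f = (\<lambda>i. {v \<in> T. f v = f i}) ` T" for f :: "nat \<Rightarrow> nat"
  have fT: "finite T" "card T = m" unfolding T_def by auto
  have fP: "finite (T \<rightarrow>\<^sub>E {..<l})" using fT by (intro finite_PiE) auto
  then have fNC: "finite NC" unfolding NC_def by simp
  have "l ^ m = card (T \<rightarrow>\<^sub>E {..<l})" using fT by (simp add: card_PiE)
  moreover have "card (T \<rightarrow>\<^sub>E {..<l}) - card ((\<lambda>j. \<lambda>v\<in>T. j) ` {..<l}) \<le> L"
    unfolding L_def NC_def by (rule diff_card_le_card_Diff) simp
  moreover have "card ((\<lambda>j. \<lambda>v\<in>T. j) ` {..<l}) \<le> l" using card_image_le[of "{..<l}"] by force
  ultimately have Lm: "l ^ m \<le> L + l" by linarith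
  have lm: "l < l ^ m" using l m power_strict_increasing[of 1 m l] by simp
  then have L0: "0 < L" using Lm by linarith
  have "real (l ^ m) \<le> real (L + l)" using Lm by (rule of_nat_mono)
  then have Lr: "real l ^ m - real l \<le> real L" by simp
  have lr: "0 < real l ^ m - real l" using lm of_nat_less_iff[of l "l ^ m", where 'a = real] by simp
  obtain g where g: "bij_betw g {..<L} NC"
    using ex_bij_betw_nat_finite[OF fNC] unfolding L_def atLeast0LessThan by blast
  \<comment> \<open>Colours run cyclically through the non-constant maps, so that all maps are used
    almost equally often.\<close>
  define blk where "blk c = bl (g (c mod L))" for c
  have gN: "g (c mod L) \<in> NC" for c using g L0 bij_betwE by fastforce
  have nonconst: "{v \<in> T. f v = f i} \<noteq> T" if "f \<in> NC" "i \<in> T" for f i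
  proof
    assume eq: "{v \<in> T. f v = f i} = T"
    have fE: "f \<in> T \<rightarrow>\<^sub>E {..<l}" using that unfolding NC_def by auto
    have "f = (\<lambda>v\<in>T. f i)"
    proof
      fix v show "f v = (\<lambda>v\<in>T. f i) v" using eq PiE_arb[OF fE, of v] by (cases "v \<in> T") auto
    qed
    moreover have "f i \<in> {..<l}" using fE that by auto
    ultimately show False using that(1) unfolding NC_def by blast
  qed
  show thesis
  proof
    show "blk c \<subseteq> proper_parts m" for c
      using nonconst[OF gN] unfolding blk_def bl_def T_def[symmetric] by auto
    show "card (blk c) \<le> m" for c unfolding blk_def bl_def using card_image_le[OF fT(1)] fT(2) by metis
    show "\<Union>(blk c) = {..<m}" for c unfolding blk_def bl_def T_def[symmetric] by auto
  next
    fix S k assume S: "S \<subseteq> {..<m}" "S \<noteq> {}"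
    then have fS: "finite S" "S \<subseteq> T" using finite_subset unfolding T_def by auto
    define FS where "FS = {f \<in> NC. S \<in> bl f}"
    \<comment> \<open>A map with fibre \<open>S\<close> is determined by its value on
      \<open>S\<close> and by different values elsewhere.\<close>
    have "FS \<subseteq> (\<Union>j\<in>{..<l}. Pi\<^sub>E T (\<lambda>v. if v \<in> S then {j} else {..<l} - {j}))"
    proof
      fix f assume f: "f \<in> FS"
      then obtain i where i: "i \<in> T" "S = {v \<in> T. f v = f i}" unfolding FS_def bl_def by auto
      have fE: "f \<in> T \<rightarrow>\<^sub>E {..<l}" using f unfolding FS_def NC_def by auto
      then have "f \<in> Pi\<^sub>E T (\<lambda>v. if v \<in> S then {f i} else {..<l} - {f i})" using i(2) by (auto simp: PiE_iff)
      then show "f \<in> (\<Union>j\<in>{..<l}. Pi\<^sub>E T (\<lambda>v. if v \<in> S then {j} else {..<l} - {j}))" using fE i(1) by blast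
    qed
    then have "card FS \<le> card (\<Union>j\<in>{..<l}. Pi\<^sub>E T (\<lambda>v. if v \<in> S then {j} else {..<l} - {j}))"
      using fT by (intro card_mono finite_UN_I finite_PiE) auto
    also have "\<dots> \<le> (\<Sum>j\<in>{..<l}. card (Pi\<^sub>E T (\<lambda>v. if v \<in> S then {j} else {..<l} - {j})))"
      by (rule card_UN_le) simp
    also have "\<dots> = (\<Sum>j\<in>{..<l}. (l - 1) ^ (m - card S))"
    proof (rule sum.cong)
      fix j assume j: "j \<in> {..<l}"
      have "card (Pi\<^sub>E T (\<lambda>v. if v \<in> S then {j} else {..<l} - {j})) = (\<Prod>v\<in>T. if v \<in> S then 1 else l - 1)"
        using fT j by (subst card_PiE) (auto intro!: prod.cong)
      also have "\<dots> = (l - 1) ^ card (T - S)" using fT by (simp add: prod.If_cases Diff_eq)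
      also have "card (T - S) = m - card S" using fS fT by (simp add: card_Diff_subset)
      finally show "card (Pi\<^sub>E T (\<lambda>v. if v \<in> S then {j} else {..<l} - {j})) = (l - 1) ^ (m - card S)" .
    qed simp
    finally have cFS: "card FS \<le> l * (l - 1) ^ (m - card S)" by simp
    have fFS: "finite FS" unfolding FS_def using fNC by simp
    define I where "I = {i \<in> {..<L}. g i \<in> FS}"
    have "inj_on g I" "g ` I \<subseteq> FS" using g unfolding I_def bij_betw_def inj_on_def by auto
    then have cI: "card I \<le> card FS" using fFS by (rule card_inj_on_le)
    have "{c \<in> {1..k}. S \<in> blk c} \<subseteq> (\<Union>i\<in>I. {c \<in> {1..k}. c mod L = i})"
      unfolding I_def FS_def blk_def using gN L0 by auto
    then have "card {c \<in> {1..k}. S \<in> blk c} \<le> card (\<Union>i\<in>I. {c \<in> {1..k}. c mod L = i})"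
      by (intro card_mono) (auto simp: I_def)
    also have "\<dots> \<le> (\<Sum>i\<in>I. card {c \<in> {1..k}. c mod L = i})" by (rule card_UN_le) (simp add: I_def)
    also have "\<dots> \<le> card I * (k div L + 1)"
      using sum_bounded_above[of I "\<lambda>i. card {c \<in> {1..k}. c mod L = i}" "k div L + 1"] card_residue_le[OF L0] by simp
    also have "\<dots> \<le> (l * (l - 1) ^ (m - card S)) * (k div L + 1)" using cI cFS by (intro mult_right_mono) auto
    finally have "real (card {c \<in> {1..k}. S \<in> blk c}) \<le> real ((l * (l - 1) ^ (m - card S)) * (k div L + 1))" by (rule of_nat_mono)
    also have "\<dots> = (real (k div L) + 1) * (real l * real (l - 1) ^ (m - card S))" by (simp add: algebra_simps)
    also have "\<dots> \<le> (real k / (real l ^ m - real l) + 1) * (real l * real (l - 1) ^ (m - card S))"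
    proof (rule mult_right_mono)
      have "real (k div L) \<le> real k / real L" by (rule of_nat_div_le_of_nat)
      also have "\<dots> \<le> real k / (real l ^ m - real l)" using Lr lr L0 by (intro divide_left_mono mult_pos_pos) auto
      finally show "real (k div L) + 1 \<le> real k / (real l ^ m - real l) + 1" by simp
    qed simp
    finally show "real (card {c \<in> {1..k}. S \<in> blk c}) \<le> (real k / (real l ^ m - real l) + 1) * (real l * real (l - 1) ^ (m - card S))" .
  qed
qed

lemma region_slack:
  fixes c x y z G M A c0 B :: real
  assumes "2 * c \<le> x - y + 2 * z" "x - G / 2 - M \<le> A" "2 * G \<le> y" "5 * M + 2 * z \<le> c0" "2 * c0 \<le> G" "B \<le> G"
  shows "2 * (c + M) + B + 2 * M \<le> A"
  using assms by argo

definition bob_typical :: "real \<Rightarrow> nat \<Rightarrow> nat \<Rightarrow> real \<Rightarrow> real \<Rightarrow> real \<Rightarrow> nat \<Rightarrow> nat set set \<Rightarrow> bool" where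
  "bob_typical p m J \<kappa> \<delta> \<delta>' n E \<longleftrightarrow> (\<forall>Z F. \<not> dense_pair n J \<kappa> ((1 - p) ^ J) E Z F) \<and>
     (\<forall>S Y. S \<subseteq> {..<m} \<longrightarrow> Y \<subseteq> {m..<n} \<longrightarrow> card Y \<le> J \<longrightarrow>
        (p ^ card S * (1 - p) ^ (m - card S) * (1 - p) ^ J - \<delta>) * (real n - m - J) < card (atom m n E S - nbrs E Y)) \<and>
     (\<forall>S. S \<subseteq> {..<m} \<longrightarrow> (p ^ card S * (1 - p) ^ (m - card S) - \<delta>') * (real n - m) < card (atom m n E S))"

lemma bob_wins_random:
  fixes l :: nat and p \<epsilon> :: real
  assumes l: "2 \<le> l" and p: "p = 1 / real l" and eps: "0 < \<epsilon>" "\<epsilon> \<le> p / 4"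
  obtains m J \<kappa> \<delta> \<delta>' where "0 < \<kappa>" "0 < \<delta>" "0 < \<delta>'"
    "\<forall>\<^sub>F n in sequentially. even n \<longrightarrow> (\<forall>E. E \<subseteq> all_edges {..<n} \<longrightarrow> bob_typical p m J \<kappa> \<delta> \<delta>' n E \<longrightarrow>
       (\<forall>k. real k \<le> (p / 2 - \<epsilon>) * n \<longrightarrow> \<not> alice_wins {..<n} E k))"
proof -
  have l': "2 \<le> real l" using l by simp
  have p01: "0 < p" "p \<le> 1 / 2" unfolding p using l' by (auto simp: field_simps)
  \<comment> \<open>The slack relative to \<open>n / l\<close>: the number of colours is at most
    \<open>(1 / 2 - e) * n / l\<close>.\<close>
  define e where "e = \<epsilon> * l"
  have e: "0 < e" "e \<le> 1 / 4"
  proof -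
    show "0 < e" unfolding e_def using eps l by simp
    have "\<epsilon> * l \<le> p / 4 * l" using eps by (intro mult_right_mono) auto
    also have "\<dots> = 1 / 4" unfolding p using l by simp
    finally show "e \<le> 1 / 4" unfolding e_def .
  qed
  \<comment> \<open>Leaving out the \<open>l\<close> constant maps then costs at most a fraction
    \<open>e\<close> of all maps.\<close>
  obtain m where m: "2 \<le> m" "real l / e \<le> real l ^ m"
  proof -
    obtain m0 where "real l / e < real l ^ m0" using real_arch_pow[of "real l" "real l / e"] l' by auto
    moreover have "real l ^ m0 \<le> real l ^ (m0 + 2)" using l' by (intro power_increasing) auto
    ultimately show ?thesis using that[of "m0 + 2"] by simp
  qed
  define \<pi> where "\<pi> = p ^ m"
  define w where "w S = p ^ card S * (1 - p) ^ (m - card S)" for S :: "nat set"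
  have \<pi>: "0 < \<pi>" "\<pi> \<le> 1" unfolding \<pi>_def using p01 by (auto intro: power_le_one)
  have w\<pi>: "\<pi> \<le> w S" if "S \<subseteq> {..<m}" for S
  proof -
    have "card S \<le> m" using that card_mono[of "{..<m}" S] by simp
    then have "\<pi> = p ^ card S * p ^ (m - card S)" unfolding \<pi>_def by (simp flip: power_add)
    also have "\<dots> \<le> w S" unfolding w_def using p01 by (intro mult_left_mono power_mono) auto
    finally show ?thesis .
  qed
  \<comment> \<open>An atom of density \<open>w S \<ge> \<pi>\<close> has about
    \<open>e * w S * n \<ge> 2 * g * n\<close> vertices beyond twice its tasks; \<open>g * n\<close>
    of them form the reserve \<open>B\<close>.\<close>
  define g where "g = e * \<pi> / 2"
  have "e * \<pi> \<le> 1 / 4 * 1" using e \<pi> by (intro mult_mono) auto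
  moreover have "0 < e * \<pi>" using e \<pi> by simp
  ultimately have g: "0 < g" "g \<le> 1 / 8" unfolding g_def by linarith+
  \<comment> \<open>At most \<open>g * n / (16 * m)\<close> classes are so large, and
    \<open>m\<close> replies for each of them fit into \<open>r0\<close>.\<close>
  define C where "C = 4 * m + nat \<lceil>16 * m / g\<rceil>"
  define J where "J = C + 3"
  define q where "q = (1 - p) ^ J"
  have q: "0 < q" "q \<le> 1" unfolding q_def using p01 by (auto intro: power_le_one)
  define \<rho>' where "\<rho>' = q * g * \<pi> / 64"
  have qg: "0 < q * g" "q * g \<le> g" "q * g * \<pi> \<le> q * g" using q g \<pi> by (auto simp: mult_left_le_one_le mult_left_le)
  have qp: "q * g * \<pi> \<le> q * \<pi>" using q g \<pi> mult_mono[of g 1 "q * \<pi>" "q * \<pi>"] by (simp add: mult_ac)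
  have "0 < q * g * \<pi>" using q g \<pi> by simp
  then have \<rho>': "0 < \<rho>'" "\<rho>' \<le> g / 64" "\<rho>' \<le> q * g / 64" "\<rho>' \<le> q * \<pi> / 64"
    unfolding \<rho>'_def using qg qp by linarith+
  define M where "M = real ((m + 1) * 2 ^ m * J * (m + 1))"
  have M: "1 \<le> M" "real J \<le> M"
  proof -
    have "0 < (m + 1) * 2 ^ m * (m + 1)" by simp
    then have "J * 1 \<le> J * ((m + 1) * 2 ^ m * (m + 1))" by (intro mult_left_mono) linarith+
    then have "J \<le> (m + 1) * 2 ^ m * J * (m + 1)" by (simp only: mult_ac mult_1_right)
    then show "real J \<le> M" unfolding M_def by (rule of_nat_mono)
    then show "1 \<le> M" unfolding J_def by simp
  qed
  \<comment> \<open>\<open>M\<close> collects the factors by which the family size enters the bound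
    \<open>Q\<close>, and \<open>\<rho>' * n / 8\<close> fits into \<open>Q\<close>.\<close>
  define \<kappa> where "\<kappa> = \<rho>' / (8 * M)"
  have \<kappa>: "0 < \<kappa>" "M * \<kappa> = \<rho>' / 8" unfolding \<kappa>_def using \<rho>' M by auto
  define \<delta> where "\<delta> = \<pi> * q / 2"
  define \<delta>' where "\<delta>' = e * \<pi> / 4"
  define c0 where "c0 = 5 * real m + 2 * real l ^ (m + 1) + real J"
  have ev: "\<forall>\<^sub>F n :: nat in sequentially. 100 + 100 * c0 \<le> \<rho>' * real n \<and> 1 \<le> real n"
    using \<rho>'(1) by (intro eventually_conj) real_asymp+
  have "\<forall>\<^sub>F n in sequentially. even n \<longrightarrow> (\<forall>E. E \<subseteq> all_edges {..<n} \<longrightarrow> bob_typical p m J \<kappa> \<delta> \<delta>' n E \<longrightarrow>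
       (\<forall>k. real k \<le> (p / 2 - \<epsilon>) * n \<longrightarrow> \<not> alice_wins {..<n} E k))"
    using ev
  proof eventually_elim
    case (elim n)
    have c0: "0 \<le> c0" "5 * real m \<le> c0" "real J \<le> c0" "5 * real m + 2 * real l ^ (m + 1) \<le> c0" unfolding c0_def by auto
    have rn: "100 + 100 * c0 \<le> \<rho>' * n" "1 \<le> real n" using elim by auto
    have sc: "\<rho>' * n \<le> g * n / 64" "\<rho>' * n \<le> q * g * n / 64" "\<rho>' * n \<le> q * \<pi> * n / 64"
      using \<rho>'(2-4) mult_right_mono[OF \<rho>'(2), of "real n"] mult_right_mono[OF \<rho>'(3), of "real n"] mult_right_mono[OF \<rho>'(4), of "real n"] by auto
    have gn: "g * n \<le> n / 8" using mult_right_mono[OF g(2), of "real n"] by simp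
    define B where "B = nat \<lfloor>g * n\<rfloor>"
    define \<beta> where "\<beta> = nat \<lfloor>g * n / 4\<rfloor>"
    define r0 where "r0 = nat \<lfloor>g * n / 8\<rfloor>"
    define Q where "Q = nat \<lfloor>\<rho>' * n / 4\<rfloor>"
    define \<rho> where "\<rho> = nat \<lfloor>\<rho>' * n\<rfloor>"
    define K where "K = nat \<lfloor>\<kappa> * n\<rfloor>"
    have B: "g * n - 1 \<le> B" "B \<le> g * n" unfolding B_def using g by (intro nat_floor_bounds, simp)+
    have \<beta>: "g * n / 4 - 1 \<le> \<beta>" "\<beta> \<le> g * n / 4" unfolding \<beta>_def using g by (intro nat_floor_bounds, simp)+
    have r0: "g * n / 8 - 1 \<le> r0" "r0 \<le> g * n / 8" unfolding r0_def using g by (intro nat_floor_bounds, simp)+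
    have Q: "\<rho>' * n / 4 - 1 \<le> Q" "Q \<le> \<rho>' * n / 4" unfolding Q_def using \<rho>' by (intro nat_floor_bounds, simp)+
    have \<rho>: "\<rho>' * n - 1 \<le> \<rho>" "\<rho> \<le> \<rho>' * n" unfolding \<rho>_def using \<rho>' by (intro nat_floor_bounds, simp)+
    have K: "\<kappa> * n - 1 \<le> K" "K \<le> \<kappa> * n" unfolding K_def using \<kappa> by (intro nat_floor_bounds, simp)+
    have Mk: "M * (\<kappa> * n) = \<rho>' * n / 8" using \<kappa>(2) by (simp flip: mult.assoc)
    have kn: "0 \<le> \<kappa> * n" using \<kappa> by simp
    have kr: "\<kappa> * n \<le> \<rho>' * n / 8" using mult_right_mono[OF M(1) kn] Mk by simp
    obtain blk :: "nat \<Rightarrow> nat set set" where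
      blk: "\<And>c. blk c \<subseteq> proper_parts m" "\<And>c. card (blk c) \<le> m" "\<And>c. \<Union>(blk c) = {..<m}"
      and cnt: "\<And>S k. S \<subseteq> {..<m} \<Longrightarrow> S \<noteq> {} \<Longrightarrow>
       real (card {c \<in> {1..k}. S \<in> blk c}) \<le> (real k / (real l ^ m - real l) + 1) * (real l * real (l - 1) ^ (m - card S))"
      using ex_blocks[OF l m(1)] by blast
    show ?case
    proof (intro impI allI)
      fix E k assume ev: "even n" and E: "E \<subseteq> all_edges {..<n}"
        and typical: "bob_typical p m J \<kappa> \<delta> \<delta>' n E"
        and k: "real k \<le> (p / 2 - \<epsilon>) * n"
      have nd: "\<not> dense_pair n J \<kappa> q E Z F" for Z F using typical unfolding bob_typical_def q_def by blast
      show "\<not> alice_wins {..<n} E k"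
      proof (rule bob_wins[where m = m and blk = blk and C = C and \<rho> = \<rho> and \<kappa> = K and \<beta> = \<beta> and B = B and \<tau> = r0 and Q = Q,
            folded atom_def])
        show "even n" "2 \<le> m" "E \<subseteq> all_edges {..<n}" using ev m E by auto
        have "2 * real m < real n" using rn sc c0 gn by linarith
        then show "2 * m < n" by linarith
        show "4 * m \<le> C" unfolding C_def by simp
      next
        fix S U F assume S: "S \<in> proper_parts m" and U: "U \<subseteq> atom m n E S" "\<beta> \<le> card U"
          and F: "pairwise disjnt F" "\<And>Y. Y \<in> F \<Longrightarrow> Y \<subseteq> {m..<n} \<and> card Y \<le> C + 3 \<and> card (U - nbrs E Y) < \<rho>"
        show "card F \<le> K"
        proof (rule few_bad_sets[of n J \<kappa> q E U \<beta> F \<rho> K "g * n / 8"])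
          show "\<not> dense_pair n J \<kappa> q E Z F" for Z F by (rule nd)
          show "U \<subseteq> {..<n}" using U(1) unfolding atom_def by auto
          show "\<And>Y. Y \<in> F \<Longrightarrow> Y \<subseteq> {..<n} \<and> card Y \<le> J \<and> card (U - nbrs E Y) < \<rho>" using F(2) unfolding J_def by fastforce
          show "\<kappa> * n \<le> real K + 1" using K by simp
          show "\<kappa> * n \<le> g * n / 8" using kr sc rn c0 by linarith
          have "real J * (real K + 1) \<le> real J * (\<kappa> * n) + real J" using mult_left_mono[OF K(2), of "real J"] by (simp add: algebra_simps)
          also have "real J * (\<kappa> * n) \<le> M * (\<kappa> * n)" using M(2) kn by (rule mult_right_mono)
          finally show "real J * (real K + 1) + g * n / 8 \<le> real \<beta>" using Mk \<beta>(1) rn sc c0 by linarith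
          have "q / 2 * (g * n / 8) = q * g * n / 16" by simp
          then show "real \<rho> \<le> q / 2 * (g * n / 8)" using \<rho>(2) sc(2) rn c0 by linarith
        qed (use U F q in auto)
      next
        fix S Y assume S: "S \<in> proper_parts m" and Y: "Y \<subseteq> {m..<n}" "card Y \<le> C + 3"
        have "\<pi> * q - \<delta> \<le> w S * q - \<delta>" using w\<pi>[of S] S q by (simp add: mult_right_mono)
        then have "\<pi> * q / 2 \<le> w S * q - \<delta>" unfolding \<delta>_def by simp
        moreover from this have "0 \<le> w S * q - \<delta>" using \<pi> q by (meson divide_nonneg_nonneg le_less mult_nonneg_nonneg order_trans zero_le_numeral)
        moreover have "real n / 2 \<le> real n - m - J" using rn sc c0 gn by linarith
        ultimately have "\<pi> * q / 2 * (real n / 2) \<le> (w S * q - \<delta>) * (real n - m - J)"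
          using \<pi> q by (intro mult_mono) auto
        also have "\<dots> < card (atom m n E S - nbrs E Y)" using typical S Y unfolding bob_typical_def w_def q_def J_def by blast
        finally have "q * \<pi> * n / 4 < card (atom m n E S - nbrs E Y)" by (simp add: mult_ac)
        then have "real \<rho> + 2 * real m \<le> card (atom m n E S - nbrs E Y)" using \<rho>(2) sc(3) rn c0 by linarith
        then show "\<rho> + 2 * m \<le> card (atom m n E S - nbrs E Y)" by linarith
      next
        fix S assume part: "S \<in> proper_parts m"
        let ?N = "card {c \<in> {1..k}. S \<in> blk c}"
        from part have S: "S \<subseteq> {..<m}" "S \<noteq> {}" by auto
        have cS: "card S \<le> m" using S(1) card_mono[of "{..<m}" S] by simp
        have w1: "\<pi> \<le> w S" "w S \<le> 1" using w\<pi>[OF S(1)] p01 unfolding w_def by (auto intro!: mult_le_one power_le_one)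
        define X where "X = real l * real (l - 1) ^ (m - card S)"
        \<comment> \<open>Here \<open>p = 1 / l\<close> is decisive: the number of maps with fibre
          \<open>S\<close> is proportional to the density of the atom of \<open>S\<close>, so no
          atom is overloaded.\<close>
        have X: "X = real l * (real l ^ m * w S)"
        proof -
          have "real (l - 1) = real l * (1 - p)" unfolding p using l by (simp add: field_simps of_nat_diff)
          moreover have lp: "real l * p = 1" unfolding p using l by simp
          then have "p ^ card S * real l ^ card S = 1" by (metis mult.commute power_mult_distrib power_one)
          moreover have "real l ^ m = real l ^ card S * real l ^ (m - card S)" using cS by (simp flip: power_add)
          ultimately have "real l ^ m * w S = (real l * p) ^ card S * real (l - 1) ^ (m - card S)"
            unfolding w_def by (simp add: power_mult_distrib mult_ac)
          then show ?thesis unfolding X_def using lp by simp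
        qed
        have X0: "0 \<le> X" "X \<le> real l ^ (m + 1)"
        proof -
          show "0 \<le> X" unfolding X_def by simp
          have "real l * (real l ^ m * w S) \<le> real l * (real l ^ m * 1)" using w1 by (intro mult_left_mono) auto
          then show "X \<le> real l ^ (m + 1)" unfolding X by simp
        qed
        have lr: "real l \<le> e * real l ^ m" using m(2) e by (simp add: field_simps)
        have ll: "(1 - 2 * e) * real l ^ m \<le> (1 - e) * (real l ^ m - real l)"
        proof -
          have "(1 - e) * real l \<le> 1 * real l" using e by (intro mult_right_mono) auto
          then show ?thesis using lr by (simp add: algebra_simps)
        qed
        have lpos: "0 < real l ^ m - real l"
        proof -
          have "e * real l ^ m \<le> 1 / 4 * real l ^ m" using e by (intro mult_right_mono) auto
          moreover have "0 < real l ^ m" using l by simp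
          ultimately show ?thesis using lr by linarith
        qed
        have k2: "2 * real k * real l \<le> (1 - 2 * e) * n"
        proof -
          have "2 * real k * real l \<le> 2 * ((p / 2 - \<epsilon>) * n) * real l" using k by (intro mult_right_mono mult_left_mono) auto
          also have "\<dots> = (real l * p - 2 * e) * n" unfolding e_def by (simp add: algebra_simps)
          also have "real l * p = 1" unfolding p using l by simp
          finally show ?thesis .
        qed
        have "2 * (real k / (real l ^ m - real l) * X) = (2 * real k * real l) * (real l ^ m * w S / (real l ^ m - real l))"
          unfolding X by simp
        also have "\<dots> \<le> ((1 - 2 * e) * n) * (real l ^ m * w S / (real l ^ m - real l))"
          using k2 lpos w1 \<pi> by (intro mult_right_mono) auto
        also have "\<dots> = ((1 - 2 * e) * real l ^ m) * (n * w S) / (real l ^ m - real l)" by simp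
        also have "\<dots> \<le> ((1 - e) * (real l ^ m - real l)) * (n * w S) / (real l ^ m - real l)"
          using ll lpos w1 \<pi> by (intro divide_right_mono mult_right_mono) auto
        also have "\<dots> = (1 - e) * (n * w S)" using lpos by simp
        finally have t1: "2 * (real k / (real l ^ m - real l) * X) \<le> (1 - e) * (n * w S)" .
        have "real (?N) \<le> real k / (real l ^ m - real l) * X + X"
          using cnt[OF S, of k] unfolding X_def by (simp add: algebra_simps)
        then have t2: "2 * real (?N) \<le> (1 - e) * (n * w S) + 2 * real l ^ (m + 1)"
          using t1 X0(2) by linarith
        have "(w S - \<delta>') * (real n - m) < card (atom m n E S)" using typical S unfolding bob_typical_def w_def by blast
        moreover have "(w S - \<delta>') * (real n - m) = n * w S - \<delta>' * n - (w S - \<delta>') * m" by (simp add: algebra_simps)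
        moreover have "0 \<le> \<delta>'" unfolding \<delta>'_def using e \<pi> by simp
        then have "(w S - \<delta>') * m \<le> 1 * real m" using w1 by (intro mult_right_mono) auto
        ultimately have t3: "n * w S - \<delta>' * n - m \<le> card (atom m n E S)" by linarith
        have "e * (n * \<pi>) \<le> e * (n * w S)" using e w1 by (intro mult_left_mono) auto
        then have t4: "2 * (g * n) \<le> e * (n * w S)" unfolding g_def by (simp add: mult_ac)
        have t5: "\<delta>' * n = g * n / 2" unfolding \<delta>'_def g_def by simp
        have t6: "(1 - e) * (n * w S) = n * w S - e * (n * w S)" by (simp add: algebra_simps)
        define x where "x = n * w S"
        define y where "y = e * x"
        define z where "z = real l ^ (m + 1)"
        have "2 * real (?N) \<le> x - y + 2 * z"
          using t2 unfolding t6 z_def[symmetric] unfolding y_def x_def .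
        moreover have "x - g * n / 2 - m \<le> card (atom m n E S)" using t3 unfolding t5 x_def[symmetric] .
        moreover have "2 * (g * n) \<le> y" using t4 unfolding y_def x_def .
        moreover have "5 * real m + 2 * z \<le> c0" using c0(4) unfolding z_def .
        moreover have "2 * c0 \<le> g * n" using rn(1) sc(1) c0(1) by linarith
        ultimately have "2 * (real (?N) + m) + B + 2 * real m \<le> card (atom m n E S)"
          using B(2) region_slack by blast
        then have "real (2 * (?N + m) + B + 2 * m) \<le> real (card (atom m n E S))" by simp
        then show "2 * (?N + m) + B + 2 * m \<le> card (atom m n E S)" by (simp only: of_nat_le_iff)
      next
        have "real \<rho> \<le> real \<beta>" using \<rho>(2) \<beta>(1) sc rn c0 by linarith
        then show "\<rho> \<le> \<beta>" by linarith
        have "2 * real Q + 4 \<le> real \<rho>" using \<rho>(1) Q(2) rn c0 by linarith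
        then show "2 * Q + 4 \<le> \<rho>" by linarith
        have "2 * real r0 + 2 * real Q + real \<beta> \<le> real B" using r0(2) Q(2) \<beta>(2) B(1) sc rn c0 by linarith
        then have "real (2 * (r0 + Q) + \<beta>) \<le> real B" by simp
        then show "2 * (r0 + Q) + \<beta> \<le> B" by (simp only: of_nat_le_iff)
        have "card (proper_parts m) \<le> card (Pow {..<m})" by (intro card_mono) auto
        then have "card (proper_parts m) \<le> 2 ^ m" by (simp add: card_Pow)
        then have "(m + 1) * (card (proper_parts m) * (K * (C + 3)) * (m + 1))
           \<le> (m + 1) * (2 ^ m * (K * (C + 3)) * (m + 1))" by (intro mult_left_mono mult_right_mono) auto
        also have "\<dots> = ((m + 1) * 2 ^ m * J * (m + 1)) * K" unfolding J_def by (simp only: mult_ac)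
        also have "\<dots> \<le> Q"
        proof -
          have "M * real K \<le> M * (\<kappa> * n)" using K(2) M(1) by (intro mult_left_mono) auto
          then have "M * real K \<le> real Q" using Mk Q(1) rn c0 by linarith
          then have "real (((m + 1) * 2 ^ m * J * (m + 1)) * K) \<le> real Q" unfolding M_def by (simp only: of_nat_mult)
          then show ?thesis by (simp only: of_nat_le_iff)
        qed
        finally show "(m + 1) * (card (proper_parts m) * (K * (C + 3)) * (m + 1)) \<le> Q" .
        fix x assume x: "x * (C + 1 - 2 * m) \<le> n"
        have "16 * m / g \<le> real (C + 1 - 2 * m)" unfolding C_def by linarith
        then have "real x * (16 * m / g) \<le> real x * real (C + 1 - 2 * m)" by (intro mult_left_mono) auto
        also have "\<dots> = real (x * (C + 1 - 2 * m))" by simp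
        also have "\<dots> \<le> real n" using x by (rule of_nat_mono)
        finally have "16 * (real x * real m) \<le> g * n" using g by (simp add: field_simps)
        then have "real x * real m \<le> real r0" using r0(1) rn sc c0 by linarith
        then have "real (x * m) \<le> real r0" by simp
        then show "x * m \<le> r0" by (simp only: of_nat_le_iff)
      qed (use blk in auto)
    qed
  qed
  moreover have "0 < \<delta>" "0 < \<delta>'" unfolding \<delta>_def \<delta>'_def using e \<pi> q by auto
  ultimately show thesis using \<kappa>(1) by (intro that[of \<kappa> \<delta> \<delta>' m J]) auto
qed

section \<open>The eternal game chromatic number of random graphs\<close>

abbreviation (input) bad_prob :: "real \<Rightarrow> (nat \<Rightarrow> nat set set \<Rightarrow> bool) \<Rightarrow> nat \<Rightarrow> real" where
  "bad_prob p Bad n \<equiv> gnp_prob n p {E. E \<subseteq> all_edges {..<n} \<and> Bad n E}"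

text \<open>The exceptional graphs are explicit, so that deterministic statements for large even
  \<open>n\<close> and probability estimates combine by plain implication.\<close>

definition whp_even :: "real \<Rightarrow> (nat \<Rightarrow> nat set set \<Rightarrow> bool) \<Rightarrow> bool" where
  "whp_even p Good \<longleftrightarrow> (\<exists>Bad. bad_prob p Bad \<longlonglongrightarrow> 0 \<and>
     (\<forall>\<^sub>F n in sequentially. even n \<longrightarrow> (\<forall>E. E \<subseteq> all_edges {..<n} \<longrightarrow> \<not> Bad n E \<longrightarrow> Good n E)))"

lemma whp_even_conj:
  assumes "whp_even p A" "whp_even p B"
  shows "whp_even p (\<lambda>n E. A n E \<and> B n E)"
proof -
  obtain a where a: "bad_prob p a \<longlonglongrightarrow> 0"
    "\<forall>\<^sub>F n in sequentially. even n \<longrightarrow> (\<forall>E. E \<subseteq> all_edges {..<n} \<longrightarrow> \<not> a n E \<longrightarrow> A n E)"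
    using assms(1) unfolding whp_even_def by blast
  obtain b where b: "bad_prob p b \<longlonglongrightarrow> 0"
    "\<forall>\<^sub>F n in sequentially. even n \<longrightarrow> (\<forall>E. E \<subseteq> all_edges {..<n} \<longrightarrow> \<not> b n E \<longrightarrow> B n E)"
    using assms(2) unfolding whp_even_def by blast
  have le: "gnp_prob n p {E. E \<subseteq> all_edges {..<n} \<and> (a n E \<or> b n E)}
     \<le> bad_prob p a n + bad_prob p b n" for n
  proof -
    have "{E. E \<subseteq> all_edges {..<n} \<and> (a n E \<or> b n E)} = {E. E \<subseteq> all_edges {..<n} \<and> a n E} \<union> {E. E \<subseteq> all_edges {..<n} \<and> b n E}" by auto
    then show ?thesis by (simp add: measure_Un_le)
  qed
  have "(\<lambda>n. bad_prob p a n + bad_prob p b n) \<longlonglongrightarrow> 0"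
    using tendsto_add[OF a(1) b(1)] by simp
  then have "(\<lambda>n. gnp_prob n p {E. E \<subseteq> all_edges {..<n} \<and> (a n E \<or> b n E)}) \<longlonglongrightarrow> 0"
    by (rule tendsto_sandwich[OF _ _ tendsto_const, rotated 2]) (simp_all add: le)
  moreover have "\<forall>\<^sub>F n in sequentially. even n \<longrightarrow> (\<forall>E. E \<subseteq> all_edges {..<n} \<longrightarrow> \<not> (a n E \<or> b n E) \<longrightarrow> A n E \<and> B n E)"
    using a(2) b(2) by eventually_elim blast
  ultimately show ?thesis
    unfolding whp_even_def by (intro exI[of _ "\<lambda>n E. a n E \<or> b n E"] conjI)
qed

lemma whp_even_mono:
  assumes "whp_even p A" "\<And>n E. 0 < n \<Longrightarrow> E \<subseteq> all_edges {..<n} \<Longrightarrow> A n E \<Longrightarrow> B n E"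
  shows "whp_even p B"
proof -
  obtain a where a: "bad_prob p a \<longlonglongrightarrow> 0"
    "\<forall>\<^sub>F n in sequentially. even n \<longrightarrow> (\<forall>E. E \<subseteq> all_edges {..<n} \<longrightarrow> \<not> a n E \<longrightarrow> A n E)"
    using assms(1) unfolding whp_even_def by blast
  have "\<forall>\<^sub>F n in sequentially. even n \<longrightarrow> (\<forall>E. E \<subseteq> all_edges {..<n} \<longrightarrow> \<not> a n E \<longrightarrow> B n E)"
    using a(2) eventually_gt_at_top[of 0] by eventually_elim (use assms(2) in blast)
  then show ?thesis using a(1) unfolding whp_even_def by blast
qed

lemma whp_even_not:
  assumes "bad_prob p B \<longlonglongrightarrow> 0"
  shows "whp_even p (\<lambda>n E. \<not> B n E)"
  unfolding whp_even_def using assms by (intro exI[of _ B]) simp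

lemma whp_even_not':
  assumes "(\<lambda>n. gnp_prob n p {E. B n E}) \<longlonglongrightarrow> 0"
  shows "whp_even p (\<lambda>n E. \<not> B n E)"
proof (rule whp_even_not, rule tendsto_sandwich[OF _ _ tendsto_const assms])
  show "\<forall>\<^sub>F n in sequentially. bad_prob p B n \<le> gnp_prob n p {E. B n E}"
    by (intro always_eventually allI measure_pmf.finite_measure_mono) auto
qed simp

lemma whp_even_eventually:
  assumes "\<forall>\<^sub>F n in sequentially. even n \<longrightarrow> (\<forall>E. E \<subseteq> all_edges {..<n} \<longrightarrow> A n E)"
  shows "whp_even p A"
  unfolding whp_even_def using assms by (intro exI[of _ "\<lambda>_ _. False"]) simp

lemma whp_even_tendsto:
  assumes "whp_even p A"
  shows "((\<lambda>n. gnp_prob n p {E. A n E}) \<longlongrightarrow> 1) even_at_top"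
proof -
  obtain a where a: "bad_prob p a \<longlonglongrightarrow> 0"
    "\<forall>\<^sub>F n in sequentially. even n \<longrightarrow> (\<forall>E. E \<subseteq> all_edges {..<n} \<longrightarrow> \<not> a n E \<longrightarrow> A n E)"
    using assms unfolding whp_even_def by blast
  have le: "even_at_top \<le> sequentially" unfolding even_at_top_def by simp
  have "(\<lambda>n. 1 - bad_prob p a n) \<longlonglongrightarrow> 1 - 0"
    by (intro tendsto_diff tendsto_const a(1))
  then have lim: "((\<lambda>n. 1 - bad_prob p a n) \<longlongrightarrow> 1) even_at_top"
    using tendsto_mono[OF le] by simp
  show ?thesis
  proof (rule tendsto_sandwich[OF _ _ lim tendsto_const])
    show "\<forall>\<^sub>F n in even_at_top. 1 - bad_prob p a n \<le> gnp_prob n p {E. A n E}"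
      unfolding even_at_top_def eventually_inf_principal
      using a(2)
    proof eventually_elim
      case (elim n)
      show ?case
      proof
        assume "n \<in> {n. even n}"
        then have imp: "A n E" if "E \<subseteq> all_edges {..<n}" "\<not> a n E" for E using elim that by auto
        let ?B = "{E. E \<subseteq> all_edges {..<n} \<and> a n E}"
        have "1 - gnp_prob n p ?B = gnp_prob n p (UNIV - ?B)"
          using measure_pmf.prob_compl[of ?B "gnp n p"] by simp
        also have "\<dots> \<le> gnp_prob n p {E. A n E}"
          by (rule measure_pmf.finite_measure_mono_AE) (use imp gnp_support in \<open>auto simp: AE_measure_pmf_iff\<close>)
        finally show "1 - gnp_prob n p ?B \<le> gnp_prob n p {E. A n E}" .
      qed
    qed
  qed simp
qed

lemma eternal_chi_upper:
  fixes p \<epsilon> :: real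
  assumes p: "0 < p" "p < 1" and eps: "0 < \<epsilon>"
  shows "whp_even p (\<lambda>n E. real (eternal_chi {..<n} E) \<le> (1 + \<epsilon>) * (p * real n / 2))"
proof -
  \<comment> \<open>Truncation keeps the slack at most one; a smaller \<open>\<epsilon>'\<close>
    gives a stronger bound.\<close>
  define \<epsilon>' where "\<epsilon>' = min \<epsilon> 1"
  have e': "0 < \<epsilon>'" "\<epsilon>' \<le> 1" "\<epsilon>' \<le> \<epsilon>" using eps unfolding \<epsilon>'_def by auto
  obtain J \<kappa> \<delta> where par: "0 < \<kappa>" "0 < \<delta>" and ev:
    "\<forall>\<^sub>F n in sequentially. even n \<longrightarrow> (\<forall>E. E \<subseteq> all_edges {..<n} \<longrightarrow> alice_typical p J \<kappa> \<delta> n E \<longrightarrow>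
       alice_wins {..<n} E (nat \<lfloor>(1 + \<epsilon>') * (p * real n / 2)\<rfloor>))"
    by (rule alice_wins_random[OF p e'(1,2)])
  have "whp_even p (alice_typical p J \<kappa> \<delta>)"
    by (rule whp_even_mono[OF whp_even_conj[OF whp_even_not'[OF dense_pair_whp[OF p par(1), of J]]
          whp_even_not[OF degree_whp[OF p par(2)]]]])
       (auto simp: alice_typical_def not_less)
  note whp = whp_even_conj[OF whp_even_eventually[OF ev] this]
  show ?thesis
  proof (rule whp_even_mono[OF whp])
    fix n :: nat and E :: "nat set set"
    assume "(alice_typical p J \<kappa> \<delta> n E \<longrightarrow> alice_wins {..<n} E (nat \<lfloor>(1 + \<epsilon>') * (p * real n / 2)\<rfloor>)) \<and>
      alice_typical p J \<kappa> \<delta> n E"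
    then have "alice_wins {..<n} E (nat \<lfloor>(1 + \<epsilon>') * (p * real n / 2)\<rfloor>)" by blast
    then have "eternal_chi {..<n} E \<le> nat \<lfloor>(1 + \<epsilon>') * (p * real n / 2)\<rfloor>"
      unfolding eternal_chi_def by (rule Least_le)
    then have "real (eternal_chi {..<n} E) \<le> real (nat \<lfloor>(1 + \<epsilon>') * (p * real n / 2)\<rfloor>)" by simp
    also have "\<dots> \<le> (1 + \<epsilon>') * (p * real n / 2)" using p e' by (intro nat_floor_bounds) simp
    also have "\<dots> \<le> (1 + \<epsilon>) * (p * real n / 2)" using p e' by (intro mult_right_mono) auto
    finally show "real (eternal_chi {..<n} E) \<le> (1 + \<epsilon>) * (p * real n / 2)" .
  qed
qed

lemma eternal_chi_lower:
  fixes p \<epsilon> :: real and l :: nat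
  assumes p: "0 < p" "p < 1" "p = 1 / real l" and eps: "0 < \<epsilon>"
  shows "whp_even p (\<lambda>n E. (p / 2 - \<epsilon>) * real n \<le> real (eternal_chi {..<n} E))"
proof -
  have l: "2 \<le> l"
  proof -
    have "l \<noteq> 0" "l \<noteq> 1" using p by auto
    then show ?thesis by linarith
  qed
  define \<epsilon>' where "\<epsilon>' = min \<epsilon> (p / 4)"
  have e': "0 < \<epsilon>'" "\<epsilon>' \<le> p / 4" "\<epsilon>' \<le> \<epsilon>" using eps p unfolding \<epsilon>'_def by auto
  obtain m J \<kappa> \<delta> \<delta>' where par: "0 < \<kappa>" "0 < \<delta>" "0 < \<delta>'" and ev:
    "\<forall>\<^sub>F n in sequentially. even n \<longrightarrow> (\<forall>E. E \<subseteq> all_edges {..<n} \<longrightarrow> bob_typical p m J \<kappa> \<delta> \<delta>' n E \<longrightarrow>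
       (\<forall>k. real k \<le> (p / 2 - \<epsilon>') * n \<longrightarrow> \<not> alice_wins {..<n} E k))"
    by (rule bob_wins_random[OF l p(3) e'(1,2)])
  have "whp_even p (bob_typical p m J \<kappa> \<delta> \<delta>')"
  proof (rule whp_even_mono[OF whp_even_conj[OF whp_even_not'[OF dense_pair_whp[OF p(1,2) par(1), of J]]
        whp_even_conj[OF whp_even_not'[OF atom_whp[OF p(1,2) par(2), of m J]]
        whp_even_not'[OF atom_whp[OF p(1,2) par(3), of m 0]]]]], elim conjE)
    fix n :: nat and E :: "nat set set"
    assume 1: "\<not> (\<exists>Z F. dense_pair n J \<kappa> ((1 - p) ^ J) E Z F)"
      and 2: "\<not> (\<exists>S Y. S \<subseteq> {..<m} \<and> Y \<subseteq> {m..<n} \<and> card Y \<le> J \<and>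
         card (atom m n E S - nbrs E Y) \<le> (p ^ card S * (1 - p) ^ (m - card S) * (1 - p) ^ J - \<delta>) * (real n - m - J))"
      and 3: "\<not> (\<exists>S Y. S \<subseteq> {..<m} \<and> Y \<subseteq> {m..<n} \<and> card Y \<le> 0 \<and>
         card (atom m n E S - nbrs E Y) \<le> (p ^ card S * (1 - p) ^ (m - card S) * (1 - p) ^ 0 - \<delta>') * (real n - m - real 0))"
    have "(p ^ card S * (1 - p) ^ (m - card S) - \<delta>') * (real n - m) < card (atom m n E S)" if "S \<subseteq> {..<m}" for S
    proof -
      have "nbrs E {} = {}" by (simp add: nbrs_def)
      moreover have "\<not> (card (atom m n E S - nbrs E {}) \<le> (p ^ card S * (1 - p) ^ (m - card S) * (1 - p) ^ 0 - \<delta>') * (real n - m - real 0))"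
        using 3 that by (metis card.empty empty_subsetI order_refl)
      ultimately show ?thesis by simp
    qed
    then show "bob_typical p m J \<kappa> \<delta> \<delta>' n E" unfolding bob_typical_def using 1 2 by (meson not_less)
  qed
  note whp = whp_even_conj[OF whp_even_eventually[OF ev] this]
  show ?thesis
  proof (rule whp_even_mono[OF whp], elim conjE)
    fix n :: nat and E :: "nat set set"
    assume n: "0 < n" and E: "E \<subseteq> all_edges {..<n}"
    assume "bob_typical p m J \<kappa> \<delta> \<delta>' n E \<longrightarrow> (\<forall>k. real k \<le> (p / 2 - \<epsilon>') * n \<longrightarrow> \<not> alice_wins {..<n} E k)"
      and "bob_typical p m J \<kappa> \<delta> \<delta>' n E"
    then have lose: "\<not> alice_wins {..<n} E k" if "real k \<le> (p / 2 - \<epsilon>') * n" for k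
      using that by blast
    \<comment> \<open>With one winning number at hand, the least one is itself winning, and Bob's
      victories exclude every \<open>k\<close> up to the bound.\<close>
    have "alice_wins {..<n} E (Suc (card {..<n}))" using n E by (intro alice_wins_card) auto
    then have "alice_wins {..<n} E (eternal_chi {..<n} E)" unfolding eternal_chi_def by (rule LeastI)
    then have "\<not> real (eternal_chi {..<n} E) \<le> (p / 2 - \<epsilon>') * n" using lose by blast
    moreover have "(p / 2 - \<epsilon>) * n \<le> (p / 2 - \<epsilon>') * n" using e' by (intro mult_right_mono) auto
    ultimately show "(p / 2 - \<epsilon>) * real n \<le> real (eternal_chi {..<n} E)" by linarith
  qed
qed

theorem theorem2:
  fixes p :: real
  assumes "0 < p" and "p < 1"
  shows
    "(\<forall>\<epsilon>::real. \<epsilon> > 0 \<longrightarrow>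
       ((\<lambda>n. measure_pmf.prob (gnp n p)
           {E. real (eternal_chi {..<n} E) \<le> (1 + \<epsilon>) * (p * real n / 2)}) \<longlongrightarrow> 1) even_at_top)
     \<and>
     ((\<exists>l::nat. p = 1 / real l) \<longrightarrow>
       (\<forall>\<epsilon>::real. \<epsilon> > 0 \<longrightarrow>
         ((\<lambda>n. measure_pmf.prob (gnp n p)
             {E. \<bar>real (eternal_chi {..<n} E) - p * real n / 2\<bar> \<le> \<epsilon> * real n}) \<longlongrightarrow> 1) even_at_top))"
proof (intro conjI allI impI)
  fix \<epsilon> :: real assume "\<epsilon> > 0"
  then show "((\<lambda>n. measure_pmf.prob (gnp n p)
           {E. real (eternal_chi {..<n} E) \<le> (1 + \<epsilon>) * (p * real n / 2)}) \<longlongrightarrow> 1) even_at_top"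
    by (intro whp_even_tendsto eternal_chi_upper assms)
next
  fix \<epsilon> :: real assume "\<exists>l::nat. p = 1 / real l" and eps: "\<epsilon> > 0"
  then obtain l :: nat where l: "p = 1 / real l" by blast
  show "((\<lambda>n. measure_pmf.prob (gnp n p)
             {E. \<bar>real (eternal_chi {..<n} E) - p * real n / 2\<bar> \<le> \<epsilon> * real n}) \<longlongrightarrow> 1) even_at_top"
  proof (rule whp_even_tendsto, rule whp_even_mono[OF whp_even_conj[OF
        eternal_chi_upper[OF assms eps] eternal_chi_lower[OF assms l eps]]], elim conjE)
    fix n :: nat and E :: "nat set set"
    assume u: "real (eternal_chi {..<n} E) \<le> (1 + \<epsilon>) * (p * real n / 2)"
      and lo: "(p / 2 - \<epsilon>) * real n \<le> real (eternal_chi {..<n} E)"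
    have "\<epsilon> * real n * (p / 2) \<le> \<epsilon> * real n * 1" using assms eps by (intro mult_left_mono) auto
    then have "(1 + \<epsilon>) * (p * real n / 2) \<le> p * real n / 2 + \<epsilon> * real n" by (simp add: algebra_simps)
    moreover have "(p / 2 - \<epsilon>) * real n = p * real n / 2 - \<epsilon> * real n" by (simp add: algebra_simps)
    ultimately show "\<bar>real (eternal_chi {..<n} E) - p * real n / 2\<bar> \<le> \<epsilon> * real n" using u lo by linarith
  qed
qed



end
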